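(* Let $P(\zeta)=\sum_{|\alpha|\le m}a_\alpha\zeta^\alpha$ be a polynomial on $\mathbb{C}^n$ with coefficients $a_\alpha\in\widetilde{\mathbb{C}}$ fulfilling the following conditions: (i) there exist a choice of representatives $(a_{\alpha,\varepsilon})_\varepsilon$ of the $a_\alpha$, a net $(c_\varepsilon)_\varepsilon\in\mathbb{R}^{(0,1]}$ of the form $c_\varepsilon=c\,\omega_\varepsilon$ with $c<0$ and $$\exists c_0,a>0\ \forall\varepsilon\in(0,1]\qquad c_0\varepsilon^a\le\omega_\varepsilon\le\log(1/\varepsilon)+1,$$ and a constant $\varepsilon_0>0$ such that $$P_\varepsilon(\xi',\zeta_n):=\sum_{|\alpha|\le m}a_{\alpha,\varepsilon}(\xi',\zeta_n)^\alpha\neq0$$ for all $\varepsilon\in(0,\varepsilon_0]$, all $\xi'\in\mathbb{R}^{n-1}$ and all $\zeta_n=\xi_n+i\eta_n$ ($\xi_n,\eta_n\in\mathbb{R}$) with $\eta_n<c_\varepsilon$; (ii) the coefficient of the highest power of $\zeta_n$ in $P$ is an invertible element of $\widetilde{\mathbb{C}}$. Then $P(D)=\sum_{|\alpha|\le m}a_\alpha D^\alpha$ is an evolution operator with respect to $H_n=\{x\in\mathbb{R}^n:x_n\ge0\}$; that is, it has a fundamental solution in $\mathcal{L}_{\rm b}(\mathcal{G}_c(\mathbb{R}^n),\widetilde{\mathbb{C}})$ whose support is contained in $H_n$.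
   Context: All nets are indexed by $\varepsilon\in(0,1]$; $O(\cdot)$ is as $\varepsilon\to0$. $\widetilde{\mathbb{C}}$ is the ring of complex nets that are moderate ($\exists N\in\mathbb{N}$: $|r_\varepsilon|=O(\varepsilon^{-N})$) modulo negligible nets ($\forall q\in\mathbb{N}$: $|r_\varepsilon|=O(\varepsilon^{q})$). $\mathcal{G}(\Omega)$ ($\Omega\subseteq\mathbb{R}^n$ open) is the Colombeau algebra: nets $(u_\varepsilon)_\varepsilon$ in $C^\infty(\Omega)$ with $\forall K\Subset\Omega\,\forall\alpha\,\exists N$: $\sup_K|\partial^\alpha u_\varepsilon|=O(\varepsilon^{-N})$, modulo nets with $\forall K\,\forall\alpha\,\forall q$: $\sup_K|\partial^\alpha u_\varepsilon|=O(\varepsilon^q)$. $\mathcal{G}_c(\Omega)$ consists of the elements with compact support (representatives are chosen with supports in one compact set independent of $\varepsilon$). Topology: for $K\Subset\Omega$, $\mathcal{G}_K(\Omega)=\{u\in\mathcal{G}_c(\Omega):\mathrm{supp}\,u\subseteq K\}$ carries the ultra-pseudo-seminorms $e^{-\mathrm{v}_{K,j}(u)}$, $\mathrm{v}_{K,j}(u)=\sup\{b\in\mathbb{R}:\sup_{x\in K',|\alpha|\le j}|\partial^\alpha u_\varepsilon(x)|=O(\varepsilon^b)\}$, with $K'\Subset\Omega$ a compact neighbourhood of $K$ (choice irrelevant); $\mathcal{G}_c(\Omega)$ is the strict inductive limit of the $\mathcal{G}_{K}(\Omega)$; $\widetilde{\mathbb{C}}$ carries $|r|_{\rm e}=e^{-\mathrm{v}(r)}$,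 $\mathrm{v}(r)=\sup\{b:|r_\varepsilon|=O(\varepsilon^b)\}$. $\mathcal{L}(\mathcal{G}_c(\Omega),\widetilde{\mathbb{C}})$ is the set of continuous $\widetilde{\mathbb{C}}$-linear functionals. Such a $T$ is basic, $T\in\mathcal{L}_{\rm b}(\mathcal{G}_c(\Omega),\widetilde{\mathbb{C}})$, if there is a net $(T_\varepsilon)_\varepsilon$ in $\mathcal{D}'(\Omega)$ such that $\forall K\Subset\Omega\ \exists j,N\in\mathbb{N},c>0,\eta\in(0,1]$ with $|T_\varepsilon(f)|\le c\,\varepsilon^{-N}\sup_{x\in K,|\alpha|\le j}|\partial^\alpha f(x)|$ for all $f\in C^\infty_K(\Omega)$, $\varepsilon\in(0,\eta]$, and $T(u)=[(T_\varepsilon(u_\varepsilon))_\varepsilon]$ for all $u\in\mathcal{G}_c(\Omega)$. $\Omega\mapsto\mathcal{L}(\mathcal{G}_c(\Omega),\widetilde{\mathbb{C}})$ is a sheaf; $\mathrm{supp}\,T$ is the complement of the largest open set on which $T$ restricts to $0$. $D^\alpha=(-i)^{|\alpha|}\partial^\alpha$; $P(D)T(u)=T({}^tP(D)u)$ with ${}^tP(D)=\sum(-1)^{|\alpha|}a_\alpha D^\alpha$. A fundamental solution of $P(D)$ is $E\in\mathcal{L}(\mathcal{G}_c(\mathbb{R}^n),\widetilde{\mathbb{C}})$ with $P(D)E=\iota_d(\delta)$, where $\iota_d(\delta)(u)=[(u_\varepsilon(0))_\varepsilon]$. *)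

theory Defs
  imports "HOL-Analysis.Analysis" "HOL-Library.Landau_Symbols"
begin

section \<open>Asymptotic scales\<close>

text \<open>Nets indexed by \<open>\<epsilon> \<in> (0,1]\<close> are total functions on \<^typ>\<open>real\<close>; values outside \<open>(0,1]\<close>
  are never looked at. The filter \<^term>\<open>at_right (0::real)\<close> is \<open>\<epsilon> \<rightarrow> 0\<close> within \<open>(0,1]\<close>.\<close>

definition eps_moderate :: "(real \<Rightarrow> real) \<Rightarrow> bool" where
  "eps_moderate f \<longleftrightarrow> (\<exists>N::nat. f \<in> O[at_right 0](\<lambda>\<epsilon>. \<epsilon> powr (- real N)))"

definition eps_negligible :: "(real \<Rightarrow> real) \<Rightarrow> bool" where
  "eps_negligible f \<longleftrightarrow> (\<forall>q::nat. f \<in> O[at_right 0](\<lambda>\<epsilon>. \<epsilon> powr (real q)))"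

lemma ev_eps: "eventually (\<lambda>\<epsilon>. \<epsilon> \<in> {0<..1::real}) (at_right 0)"
  using eventually_at_right_real[of 0 "1::real"] by (auto elim: eventually_mono)

lemma powr_bigo_mono:
  assumes "f \<in> O[at_right 0](\<lambda>\<epsilon>::real. \<epsilon> powr b)" "b' \<le> b"
  shows "f \<in> O[at_right 0](\<lambda>\<epsilon>. \<epsilon> powr b')"
proof -
  have "(\<lambda>\<epsilon>. \<epsilon> powr b) \<in> O[at_right 0](\<lambda>\<epsilon>::real. \<epsilon> powr b')"
    by (rule bigoI[of _ 1], rule eventually_mono[OF ev_eps]) (use assms(2) in \<open>auto intro: powr_mono'\<close>)
  with assms(1) show ?thesis by (rule landau_o.big_trans)
qed

lemma bigo_dom:
  assumes "g \<in> O[at_right 0](h)" "\<And>\<epsilon>. \<epsilon> \<in> {0<..1} \<Longrightarrow> \<bar>f \<epsilon>\<bar> \<le> \<bar>g \<epsilon> :: real\<bar>"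
  shows "f \<in> O[at_right (0::real)](h)"
proof -
  have "f \<in> O[at_right (0::real)](g)"
    by (rule bigoI[of _ 1], rule eventually_mono[OF ev_eps]) (use assms(2) in auto)
  then show ?thesis using assms(1) by (rule landau_o.big_trans)
qed

lemma eps_moderate_dom:
  "eps_moderate g \<Longrightarrow> (\<And>\<epsilon>. \<epsilon> \<in> {0<..1} \<Longrightarrow> \<bar>f \<epsilon>\<bar> \<le> \<bar>g \<epsilon>\<bar>) \<Longrightarrow> eps_moderate f"
  unfolding eps_moderate_def using bigo_dom by blast

lemma eps_negligible_dom:
  "eps_negligible g \<Longrightarrow> (\<And>\<epsilon>. \<epsilon> \<in> {0<..1} \<Longrightarrow> \<bar>f \<epsilon>\<bar> \<le> \<bar>g \<epsilon>\<bar>) \<Longrightarrow> eps_negligible f"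
  unfolding eps_negligible_def using bigo_dom by blast

lemma eps_moderate_add:
  assumes "eps_moderate f" "eps_moderate g" shows "eps_moderate (\<lambda>\<epsilon>. f \<epsilon> + g \<epsilon>)"
proof -
  obtain N M :: nat where f: "f \<in> O[at_right 0](\<lambda>\<epsilon>. \<epsilon> powr (- real N))"
    and g: "g \<in> O[at_right 0](\<lambda>\<epsilon>. \<epsilon> powr (- real M))"
    using assms unfolding eps_moderate_def by blast
  have "f \<in> O[at_right 0](\<lambda>\<epsilon>. \<epsilon> powr (- real (max N M)))"
    "g \<in> O[at_right 0](\<lambda>\<epsilon>. \<epsilon> powr (- real (max N M)))"
    by (rule powr_bigo_mono[OF f], simp) (rule powr_bigo_mono[OF g], simp)
  then show ?thesis unfolding eps_moderate_def using sum_in_bigo(1) by blast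
qed

lemma eps_negligible_add:
  "eps_negligible f \<Longrightarrow> eps_negligible g \<Longrightarrow> eps_negligible (\<lambda>\<epsilon>. f \<epsilon> + g \<epsilon>)"
  unfolding eps_negligible_def using sum_in_bigo(1) by blast

lemma eps_moderate_mult:
  assumes "eps_moderate f" "eps_moderate g" shows "eps_moderate (\<lambda>\<epsilon>. f \<epsilon> * g \<epsilon>)"
proof -
  obtain N M :: nat where f: "f \<in> O[at_right 0](\<lambda>\<epsilon>. \<epsilon> powr (- real N))"
    and g: "g \<in> O[at_right 0](\<lambda>\<epsilon>. \<epsilon> powr (- real M))"
    using assms unfolding eps_moderate_def by blast
  have "(\<lambda>\<epsilon>. f \<epsilon> * g \<epsilon>) \<in> O[at_right 0](\<lambda>\<epsilon>. \<epsilon> powr (- real (N + M)))"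
    using landau_o.big.mult[OF f g] by (simp add: powr_add[symmetric])
  then show ?thesis unfolding eps_moderate_def by blast
qed

lemma eps_negligible_mult:
  assumes "eps_moderate f" "eps_negligible g" shows "eps_negligible (\<lambda>\<epsilon>. f \<epsilon> * g \<epsilon>)"
  unfolding eps_negligible_def
proof
  fix q :: nat
  obtain N :: nat where f: "f \<in> O[at_right 0](\<lambda>\<epsilon>. \<epsilon> powr (- real N))"
    using assms unfolding eps_moderate_def by blast
  have g: "g \<in> O[at_right 0](\<lambda>\<epsilon>. \<epsilon> powr (real (N + q)))"
    using assms unfolding eps_negligible_def by blast
  show "(\<lambda>\<epsilon>. f \<epsilon> * g \<epsilon>) \<in> O[at_right 0](\<lambda>\<epsilon>. \<epsilon> powr (real q))"
    using landau_o.big.mult[OF f g] by (simp add: powr_add[symmetric])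
qed

lemma eps_moderate_powr: "eps_moderate (\<lambda>\<epsilon>. \<epsilon> powr b)"
proof -
  have "- real (nat \<lceil>\<bar>b\<bar>\<rceil>) \<le> b" by linarith
  then show ?thesis unfolding eps_moderate_def using powr_bigo_mono[OF landau_o.big_refl] by blast
qed

lemma eps_moderate_const [simp]: "eps_moderate (\<lambda>\<epsilon>. c)"
proof -
  have "(\<lambda>\<epsilon>::real. c) \<in> O[at_right 0](\<lambda>\<epsilon>. \<epsilon> powr (- real 0))"
    by (rule bigoI[of _ "\<bar>c\<bar>"], rule eventually_mono[OF ev_eps]) auto
  then show ?thesis unfolding eps_moderate_def by blast
qed

lemma eps_negligible_zero [simp]: "eps_negligible (\<lambda>\<epsilon>. 0)"
  unfolding eps_negligible_def by simp

lemma eps_negligible_imp_bigo: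
  assumes "eps_negligible f" shows "f \<in> O[at_right 0](\<lambda>\<epsilon>. \<epsilon> powr b)"
proof -
  have "b \<le> real (nat \<lceil>\<bar>b\<bar>\<rceil>)" by linarith
  then show ?thesis using assms powr_bigo_mono unfolding eps_negligible_def by blast
qed

section \<open>The ring of complex generalized numbers\<close>

definition gc_moderate :: "(real \<Rightarrow> complex) \<Rightarrow> bool" where
  "gc_moderate r \<longleftrightarrow> eps_moderate (\<lambda>\<epsilon>. norm (r \<epsilon>))"

definition gc_negligible :: "(real \<Rightarrow> complex) \<Rightarrow> bool" where
  "gc_negligible r \<longleftrightarrow> eps_negligible (\<lambda>\<epsilon>. norm (r \<epsilon>))"

definition gc_rel :: "(real \<Rightarrow> complex) \<Rightarrow> (real \<Rightarrow> complex) \<Rightarrow> bool" where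
  "gc_rel r s \<longleftrightarrow> gc_moderate r \<and> gc_moderate s \<and> gc_negligible (\<lambda>\<epsilon>. r \<epsilon> - s \<epsilon>)"

lemma gc_moderate_const [simp]: "gc_moderate (\<lambda>\<epsilon>. c)"
  by (simp add: gc_moderate_def)

lemma gc_moderate_add: "gc_moderate r \<Longrightarrow> gc_moderate s \<Longrightarrow> gc_moderate (\<lambda>\<epsilon>. r \<epsilon> + s \<epsilon>)"
  unfolding gc_moderate_def
  by (rule eps_moderate_dom[OF eps_moderate_add[of "\<lambda>\<epsilon>. norm (r \<epsilon>)" "\<lambda>\<epsilon>. norm (s \<epsilon>)"]])
     (auto intro: norm_triangle_ineq)

lemma gc_moderate_mult: "gc_moderate r \<Longrightarrow> gc_moderate s \<Longrightarrow> gc_moderate (\<lambda>\<epsilon>. r \<epsilon> * s \<epsilon>)"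
  unfolding gc_moderate_def using eps_moderate_mult by (auto simp: norm_mult)

lemma gc_moderate_uminus: "gc_moderate r \<Longrightarrow> gc_moderate (\<lambda>\<epsilon>. - r \<epsilon>)"
  unfolding gc_moderate_def by simp

lemma gc_negligible_zero [simp]: "gc_negligible (\<lambda>\<epsilon>. 0)"
  by (simp add: gc_negligible_def)

lemma gc_negligible_add: "gc_negligible r \<Longrightarrow> gc_negligible s \<Longrightarrow> gc_negligible (\<lambda>\<epsilon>. r \<epsilon> + s \<epsilon>)"
  unfolding gc_negligible_def
  by (rule eps_negligible_dom[OF eps_negligible_add[of "\<lambda>\<epsilon>. norm (r \<epsilon>)" "\<lambda>\<epsilon>. norm (s \<epsilon>)"]])
     (auto intro: norm_triangle_ineq)

lemma gc_negligible_mult: "gc_moderate r \<Longrightarrow> gc_negligible s \<Longrightarrow> gc_negligible (\<lambda>\<epsilon>. r \<epsilon> * s \<epsilon>)"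
  unfolding gc_moderate_def gc_negligible_def using eps_negligible_mult by (auto simp: norm_mult)

lemma gc_negligible_uminus: "gc_negligible r \<Longrightarrow> gc_negligible (\<lambda>\<epsilon>. - r \<epsilon>)"
  unfolding gc_negligible_def by simp

lemma part_equivp_gc_rel: "part_equivp gc_rel"
proof (rule part_equivpI)
  show "\<exists>x. gc_rel x x"
    by (rule exI[of _ "\<lambda>_. 0"]) (simp add: gc_rel_def)
  show "symp gc_rel"
    by (rule sympI) (auto simp: gc_rel_def dest: gc_negligible_uminus)
  show "transp gc_rel"
  proof (rule transpI)
    fix r s t assume "gc_rel r s" "gc_rel s t"
    then show "gc_rel r t"
      using gc_negligible_add[of "\<lambda>\<epsilon>. r \<epsilon> - s \<epsilon>" "\<lambda>\<epsilon>. s \<epsilon> - t \<epsilon>"] by (auto simp: gc_rel_def)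
  qed
qed

quotient_type gcomplex = "real \<Rightarrow> complex" / partial: gc_rel
  by (rule part_equivp_gc_rel)

definition gc_represents :: "(real \<Rightarrow> complex) \<Rightarrow> gcomplex \<Rightarrow> bool" where
  "gc_represents r z \<longleftrightarrow> gc_moderate r \<and> abs_gcomplex r = z"

instantiation gcomplex :: comm_ring_1
begin

lift_definition zero_gcomplex :: gcomplex is "\<lambda>\<epsilon>. 0" by (simp add: gc_rel_def)

lift_definition one_gcomplex :: gcomplex is "\<lambda>\<epsilon>. 1" by (simp add: gc_rel_def)

lift_definition plus_gcomplex :: "gcomplex \<Rightarrow> gcomplex \<Rightarrow> gcomplex" is "\<lambda>r s \<epsilon>. r \<epsilon> + s \<epsilon>"
proof -
  fix r r' s s' assume *: "gc_rel r r'" "gc_rel s s'"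
  then have "gc_negligible (\<lambda>\<epsilon>. (r \<epsilon> - r' \<epsilon>) + (s \<epsilon> - s' \<epsilon>))"
    unfolding gc_rel_def by (intro gc_negligible_add) auto
  with * show "gc_rel (\<lambda>\<epsilon>. r \<epsilon> + s \<epsilon>) (\<lambda>\<epsilon>. r' \<epsilon> + s' \<epsilon>)"
    by (simp add: gc_rel_def gc_moderate_add add_diff_add)
qed

lift_definition uminus_gcomplex :: "gcomplex \<Rightarrow> gcomplex" is "\<lambda>r \<epsilon>. - r \<epsilon>"
proof -
  fix r r' assume *: "gc_rel r r'"
  then have "gc_negligible (\<lambda>\<epsilon>. - (r \<epsilon> - r' \<epsilon>))"
    unfolding gc_rel_def by (intro gc_negligible_uminus) auto
  with * show "gc_rel (\<lambda>\<epsilon>. - r \<epsilon>) (\<lambda>\<epsilon>. - r' \<epsilon>)"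
    by (simp add: gc_rel_def gc_moderate_uminus minus_diff_minus)
qed

lift_definition times_gcomplex :: "gcomplex \<Rightarrow> gcomplex \<Rightarrow> gcomplex" is "\<lambda>r s \<epsilon>. r \<epsilon> * s \<epsilon>"
proof -
  fix r r' s s' assume *: "gc_rel r r'" "gc_rel s s'"
  then have "gc_negligible (\<lambda>\<epsilon>. r \<epsilon> * (s \<epsilon> - s' \<epsilon>) + s' \<epsilon> * (r \<epsilon> - r' \<epsilon>))"
    unfolding gc_rel_def by (intro gc_negligible_add gc_negligible_mult) auto
  then have "gc_negligible (\<lambda>\<epsilon>. r \<epsilon> * s \<epsilon> - r' \<epsilon> * s' \<epsilon>)"
    by (simp add: algebra_simps)
  with * show "gc_rel (\<lambda>\<epsilon>. r \<epsilon> * s \<epsilon>) (\<lambda>\<epsilon>. r' \<epsilon> * s' \<epsilon>)"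
    unfolding gc_rel_def by (blast intro: gc_moderate_mult)
qed

definition minus_gcomplex :: "gcomplex \<Rightarrow> gcomplex \<Rightarrow> gcomplex" where
  "minus_gcomplex z w = z + - w"

instance
proof
  fix x y z :: gcomplex
  show "(x * y) * z = x * (y * z)"
    by transfer (simp add: gc_rel_def gc_moderate_mult algebra_simps)
  show "x * y = y * x"
    by transfer (simp add: gc_rel_def gc_moderate_mult algebra_simps)
  show "1 * x = x" by transfer (simp add: gc_rel_def)
  show "(x + y) + z = x + (y + z)"
    by transfer (simp add: gc_rel_def gc_moderate_add algebra_simps)
  show "x + y = y + x"
    by transfer (simp add: gc_rel_def gc_moderate_add algebra_simps)
  show "0 + x = x" by transfer (simp add: gc_rel_def)
  show "- x + x = 0" by transfer (simp add: gc_rel_def gc_moderate_add gc_moderate_uminus)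
  show "x - y = x + - y" by (simp add: minus_gcomplex_def)
  show "(x + y) * z = x * z + y * z"
    by transfer (simp add: gc_rel_def gc_moderate_add gc_moderate_mult algebra_simps)
  show "(0::gcomplex) \<noteq> 1"
  proof (transfer, rule notI)
    assume "gc_rel (\<lambda>\<epsilon>. 0) (\<lambda>\<epsilon>. 1)"
    then have "(\<lambda>\<epsilon>. 1::real) \<in> O[at_right 0](\<lambda>\<epsilon>. \<epsilon> powr real 1)"
      unfolding gc_rel_def gc_negligible_def eps_negligible_def by (auto dest!: spec[of _ 1])
    then obtain c where c: "c > 0" "eventually (\<lambda>\<epsilon>::real. norm (1::real) \<le> c * norm (\<epsilon> powr real 1)) (at_right 0)"
      by (elim landau_o.bigE)
    have "eventually (\<lambda>\<epsilon>::real. \<epsilon> \<in> {0<..<1/c}) (at_right 0)"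
      using c(1) by (intro eventually_at_right_real) simp
    with c(2) have "eventually (\<lambda>\<epsilon>::real. False) (at_right 0)"
      by eventually_elim (use c(1) in \<open>auto simp: field_simps\<close>)
    then show False by simp
  qed
qed

end

lift_definition gc_eps_powr :: "real \<Rightarrow> gcomplex" is "\<lambda>b \<epsilon>. of_real (\<epsilon> powr b)"
  by (simp add: gc_rel_def gc_moderate_def eps_moderate_powr)

lemma bigo_norm_cong:
  assumes "\<And>\<epsilon>. \<epsilon> \<in> {0<..1} \<Longrightarrow> \<bar>f \<epsilon>\<bar> \<le> \<bar>g \<epsilon>\<bar> + \<bar>h \<epsilon>\<bar>" "eps_negligible h"
    "g \<in> O[at_right 0](\<lambda>\<epsilon>. \<epsilon> powr b)"
  shows "f \<in> O[at_right 0](\<lambda>\<epsilon>. \<epsilon> powr b)"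
proof (rule bigo_dom)
  show "(\<lambda>\<epsilon>. \<bar>g \<epsilon>\<bar> + \<bar>h \<epsilon>\<bar>) \<in> O[at_right 0](\<lambda>\<epsilon>. \<epsilon> powr b)"
    using assms eps_negligible_imp_bigo by (intro sum_in_bigo(1)) auto
qed (use assms in auto)

lift_definition gc_val :: "gcomplex \<Rightarrow> ereal" is
  "\<lambda>r. Sup {ereal b | b. (\<lambda>\<epsilon>. norm (r \<epsilon>)) \<in> O[at_right 0](\<lambda>\<epsilon>. \<epsilon> powr b)}"
proof -
  have *: "(\<lambda>\<epsilon>. norm (s \<epsilon>)) \<in> O[at_right 0](\<lambda>\<epsilon>. \<epsilon> powr b)"
    if "gc_negligible (\<lambda>\<epsilon>. r \<epsilon> - s \<epsilon>)" "(\<lambda>\<epsilon>. norm (r \<epsilon>)) \<in> O[at_right 0](\<lambda>\<epsilon>. \<epsilon> powr b)"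
    for r s b
    by (rule bigo_norm_cong[OF _ that[unfolded gc_negligible_def]])
       (metis (no_types, lifting) abs_norm_cancel add.commute norm_minus_commute norm_triangle_sub)
  show "Sup {ereal b | b. (\<lambda>\<epsilon>. norm (r \<epsilon>)) \<in> O[at_right 0](\<lambda>\<epsilon>. \<epsilon> powr b)}
      = Sup {ereal b | b. (\<lambda>\<epsilon>. norm (s \<epsilon>)) \<in> O[at_right 0](\<lambda>\<epsilon>. \<epsilon> powr b)}"
    if "gc_rel r s" for r s
  proof -
    have "gc_negligible (\<lambda>\<epsilon>. r \<epsilon> - s \<epsilon>)" "gc_negligible (\<lambda>\<epsilon>. s \<epsilon> - r \<epsilon>)"
      using that gc_negligible_uminus[of "\<lambda>\<epsilon>. r \<epsilon> - s \<epsilon>"] by (auto simp: gc_rel_def)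
    then have "(\<lambda>\<epsilon>. norm (r \<epsilon>)) \<in> O[at_right 0](\<lambda>\<epsilon>. \<epsilon> powr b) \<longleftrightarrow>
        (\<lambda>\<epsilon>. norm (s \<epsilon>)) \<in> O[at_right 0](\<lambda>\<epsilon>. \<epsilon> powr b)" for b
      using * by blast
    then show ?thesis by simp
  qed
qed

text \<open>\<open>v \<mapsto> e\<^sup>-\<^sup>v\<close> with \<open>e\<^sup>-\<^sup>\<infinity> = 0\<close>; the valuation of a moderate net is never \<open>-\<infinity>\<close>.\<close>

definition exp_minus :: "ereal \<Rightarrow> real" where
  "exp_minus v = (if v = \<infinity> then 0 else exp (- real_of_ereal v))"

definition gc_abs :: "gcomplex \<Rightarrow> real" where
  "gc_abs z = exp_minus (gc_val z)"

definition gc_open :: "gcomplex set \<Rightarrow> bool" where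
  "gc_open S \<longleftrightarrow> (\<forall>z\<in>S. \<exists>d>0. \<forall>w. gc_abs (w - z) < d \<longrightarrow> w \<in> S)"

definition gc_topology :: "gcomplex topology" where
  "gc_topology = topology gc_open"

lemma istopology_gc_open: "istopology gc_open"
  unfolding istopology_def
proof (intro conjI allI impI)
  fix S T assume *: "gc_open S" "gc_open T"
  show "gc_open (S \<inter> T)"
    unfolding gc_open_def
  proof
    fix z assume "z \<in> S \<inter> T"
    then obtain d e where "d > 0" "\<forall>w. gc_abs (w - z) < d \<longrightarrow> w \<in> S"
      "e > 0" "\<forall>w. gc_abs (w - z) < e \<longrightarrow> w \<in> T"
      using * unfolding gc_open_def by blast
    then show "\<exists>d>0. \<forall>w. gc_abs (w - z) < d \<longrightarrow> w \<in> S \<inter> T"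
      by (intro exI[of _ "min d e"]) auto
  qed
next
  fix \<S> assume "\<forall>S\<in>\<S>. gc_open S"
  then show "gc_open (\<Union>\<S>)" unfolding gc_open_def by (meson Union_iff)
qed

lemma openin_gc_topology: "openin gc_topology S \<longleftrightarrow> gc_open S"
  by (simp add: gc_topology_def istopology_gc_open topology_inverse')

section \<open>Smooth functions\<close>

text \<open>The notation \<open>real^'n\<close> constrains \<open>'n\<close> to exactly the sort \<open>finite\<close>.\<close>

type_synonym 'n space = "(real, 'n) vec"

definition partial_deriv :: "'n::finite \<Rightarrow> ('n space \<Rightarrow> complex) \<Rightarrow> 'n space \<Rightarrow> complex" where
  "partial_deriv i f x = frechet_derivative f (at x) (axis i 1)"

primrec Ck :: "nat \<Rightarrow> (('n::finite) space \<Rightarrow> complex) \<Rightarrow> bool" where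
  "Ck 0 f \<longleftrightarrow> continuous_on UNIV f"
| "Ck (Suc k) f \<longleftrightarrow> (\<forall>x. f differentiable (at x)) \<and> (\<forall>i. Ck k (partial_deriv i f))"

definition smooth :: "(('n::finite) space \<Rightarrow> complex) \<Rightarrow> bool" where
  "smooth f \<longleftrightarrow> (\<forall>k. Ck k f)"

definition mi_order :: "('n::finite \<Rightarrow> nat) \<Rightarrow> nat" where
  "mi_order \<alpha> = (\<Sum>i\<in>UNIV. \<alpha> i)"

text \<open>\<open>\<partial>\<^sup>\<alpha> f = \<partial>\<^sub>1\<^bsup>\<alpha>\<^sub>1\<^esup> (\<dots> (\<partial>\<^sub>n\<^bsup>\<alpha>\<^sub>n\<^esup> f))\<close>; the coordinates are ordered by the order of the index type.\<close>

definition multi_deriv :: "('n::{finite,linorder} \<Rightarrow> nat) \<Rightarrow> ('n space \<Rightarrow> complex) \<Rightarrow> 'n space \<Rightarrow> complex" where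
  "multi_deriv \<alpha> f = foldr (\<lambda>i. partial_deriv i ^^ \<alpha> i) (sorted_list_of_set UNIV) f"

lemma smooth_differentiable: "smooth f \<Longrightarrow> f differentiable (at x)"
  unfolding smooth_def using Ck.simps(2) by blast

lemma smooth_continuous: "smooth f \<Longrightarrow> continuous_on S f"
  unfolding smooth_def using Ck.simps(1) continuous_on_subset by blast

lemma smooth_partial: "smooth f \<Longrightarrow> smooth (partial_deriv i f)"
  unfolding smooth_def using Ck.simps(2) by blast

lemma partial_deriv_lin:
  assumes "f differentiable (at x)" "g differentiable (at x)"
  shows "partial_deriv i (\<lambda>x. a * f x + b * g x) x = a * partial_deriv i f x + b * partial_deriv i g x"
proof -
  have "((\<lambda>x. a * f x + b * g x) has_derivative
      (\<lambda>h. a * frechet_derivative f (at x) h + b * frechet_derivative g (at x) h)) (at x)"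
    using assms[unfolded frechet_derivative_works] by (auto intro!: derivative_eq_intros)
  from frechet_derivative_at[OF this] show ?thesis
    unfolding partial_deriv_def by metis
qed

lemma Ck_lin: "smooth f \<Longrightarrow> smooth g \<Longrightarrow> Ck k (\<lambda>x. a * f x + b * g x)"
proof (induction k arbitrary: f g)
  case 0
  have "continuous_on UNIV f" "continuous_on UNIV g"
    using 0 by (simp_all add: smooth_continuous)
  then show ?case by (auto intro!: continuous_intros)
next
  case (Suc k)
  have "partial_deriv i (\<lambda>x. a * f x + b * g x) = (\<lambda>x. a * partial_deriv i f x + b * partial_deriv i g x)" for i
    using Suc.prems by (intro ext partial_deriv_lin smooth_differentiable)
  moreover have "(\<lambda>x. a * f x + b * g x) differentiable (at x)" for x
    using Suc.prems by (intro derivative_intros smooth_differentiable)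
  ultimately show ?case using Suc by (simp add: smooth_partial)
qed

lemma smooth_lin:
  assumes "smooth f" "smooth g" shows "smooth (\<lambda>x. a * f x + b * g x)"
proof -
  have "\<forall>k. Ck k (\<lambda>x. a * f x + b * g x)"
    by (rule allI) (rule Ck_lin[OF assms])
  then show ?thesis by (simp add: smooth_def)
qed

lemma smooth_zero [simp]: "smooth (\<lambda>x :: ('n::finite) space. 0)"
proof -
  have "Ck k (\<lambda>x::'n space. 0)" for k
    by (induction k) (simp_all add: partial_deriv_def[abs_def])
  then show ?thesis by (simp add: smooth_def)
qed

lemma smooth_funpow: "smooth f \<Longrightarrow> smooth ((partial_deriv i ^^ k) f)"
  by (induction k) (auto simp: smooth_partial)

lemma smooth_foldr: "smooth f \<Longrightarrow> smooth (foldr (\<lambda>i. partial_deriv i ^^ \<alpha> i) xs f)"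
  by (induction xs) (auto simp: smooth_funpow)

lemma smooth_multi_deriv: "smooth f \<Longrightarrow> smooth (multi_deriv \<alpha> f)"
  unfolding multi_deriv_def by (rule smooth_foldr)

lemma funpow_lin:
  assumes "smooth f" "smooth g"
  shows "(partial_deriv i ^^ k) (\<lambda>x. a * f x + b * g x)
    = (\<lambda>x. a * (partial_deriv i ^^ k) f x + b * (partial_deriv i ^^ k) g x)"
proof (induction k)
  case (Suc k)
  have "partial_deriv i (\<lambda>x. a * (partial_deriv i ^^ k) f x + b * (partial_deriv i ^^ k) g x)
     = (\<lambda>x. a * partial_deriv i ((partial_deriv i ^^ k) f) x + b * partial_deriv i ((partial_deriv i ^^ k) g) x)"
    using assms by (intro ext partial_deriv_lin smooth_differentiable smooth_funpow)
  with Suc show ?case by simp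
qed simp

lemma multi_deriv_lin:
  assumes "smooth f" "smooth g"
  shows "multi_deriv \<alpha> (\<lambda>x. a * f x + b * g x) = (\<lambda>x. a * multi_deriv \<alpha> f x + b * multi_deriv \<alpha> g x)"
proof -
  have "foldr (\<lambda>i. partial_deriv i ^^ \<alpha> i) xs (\<lambda>x. a * f x + b * g x) =
    (\<lambda>x. a * foldr (\<lambda>i. partial_deriv i ^^ \<alpha> i) xs f x + b * foldr (\<lambda>i. partial_deriv i ^^ \<alpha> i) xs g x)" for xs
    by (induction xs) (simp_all add: funpow_lin smooth_foldr assms)
  then show ?thesis by (simp add: multi_deriv_def)
qed

lemma multi_deriv_zero [simp]: "multi_deriv (\<lambda>_. 0) f = f"
proof -
  have "foldr (\<lambda>i. partial_deriv i ^^ 0) xs f = f" for xs by (induction xs) auto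
  then show ?thesis by (simp add: multi_deriv_def)
qed

lemma smooth_line_deriv:
  assumes "smooth f"
  shows "((\<lambda>s::real. Re (f (y + s *\<^sub>R axis i 1))) has_real_derivative Re (partial_deriv i f (y + s *\<^sub>R axis i 1))) (at s)"
    "((\<lambda>s::real. Im (f (y + s *\<^sub>R axis i 1))) has_real_derivative Im (partial_deriv i f (y + s *\<^sub>R axis i 1))) (at s)"
proof -
  let ?z = "y + s *\<^sub>R axis i (1::real)"
  have f: "(f has_derivative frechet_derivative f (at ?z)) (at ?z)"
    using smooth_differentiable[OF assms] frechet_derivative_works by blast
  have g: "((\<lambda>s::real. y + s *\<^sub>R axis i 1) has_derivative (\<lambda>h. h *\<^sub>R axis i 1)) (at s)"
    by (auto intro!: derivative_eq_intros)
  have "((\<lambda>s::real. f (y + s *\<^sub>R axis i 1)) has_derivative (\<lambda>h. frechet_derivative f (at ?z) (h *\<^sub>R axis i 1))) (at s)"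
    using diff_chain_at[OF g] f by (simp add: o_def)
  moreover have "frechet_derivative f (at ?z) (h *\<^sub>R axis i 1) = h *\<^sub>R partial_deriv i f ?z" for h
    unfolding partial_deriv_def using has_derivative_linear[OF f] linear_scale by blast
  ultimately have *: "((\<lambda>s::real. f (y + s *\<^sub>R axis i 1)) has_derivative (\<lambda>h. h *\<^sub>R partial_deriv i f ?z)) (at s)"
    by simp
  show "((\<lambda>s::real. Re (f (y + s *\<^sub>R axis i 1))) has_real_derivative Re (partial_deriv i f ?z)) (at s)"
    "((\<lambda>s::real. Im (f (y + s *\<^sub>R axis i 1))) has_real_derivative Im (partial_deriv i f ?z)) (at s)"
    unfolding has_field_derivative_def
    using bounded_linear.has_derivative[OF bounded_linear_Re *] bounded_linear.has_derivative[OF bounded_linear_Im *]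
    by (simp_all add: mult.commute[of _ "Re _"] mult.commute[of _ "Im _"])
qed

lemma second_difference:
  fixes F G H :: "('n::finite) space \<Rightarrow> real" and h :: real
  assumes h: "h > 0"
    and F: "\<And>y s. ((\<lambda>s. F (y + s *\<^sub>R axis i 1)) has_real_derivative G (y + s *\<^sub>R axis i 1)) (at s)"
    and G: "\<And>y s. ((\<lambda>s. G (y + s *\<^sub>R axis j 1)) has_real_derivative H (y + s *\<^sub>R axis j 1)) (at s)"
  shows "\<exists>s t. 0 < s \<and> s < h \<and> 0 < t \<and> t < h \<and>
    F (x + h *\<^sub>R axis i 1 + h *\<^sub>R axis j 1) - F (x + h *\<^sub>R axis i 1) - F (x + h *\<^sub>R axis j 1) + F x
    = h * h * H (x + s *\<^sub>R axis i 1 + t *\<^sub>R axis j 1)"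
proof -
  define g where "g s = F ((x + h *\<^sub>R axis j 1) + s *\<^sub>R axis i 1) - F (x + s *\<^sub>R axis i 1)" for s
  have g: "(g has_real_derivative G ((x + h *\<^sub>R axis j 1) + s *\<^sub>R axis i 1) - G (x + s *\<^sub>R axis i 1)) (at s)" for s
    unfolding g_def by (intro DERIV_diff F)
  obtain s where s: "0 < s" "s < h"
    "g h - g 0 = (h - 0) * (G ((x + h *\<^sub>R axis j 1) + s *\<^sub>R axis i 1) - G (x + s *\<^sub>R axis i 1))"
    using MVT2[OF h g] by blast
  obtain t where t: "0 < t" "t < h"
    "G ((x + s *\<^sub>R axis i 1) + h *\<^sub>R axis j 1) - G ((x + s *\<^sub>R axis i 1) + 0 *\<^sub>R axis j 1)
      = (h - 0) * H ((x + s *\<^sub>R axis i 1) + t *\<^sub>R axis j 1)"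
    using MVT2[OF h G] by blast
  have "g h - g 0 = h * h * H (x + s *\<^sub>R axis i 1 + t *\<^sub>R axis j 1)"
    using s(3) t(3) by (simp add: algebra_simps)
  moreover have "g h - g 0 = F (x + h *\<^sub>R axis i 1 + h *\<^sub>R axis j 1) - F (x + h *\<^sub>R axis i 1)
      - F (x + h *\<^sub>R axis j 1) + F x"
    by (simp add: g_def algebra_simps)
  ultimately show ?thesis using s t by metis
qed

lemma mixed_partials_real:
  fixes F :: "('n::finite) space \<Rightarrow> real"
  assumes Fi: "\<And>y s. ((\<lambda>s. F (y + s *\<^sub>R axis i 1)) has_real_derivative G (y + s *\<^sub>R axis i 1)) (at s)"
    and Gj: "\<And>y s. ((\<lambda>s. G (y + s *\<^sub>R axis j 1)) has_real_derivative H (y + s *\<^sub>R axis j 1)) (at s)"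
    and Fj: "\<And>y s. ((\<lambda>s. F (y + s *\<^sub>R axis j 1)) has_real_derivative G' (y + s *\<^sub>R axis j 1)) (at s)"
    and Gi: "\<And>y s. ((\<lambda>s. G' (y + s *\<^sub>R axis i 1)) has_real_derivative H' (y + s *\<^sub>R axis i 1)) (at s)"
    and cont: "isCont H x" "isCont H' x"
  shows "H x = H' x"
proof (rule ccontr)
  assume "H x \<noteq> H' x"
  then have e: "\<bar>H x - H' x\<bar> / 2 > 0" by simp
  obtain d where d: "d > 0" "\<And>y. dist y x < d \<Longrightarrow> dist (H y) (H x) < \<bar>H x - H' x\<bar> / 2"
    using cont(1) e unfolding continuous_at_eps_delta by blast
  obtain d' where d': "d' > 0" "\<And>y. dist y x < d' \<Longrightarrow> dist (H' y) (H' x) < \<bar>H x - H' x\<bar> / 2"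
    using cont(2) e unfolding continuous_at_eps_delta by blast
  define h where "h = min d d' / 2"
  have h: "h > 0" using d d' by (simp add: h_def)
  obtain s t where st: "0 < s" "s < h" "0 < t" "t < h"
    "F (x + h *\<^sub>R axis i 1 + h *\<^sub>R axis j 1) - F (x + h *\<^sub>R axis i 1) - F (x + h *\<^sub>R axis j 1) + F x
     = h * h * H (x + s *\<^sub>R axis i 1 + t *\<^sub>R axis j 1)"
    using second_difference[OF h Fi Gj] by metis
  obtain s' t' where st': "0 < s'" "s' < h" "0 < t'" "t' < h"
    "F (x + h *\<^sub>R axis j 1 + h *\<^sub>R axis i 1) - F (x + h *\<^sub>R axis j 1) - F (x + h *\<^sub>R axis i 1) + F x
     = h * h * H' (x + s' *\<^sub>R axis j 1 + t' *\<^sub>R axis i 1)"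
    using second_difference[OF h Fj Gi] by metis
  have "h * h * H (x + s *\<^sub>R axis i 1 + t *\<^sub>R axis j 1) = h * h * H' (x + s' *\<^sub>R axis j 1 + t' *\<^sub>R axis i 1)"
    using st(5) st'(5) by (simp add: algebra_simps)
  then have eq: "H (x + s *\<^sub>R axis i 1 + t *\<^sub>R axis j 1) = H' (x + s' *\<^sub>R axis j 1 + t' *\<^sub>R axis i 1)"
    using h by simp
  have close: "dist (x + s *\<^sub>R axis i 1 + t *\<^sub>R axis j (1::real)) x < min d d'"
    if "0 < s" "s < h" "0 < t" "t < h" for s t i j
  proof -
    have "dist (x + s *\<^sub>R axis i 1 + t *\<^sub>R axis j (1::real)) x = norm (s *\<^sub>R axis i 1 + t *\<^sub>R axis j (1::real))"
      by (simp add: dist_norm)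
    also have "\<dots> \<le> norm (s *\<^sub>R axis i (1::real)) + norm (t *\<^sub>R axis j (1::real))" by (rule norm_triangle_ineq)
    also have "\<dots> = s + t" using that by simp
    also have "\<dots> < min d d'" using that by (simp add: h_def)
    finally show ?thesis .
  qed
  have "dist (H (x + s *\<^sub>R axis i 1 + t *\<^sub>R axis j 1)) (H x) < \<bar>H x - H' x\<bar> / 2"
    using d(2) close[OF st(1-4), of i j] by simp
  moreover have "dist (H (x + s *\<^sub>R axis i 1 + t *\<^sub>R axis j 1)) (H' x) < \<bar>H x - H' x\<bar> / 2"
    using d'(2) close[OF st'(1-4), of j i] unfolding eq by simp
  moreover have "\<bar>H x - H' x\<bar> \<le> dist (H (x + s *\<^sub>R axis i 1 + t *\<^sub>R axis j 1)) (H x)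
      + dist (H (x + s *\<^sub>R axis i 1 + t *\<^sub>R axis j 1)) (H' x)"
    unfolding dist_real_def[symmetric] by (rule dist_triangle3)
  ultimately show False by argo
qed

lemma partial_deriv_commute:
  assumes "smooth f"
  shows "partial_deriv i (partial_deriv j f) = partial_deriv j (partial_deriv i f)"
proof
  fix x
  have c: "isCont (partial_deriv k (partial_deriv l f)) x" for k l
    using smooth_continuous[of "partial_deriv k (partial_deriv l f)" UNIV] assms
    by (simp add: smooth_partial continuous_on_eq_continuous_at)
  have "Re (partial_deriv i (partial_deriv j f) x) = Re (partial_deriv j (partial_deriv i f) x)"
    by (rule mixed_partials_real[where F="\<lambda>x. Re (f x)" and i=j and j=i])
       (rule smooth_line_deriv smooth_partial assms isCont_Re c)+
  moreover have "Im (partial_deriv i (partial_deriv j f) x) = Im (partial_deriv j (partial_deriv i f) x)"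
    by (rule mixed_partials_real[where F="\<lambda>x. Im (f x)" and i=j and j=i])
       (rule smooth_line_deriv smooth_partial assms isCont_Im c)+
  ultimately show "partial_deriv i (partial_deriv j f) x = partial_deriv j (partial_deriv i f) x"
    by (rule complex_eqI)
qed

lemma partial_deriv_commute_funpow:
  "smooth f \<Longrightarrow> (partial_deriv i ^^ k) (partial_deriv j f) = partial_deriv j ((partial_deriv i ^^ k) f)"
  by (induction k) (simp_all add: partial_deriv_commute smooth_funpow)

lemma partial_deriv_commute_foldr:
  "smooth f \<Longrightarrow> foldr (\<lambda>i. partial_deriv i ^^ \<beta> i) xs ((partial_deriv j ^^ k) f)
     = (partial_deriv j ^^ k) (foldr (\<lambda>i. partial_deriv i ^^ \<beta> i) xs f)"
proof (induction xs)
  case (Cons y ys)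
  have *: "(partial_deriv i ^^ l) ((partial_deriv j ^^ k) g) = (partial_deriv j ^^ k) ((partial_deriv i ^^ l) g)"
    if "smooth g" for g i l
    using that by (induction k) (simp_all add: partial_deriv_commute_funpow smooth_funpow)
  show ?case using Cons by (simp add: * smooth_foldr)
qed simp

lemma multi_deriv_multi_deriv:
  assumes "smooth f" shows "multi_deriv \<beta> (multi_deriv \<alpha> f) = multi_deriv (\<lambda>i. \<beta> i + \<alpha> i) f"
proof -
  have "foldr (\<lambda>i. partial_deriv i ^^ \<beta> i) xs (foldr (\<lambda>i. partial_deriv i ^^ \<alpha> i) xs f)
    = foldr (\<lambda>i. partial_deriv i ^^ (\<beta> i + \<alpha> i)) xs f" for xs
    by (induction xs) (simp_all add: partial_deriv_commute_foldr smooth_foldr assms funpow_add)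
  then show ?thesis by (simp add: multi_deriv_def)
qed

text \<open>The element \<open>0\<close> is inserted so that the suprema over the empty compact set are \<open>0\<close>.\<close>

definition sup_norm :: "'a set \<Rightarrow> ('a \<Rightarrow> complex) \<Rightarrow> real" where
  "sup_norm K f = Sup (insert 0 ((\<lambda>x. norm (f x)) ` K))"

definition Cj_norm :: "('n::{finite,linorder}) space set \<Rightarrow> nat \<Rightarrow> ('n space \<Rightarrow> complex) \<Rightarrow> real" where
  "Cj_norm K j f = Sup (insert 0 {norm (multi_deriv \<alpha> f x) | \<alpha> x. mi_order \<alpha> \<le> j \<and> x \<in> K})"

lemma bdd_above_sup_norm:
  assumes "compact K" "continuous_on K f" shows "bdd_above (insert 0 ((\<lambda>x. norm (f x)) ` K))"
proof -
  have "compact ((\<lambda>x. norm (f x)) ` K)"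
    using assms by (intro compact_continuous_image continuous_intros)
  then show ?thesis by (simp add: compact_imp_bounded bounded_imp_bdd_above)
qed

lemma sup_norm_upper:
  "compact K \<Longrightarrow> continuous_on K f \<Longrightarrow> x \<in> K \<Longrightarrow> norm (f x) \<le> sup_norm K f"
  unfolding sup_norm_def by (rule cSup_upper) (auto simp: bdd_above_sup_norm simp del: bdd_above_insert)

lemma sup_norm_nonneg: "compact K \<Longrightarrow> continuous_on K f \<Longrightarrow> 0 \<le> sup_norm K f"
  unfolding sup_norm_def by (rule cSup_upper) (auto simp: bdd_above_sup_norm simp del: bdd_above_insert)

lemma sup_norm_least: "0 \<le> c \<Longrightarrow> (\<And>x. x \<in> K \<Longrightarrow> norm (f x) \<le> c) \<Longrightarrow> sup_norm K f \<le> c"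
  unfolding sup_norm_def by (rule cSup_least) auto

lemma sup_norm_lin:
  assumes "compact K" "continuous_on K f" "continuous_on K g"
  shows "\<bar>sup_norm K (\<lambda>x. a * f x + b * g x)\<bar> \<le> \<bar>norm a * sup_norm K f + norm b * sup_norm K g\<bar>"
proof -
  have nn: "0 \<le> sup_norm K f" "0 \<le> sup_norm K g" using assms by (auto intro: sup_norm_nonneg)
  have "sup_norm K (\<lambda>x. a * f x + b * g x) \<le> norm a * sup_norm K f + norm b * sup_norm K g"
  proof (rule sup_norm_least)
    fix x assume x: "x \<in> K"
    have "norm (a * f x + b * g x) \<le> norm a * norm (f x) + norm b * norm (g x)"
      by (metis norm_mult norm_triangle_ineq)
    also have "\<dots> \<le> norm a * sup_norm K f + norm b * sup_norm K g"
      using assms x by (intro add_mono mult_left_mono sup_norm_upper) auto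
    finally show "norm (a * f x + b * g x) \<le> norm a * sup_norm K f + norm b * sup_norm K g" .
  qed (use nn in auto)
  moreover have "0 \<le> sup_norm K (\<lambda>x. a * f x + b * g x)"
    using assms by (intro sup_norm_nonneg continuous_intros)
  ultimately show ?thesis by linarith
qed

section \<open>The Colombeau algebra on the whole space\<close>

text \<open>Only the module structure over \<^typ>\<open>gcomplex\<close> and the derivatives are needed here.\<close>

definition smooth_net :: "(real \<Rightarrow> ('n::finite) space \<Rightarrow> complex) \<Rightarrow> bool" where
  "smooth_net u \<longleftrightarrow> (\<forall>\<epsilon>\<in>{0<..1}. smooth (u \<epsilon>))"

definition gf_moderate :: "(real \<Rightarrow> ('n::{finite,linorder}) space \<Rightarrow> complex) \<Rightarrow> bool" where
  "gf_moderate u \<longleftrightarrow> smooth_net u \<and>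
     (\<forall>K \<alpha>. compact K \<longrightarrow> eps_moderate (\<lambda>\<epsilon>. sup_norm K (multi_deriv \<alpha> (u \<epsilon>))))"

definition gf_negligible_on :: "('n::{finite,linorder}) space set \<Rightarrow> (real \<Rightarrow> 'n space \<Rightarrow> complex) \<Rightarrow> bool" where
  "gf_negligible_on V u \<longleftrightarrow>
     (\<forall>K \<alpha>. compact K \<and> K \<subseteq> V \<longrightarrow> eps_negligible (\<lambda>\<epsilon>. sup_norm K (multi_deriv \<alpha> (u \<epsilon>))))"

definition gf_rel :: "(real \<Rightarrow> ('n::{finite,linorder}) space \<Rightarrow> complex) \<Rightarrow> (real \<Rightarrow> 'n space \<Rightarrow> complex) \<Rightarrow> bool" where
  "gf_rel u v \<longleftrightarrow> gf_moderate u \<and> gf_moderate v \<and> gf_negligible_on UNIV (\<lambda>\<epsilon> x. u \<epsilon> x - v \<epsilon> x)"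

lemma gf_moderate_lin:
  fixes u v :: "real \<Rightarrow> ('n::{finite,linorder}) space \<Rightarrow> complex"
  assumes "gc_moderate r" "gc_moderate s" "gf_moderate u" "gf_moderate v"
  shows "gf_moderate (\<lambda>\<epsilon> x. r \<epsilon> * u \<epsilon> x + s \<epsilon> * v \<epsilon> x)"
  unfolding gf_moderate_def
proof (intro conjI allI impI)
  have sm: "smooth (u \<epsilon>)" "smooth (v \<epsilon>)" if "\<epsilon> \<in> {0<..1}" for \<epsilon>
    using assms that unfolding gf_moderate_def smooth_net_def by blast+
  then show "smooth_net (\<lambda>\<epsilon> x. r \<epsilon> * u \<epsilon> x + s \<epsilon> * v \<epsilon> x)"
    unfolding smooth_net_def by (blast intro: smooth_lin)
  fix K :: "'n space set" and \<alpha> :: "'n \<Rightarrow> nat" assume K: "compact K"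
  show "eps_moderate (\<lambda>\<epsilon>. sup_norm K (multi_deriv \<alpha> (\<lambda>x. r \<epsilon> * u \<epsilon> x + s \<epsilon> * v \<epsilon> x)))"
  proof (rule eps_moderate_dom)
    show "eps_moderate (\<lambda>\<epsilon>. norm (r \<epsilon>) * sup_norm K (multi_deriv \<alpha> (u \<epsilon>))
        + norm (s \<epsilon>) * sup_norm K (multi_deriv \<alpha> (v \<epsilon>)))"
      using assms K unfolding gf_moderate_def gc_moderate_def
      by (intro eps_moderate_add eps_moderate_mult) auto
  qed (use K sm in \<open>simp add: multi_deriv_lin sup_norm_lin smooth_continuous smooth_multi_deriv\<close>)
qed

lemma gf_negligible_lin:
  fixes u v :: "real \<Rightarrow> ('n::{finite,linorder}) space \<Rightarrow> complex"
  assumes "smooth_net u" "smooth_net v"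
    and "\<And>K \<alpha>. compact K \<Longrightarrow> K \<subseteq> V \<Longrightarrow> eps_negligible (\<lambda>\<epsilon>. norm (r \<epsilon>) * sup_norm K (multi_deriv \<alpha> (u \<epsilon>)))"
    and "\<And>K \<alpha>. compact K \<Longrightarrow> K \<subseteq> V \<Longrightarrow> eps_negligible (\<lambda>\<epsilon>. norm (s \<epsilon>) * sup_norm K (multi_deriv \<alpha> (v \<epsilon>)))"
  shows "gf_negligible_on V (\<lambda>\<epsilon> x. r \<epsilon> * u \<epsilon> x + s \<epsilon> * v \<epsilon> x)"
  unfolding gf_negligible_on_def
proof (intro allI impI, elim conjE)
  fix K :: "'n space set" and \<alpha> :: "'n \<Rightarrow> nat" assume K: "compact K" "K \<subseteq> V"
  have sm: "smooth (u \<epsilon>)" "smooth (v \<epsilon>)" if "\<epsilon> \<in> {0<..1}" for \<epsilon>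
    using assms that unfolding smooth_net_def by blast+
  show "eps_negligible (\<lambda>\<epsilon>. sup_norm K (multi_deriv \<alpha> (\<lambda>x. r \<epsilon> * u \<epsilon> x + s \<epsilon> * v \<epsilon> x)))"
    by (rule eps_negligible_dom[OF eps_negligible_add[OF assms(3)[OF K, of \<alpha>] assms(4)[OF K, of \<alpha>]]])
       (use K sm in \<open>simp add: multi_deriv_lin sup_norm_lin smooth_continuous smooth_multi_deriv\<close>)
qed

lemma gf_negligible_lin':
  assumes "smooth_net u" "smooth_net v" "gc_moderate r" "gc_moderate s"
    "gf_negligible_on V u" "gf_negligible_on V v"
  shows "gf_negligible_on V (\<lambda>\<epsilon> x. r \<epsilon> * u \<epsilon> x + s \<epsilon> * v \<epsilon> x)"
  by (rule gf_negligible_lin) (use assms in \<open>auto simp: gf_negligible_on_def gc_moderate_def intro!: eps_negligible_mult\<close>)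

lemma gf_moderate_smooth: "gf_moderate u \<Longrightarrow> smooth_net u"
  by (simp add: gf_moderate_def)

lemma smooth_net_lin: "smooth_net u \<Longrightarrow> smooth_net v \<Longrightarrow> smooth_net (\<lambda>\<epsilon> x. r \<epsilon> * u \<epsilon> x + s \<epsilon> * v \<epsilon> x)"
  unfolding smooth_net_def by (blast intro: smooth_lin)

lemma smooth_net_diff: "smooth_net u \<Longrightarrow> smooth_net v \<Longrightarrow> smooth_net (\<lambda>\<epsilon> x. u \<epsilon> x - v \<epsilon> x)"
  using smooth_net_lin[of u v "\<lambda>_. 1" "\<lambda>_. -1"] by simp

lemma multi_deriv_zero_fun [simp]: "multi_deriv \<alpha> (\<lambda>x. 0) = (\<lambda>x. 0)"
  using multi_deriv_lin[of "\<lambda>x. 0" "\<lambda>x. 0" \<alpha> 0 0] by simp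

lemma sup_norm_zero [simp]: "sup_norm K (\<lambda>x. 0) = 0"
  by (cases "K = {}") (simp_all add: sup_norm_def image_constant_conv)

lemma gf_negligible_zero [simp]: "gf_negligible_on V (\<lambda>\<epsilon> x. 0)"
  by (simp add: gf_negligible_on_def)

lemma gf_moderate_zero [simp]: "gf_moderate (\<lambda>\<epsilon> x. 0)"
  by (simp add: gf_moderate_def smooth_net_def)

lemma gf_rel_refl: "gf_moderate u \<Longrightarrow> gf_rel u u"
  by (simp add: gf_rel_def)

lemma gf_rel_sym: "gf_rel u v \<Longrightarrow> gf_rel v u"
  using gf_negligible_lin'[of "\<lambda>\<epsilon> x. u \<epsilon> x - v \<epsilon> x" "\<lambda>\<epsilon> x. 0" "\<lambda>_. -1" "\<lambda>_. 0" UNIV]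
  by (auto simp: gf_rel_def smooth_net_diff gf_moderate_smooth)

lemma part_equivp_gf_rel: "part_equivp (gf_rel :: (real \<Rightarrow> ('n::{finite,linorder}) space \<Rightarrow> complex) \<Rightarrow> _)"
  (is "part_equivp ?R")
proof (rule part_equivpI)
  show "\<exists>x. ?R x x"
    by (rule exI[of _ "\<lambda>_ _. 0"]) (simp add: gf_rel_def)
  show "symp ?R"
    by (rule sympI) (rule gf_rel_sym)
  show "transp ?R"
  proof (rule transpI)
    fix u v w :: "real \<Rightarrow> 'n space \<Rightarrow> complex" assume "gf_rel u v" "gf_rel v w"
    then show "gf_rel u w"
      using gf_negligible_lin'[of "\<lambda>\<epsilon> x. u \<epsilon> x - v \<epsilon> x" "\<lambda>\<epsilon> x. v \<epsilon> x - w \<epsilon> x" "\<lambda>_. 1" "\<lambda>_. 1" UNIV]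
      by (auto simp: gf_rel_def smooth_net_diff gf_moderate_smooth)
  qed
qed

quotient_type (overloaded) 'n gfun = "real \<Rightarrow> ('n::{finite,linorder}) space \<Rightarrow> complex" / partial: gf_rel
  by (rule part_equivp_gf_rel)

definition gf_represents :: "(real \<Rightarrow> ('n::{finite,linorder}) space \<Rightarrow> complex) \<Rightarrow> 'n gfun \<Rightarrow> bool" where
  "gf_represents r u \<longleftrightarrow> gf_moderate r \<and> abs_gfun r = u"

instantiation gfun :: ("{finite,linorder}") ab_group_add
begin

lift_definition zero_gfun :: "'a gfun" is "\<lambda>\<epsilon> x. 0" by (simp add: gf_rel_def)

lift_definition plus_gfun :: "'a gfun \<Rightarrow> 'a gfun \<Rightarrow> 'a gfun" is "\<lambda>u v \<epsilon> x. u \<epsilon> x + v \<epsilon> x"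
proof -
  fix u u' v v' :: "real \<Rightarrow> 'a space \<Rightarrow> complex" assume *: "gf_rel u u'" "gf_rel v v'"
  show "gf_rel (\<lambda>\<epsilon> x. u \<epsilon> x + v \<epsilon> x) (\<lambda>\<epsilon> x. u' \<epsilon> x + v' \<epsilon> x)"
    using * gf_moderate_lin[of "\<lambda>_. 1" "\<lambda>_. 1" u v] gf_moderate_lin[of "\<lambda>_. 1" "\<lambda>_. 1" u' v']
      gf_negligible_lin'[of "\<lambda>\<epsilon> x. u \<epsilon> x - u' \<epsilon> x" "\<lambda>\<epsilon> x. v \<epsilon> x - v' \<epsilon> x" "\<lambda>_. 1" "\<lambda>_. 1" UNIV]
    by (auto simp: gf_rel_def smooth_net_diff gf_moderate_smooth add_diff_add)
qed

lift_definition uminus_gfun :: "'a gfun \<Rightarrow> 'a gfun" is "\<lambda>u \<epsilon> x. - u \<epsilon> x"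
proof -
  fix u u' :: "real \<Rightarrow> 'a space \<Rightarrow> complex" assume *: "gf_rel u u'"
  show "gf_rel (\<lambda>\<epsilon> x. - u \<epsilon> x) (\<lambda>\<epsilon> x. - u' \<epsilon> x)"
    using * gf_moderate_lin[of "\<lambda>_. -1" "\<lambda>_. 0" u u] gf_moderate_lin[of "\<lambda>_. -1" "\<lambda>_. 0" u' u']
      gf_rel_sym[OF *]
    by (auto simp: gf_rel_def)
qed

definition minus_gfun :: "'a gfun \<Rightarrow> 'a gfun \<Rightarrow> 'a gfun" where
  "minus_gfun u v = u + - v"

instance
proof
  have add: "gf_moderate (\<lambda>\<epsilon> x. u \<epsilon> x + v \<epsilon> x)" if "gf_moderate u" "gf_moderate v"
    for u v :: "real \<Rightarrow> 'a space \<Rightarrow> complex"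
    using gf_moderate_lin[of "\<lambda>_. 1" "\<lambda>_. 1" u v] that by simp
  fix x y z :: "'a gfun"
  show "(x + y) + z = x + (y + z)"
    by transfer (simp add: gf_rel_def add add.assoc)
  show "x + y = y + x"
    by transfer (simp add: gf_rel_def add add.commute)
  show "0 + x = x" by transfer (simp add: gf_rel_def)
  show "- x + x = 0" by transfer (simp add: gf_rel_def)
  show "x - y = x + - y" by (simp add: minus_gfun_def)
qed

end

lift_definition gf_scale :: "gcomplex \<Rightarrow> 'n::{finite,linorder} gfun \<Rightarrow> 'n gfun" (infixr "*\<^sub>G" 75)
  is "\<lambda>r u \<epsilon> x. r \<epsilon> * u \<epsilon> x"
proof -
  fix r s and u v :: "real \<Rightarrow> 'n space \<Rightarrow> complex" assume *: "gc_rel r s" "gf_rel u v"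
  have m: "gf_moderate (\<lambda>\<epsilon> x. r \<epsilon> * u \<epsilon> x)" "gf_moderate (\<lambda>\<epsilon> x. s \<epsilon> * v \<epsilon> x)"
    using * gf_moderate_lin[of r "\<lambda>_. 0" u u] gf_moderate_lin[of s "\<lambda>_. 0" v v]
    by (auto simp: gf_rel_def gc_rel_def)
  have "gf_negligible_on UNIV (\<lambda>\<epsilon> x. r \<epsilon> * (u \<epsilon> x - v \<epsilon> x) + (r \<epsilon> - s \<epsilon>) * v \<epsilon> x)"
  proof (rule gf_negligible_lin)
    show "eps_negligible (\<lambda>\<epsilon>. norm (r \<epsilon> - s \<epsilon>) * sup_norm K (multi_deriv \<alpha> (v \<epsilon>)))" if "compact K" for K \<alpha>
      using * that eps_negligible_mult[of "\<lambda>\<epsilon>. sup_norm K (multi_deriv \<alpha> (v \<epsilon>))" "\<lambda>\<epsilon>. norm (r \<epsilon> - s \<epsilon>)"]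
      by (auto simp: gf_rel_def gf_moderate_def gc_rel_def gc_negligible_def mult.commute)
    show "eps_negligible (\<lambda>\<epsilon>. norm (r \<epsilon>) * sup_norm K (multi_deriv \<alpha> (\<lambda>x. u \<epsilon> x - v \<epsilon> x)))" if "compact K" for K \<alpha>
      using * that by (intro eps_negligible_mult) (auto simp: gf_rel_def gf_negligible_on_def gc_rel_def gc_moderate_def)
  qed (use * in \<open>auto simp: gf_rel_def smooth_net_diff gf_moderate_smooth\<close>)
  then have "gf_negligible_on UNIV (\<lambda>\<epsilon> x. r \<epsilon> * u \<epsilon> x - s \<epsilon> * v \<epsilon> x)"
    by (simp add: algebra_simps)
  with m show "gf_rel (\<lambda>\<epsilon> x. r \<epsilon> * u \<epsilon> x) (\<lambda>\<epsilon> x. s \<epsilon> * v \<epsilon> x)" by (simp add: gf_rel_def)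
qed

text \<open>\<open>D\<^sup>\<alpha> = (-\<i>)\<^bsup>|\<alpha>|\<^esup> \<partial>\<^sup>\<alpha>\<close>\<close>

lift_definition gf_D :: "('n::{finite,linorder} \<Rightarrow> nat) \<Rightarrow> 'n gfun \<Rightarrow> 'n gfun"
  is "\<lambda>\<alpha> u \<epsilon> x. (- \<i>) ^ mi_order \<alpha> * multi_deriv \<alpha> (u \<epsilon>) x"
proof -
  fix \<alpha> :: "'n \<Rightarrow> nat" and u v :: "real \<Rightarrow> 'n space \<Rightarrow> complex" assume *: "gf_rel u v"
  let ?c = "(- \<i>) ^ mi_order \<alpha>"
  have d: "gf_moderate (\<lambda>\<epsilon>. multi_deriv \<alpha> (u \<epsilon>))" if u: "gf_moderate u" for u :: "real \<Rightarrow> 'n space \<Rightarrow> complex"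
    unfolding gf_moderate_def
  proof (intro conjI allI impI)
    have sm: "smooth (u \<epsilon>)" if "\<epsilon> \<in> {0<..1}" for \<epsilon>
      using u that unfolding gf_moderate_def smooth_net_def by blast
    then show "smooth_net (\<lambda>\<epsilon>. multi_deriv \<alpha> (u \<epsilon>))" by (simp add: smooth_net_def smooth_multi_deriv)
    fix K :: "'n space set" and \<beta> :: "'n \<Rightarrow> nat" assume "compact K"
    then have "eps_moderate (\<lambda>\<epsilon>. sup_norm K (multi_deriv (\<lambda>i. \<beta> i + \<alpha> i) (u \<epsilon>)))"
      using u by (auto simp: gf_moderate_def)
    then show "eps_moderate (\<lambda>\<epsilon>. sup_norm K (multi_deriv \<beta> (multi_deriv \<alpha> (u \<epsilon>))))"
      by (rule eps_moderate_dom) (simp add: sm multi_deriv_multi_deriv)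
  qed
  have m: "gf_moderate (\<lambda>\<epsilon> x. ?c * multi_deriv \<alpha> (u \<epsilon>) x)" if "gf_moderate u" for u :: "real \<Rightarrow> 'n space \<Rightarrow> complex"
    using gf_moderate_lin[of "\<lambda>_. ?c" "\<lambda>_. 0", OF _ _ d[OF that] d[OF that]] by simp
  have sm: "smooth (u \<epsilon>)" "smooth (v \<epsilon>)" if "\<epsilon> \<in> {0<..1}" for \<epsilon>
    using * that unfolding gf_rel_def gf_moderate_def smooth_net_def by blast+
  have diff: "multi_deriv \<alpha> (\<lambda>x. u \<epsilon> x - v \<epsilon> x) = (\<lambda>x. multi_deriv \<alpha> (u \<epsilon>) x - multi_deriv \<alpha> (v \<epsilon>) x)"
    if "\<epsilon> \<in> {0<..1}" for \<epsilon> \<alpha>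
    using multi_deriv_lin[OF sm[OF that], of \<alpha> 1 "-1"] by simp
  have sd: "smooth_net (\<lambda>\<epsilon> x. multi_deriv \<alpha> (u \<epsilon>) x - multi_deriv \<alpha> (v \<epsilon>) x)"
    using * d by (auto intro!: smooth_net_diff simp: gf_rel_def gf_moderate_smooth)
  have "gf_negligible_on UNIV (\<lambda>\<epsilon> x. multi_deriv \<alpha> (u \<epsilon>) x - multi_deriv \<alpha> (v \<epsilon>) x)"
    unfolding gf_negligible_on_def
  proof (intro allI impI, elim conjE)
    fix K :: "'n space set" and \<beta> :: "'n \<Rightarrow> nat" assume "compact K"
    then have "eps_negligible (\<lambda>\<epsilon>. sup_norm K (multi_deriv (\<lambda>i. \<beta> i + \<alpha> i) (\<lambda>x. u \<epsilon> x - v \<epsilon> x)))"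
      using * by (auto simp: gf_rel_def gf_negligible_on_def)
    then show "eps_negligible (\<lambda>\<epsilon>. sup_norm K (multi_deriv \<beta> (\<lambda>x. multi_deriv \<alpha> (u \<epsilon>) x - multi_deriv \<alpha> (v \<epsilon>) x)))"
    proof (rule eps_negligible_dom)
      fix \<epsilon> :: real assume e: "\<epsilon> \<in> {0<..1}"
      have "smooth (\<lambda>x. u \<epsilon> x - v \<epsilon> x)" using smooth_lin[OF sm[OF e], of 1 "-1"] by simp
      from multi_deriv_multi_deriv[OF this, of \<beta> \<alpha>] show
        "\<bar>sup_norm K (multi_deriv \<beta> (\<lambda>x. multi_deriv \<alpha> (u \<epsilon>) x - multi_deriv \<alpha> (v \<epsilon>) x))\<bar>
         \<le> \<bar>sup_norm K (multi_deriv (\<lambda>i. \<beta> i + \<alpha> i) (\<lambda>x. u \<epsilon> x - v \<epsilon> x))\<bar>"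
        using diff[OF e, of \<alpha>] by simp
    qed
  qed
  from gf_negligible_lin'[OF sd sd _ _ this this, of "\<lambda>_. ?c" "\<lambda>_. 0"]
  have "gf_negligible_on UNIV (\<lambda>\<epsilon> x. ?c * multi_deriv \<alpha> (u \<epsilon>) x - ?c * multi_deriv \<alpha> (v \<epsilon>) x)"
    by (simp add: algebra_simps)
  then show "gf_rel (\<lambda>\<epsilon> x. ?c * multi_deriv \<alpha> (u \<epsilon>) x) (\<lambda>\<epsilon> x. ?c * multi_deriv \<alpha> (v \<epsilon>) x)"
    using * m by (simp add: gf_rel_def)
qed

text \<open>The functional \<open>\<iota>\<^sub>d(\<delta>)\<close>\<close>

lift_definition gf_dirac :: "'n::{finite,linorder} gfun \<Rightarrow> gcomplex" is "\<lambda>u \<epsilon>. u \<epsilon> 0"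
proof -
  have s: "norm (f 0) = sup_norm {0} (multi_deriv (\<lambda>_. 0) f)" for f :: "'n space \<Rightarrow> complex"
    by (simp add: sup_norm_def cSup_eq_Max)
  have m: "gc_moderate (\<lambda>\<epsilon>. u \<epsilon> 0)" if "gf_moderate u" for u :: "real \<Rightarrow> 'n space \<Rightarrow> complex"
  proof -
    have "eps_moderate (\<lambda>\<epsilon>. sup_norm {0} (multi_deriv (\<lambda>_. 0) (u \<epsilon>)))"
      using that finite_imp_compact[of "{0}"] unfolding gf_moderate_def by blast
    then show ?thesis
      unfolding gc_moderate_def by (rule eps_moderate_dom) (simp only: s[symmetric] order_refl)
  qed
  fix u v :: "real \<Rightarrow> 'n space \<Rightarrow> complex" assume *: "gf_rel u v"
  have "eps_negligible (\<lambda>\<epsilon>. sup_norm {0} (multi_deriv (\<lambda>_. 0) (\<lambda>x. u \<epsilon> x - v \<epsilon> x)))"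
    using * finite_imp_compact[of "{0}"] unfolding gf_rel_def gf_negligible_on_def by blast
  then have "gc_negligible (\<lambda>\<epsilon>. u \<epsilon> 0 - v \<epsilon> 0)"
    unfolding gc_negligible_def by (rule eps_negligible_dom) (simp only: s[symmetric] order_refl)
  with * m show "gc_rel (\<lambda>\<epsilon>. u \<epsilon> 0) (\<lambda>\<epsilon>. v \<epsilon> 0)" by (simp add: gf_rel_def gc_rel_def)
qed

lift_definition gf_zero_on :: "'n::{finite,linorder} gfun \<Rightarrow> 'n space set \<Rightarrow> bool"
  is "\<lambda>u V. gf_negligible_on V u"
proof -
  have *: "gf_negligible_on V v" if "gf_rel u v" "gf_negligible_on V u" for u v and V :: "'n space set"
  proof -
    have "gf_negligible_on V (\<lambda>\<epsilon> x. u \<epsilon> x - v \<epsilon> x)"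
      using that unfolding gf_rel_def gf_negligible_on_def by blast
    with that gf_negligible_lin'[of u "\<lambda>\<epsilon> x. u \<epsilon> x - v \<epsilon> x" "\<lambda>_. 1" "\<lambda>_. -1" V]
    show ?thesis by (auto simp: gf_rel_def smooth_net_diff gf_moderate_smooth)
  qed
  show "(\<lambda>V. gf_negligible_on V u) = (\<lambda>V. gf_negligible_on V v)"
    if "gf_rel u v" for u v :: "real \<Rightarrow> 'n space \<Rightarrow> complex"
    using *[OF that] *[OF gf_rel_sym[OF that]] by blast
qed

definition gf_supp :: "'n::{finite,linorder} gfun \<Rightarrow> 'n space set" where
  "gf_supp u = - \<Union>{V. open V \<and> gf_zero_on u V}"

definition Gc :: "'n::{finite,linorder} gfun set" where
  "Gc = {u. compact (gf_supp u)}"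

definition GK :: "('n::{finite,linorder}) space set \<Rightarrow> 'n gfun set" where
  "GK K = {u \<in> Gc. gf_supp u \<subseteq> K}"

section \<open>Topology of the compactly supported generalized functions\<close>

text \<open>For compact \<open>K\<close> the set under the supremum does not depend on the representative \<open>r\<close>.\<close>

definition gf_val :: "('n::{finite,linorder}) space set \<Rightarrow> nat \<Rightarrow> 'n gfun \<Rightarrow> ereal" where
  "gf_val K j u = Sup {ereal b | b r. gf_represents r u \<and>
     (\<lambda>\<epsilon>. Cj_norm K j (r \<epsilon>)) \<in> O[at_right 0](\<lambda>\<epsilon>. \<epsilon> powr b)}"

text \<open>Neighbourhoods of \<open>0\<close> in \<^term>\<open>GK K\<close>. One \<open>j\<close> and one compact neighbourhood \<open>K'\<close> of \<open>K\<close> suffice,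
  since the seminorms increase with \<open>j\<close> and do not depend on \<open>K'\<close>.\<close>

definition GK_nhd0 :: "('n::{finite,linorder}) space set \<Rightarrow> 'n gfun set \<Rightarrow> bool" where
  "GK_nhd0 K W \<longleftrightarrow> (\<exists>K' j. \<exists>d>0. compact K' \<and> K \<subseteq> interior K' \<and>
     {u \<in> GK K. exp_minus (gf_val K' j u) < d} \<subseteq> W)"

text \<open>Absorbent, balanced and convex sets in the sense of modules over the generalized numbers.\<close>

definition gc_absorbent :: "'n::{finite,linorder} gfun set \<Rightarrow> bool" where
  "gc_absorbent A \<longleftrightarrow> (\<forall>u\<in>Gc. \<exists>a::real. \<forall>b\<le>a. \<exists>w\<in>A. u = gc_eps_powr b *\<^sub>G w)"

definition gc_balanced :: "'n::{finite,linorder} gfun set \<Rightarrow> bool" where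
  "gc_balanced A \<longleftrightarrow> (\<forall>z u. gc_abs z \<le> 1 \<and> u \<in> A \<longrightarrow> z *\<^sub>G u \<in> A)"

definition gc_convex :: "'n::{finite,linorder} gfun set \<Rightarrow> bool" where
  "gc_convex A \<longleftrightarrow> (\<forall>u\<in>A. \<forall>v\<in>A. u + v \<in> A) \<and> (\<forall>b\<ge>0. \<forall>u\<in>A. gc_eps_powr b *\<^sub>G u \<in> A)"

text \<open>The inductive limit topology is the finest locally convex linear topology making all inclusions
  of \<^term>\<open>GK K\<close> continuous: its neighbourhood filter of \<open>0\<close> has as base all absorbent, balanced, convex
  sets that meet every \<^term>\<open>GK K\<close> in a neighbourhood of \<open>0\<close>.\<close>

definition Gc_base :: "'n::{finite,linorder} gfun set \<Rightarrow> bool" where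
  "Gc_base U \<longleftrightarrow> U \<subseteq> Gc \<and> gc_absorbent U \<and> gc_balanced U \<and> gc_convex U \<and>
     (\<forall>K. compact K \<longrightarrow> GK_nhd0 K (U \<inter> GK K))"

definition Gc_open :: "'n::{finite,linorder} gfun set \<Rightarrow> bool" where
  "Gc_open S \<longleftrightarrow> S \<subseteq> Gc \<and> (\<forall>u\<in>S. \<exists>U. Gc_base U \<and> (\<forall>w\<in>U. u + w \<in> S))"

definition Gc_topology :: "'n::{finite,linorder} gfun topology" where
  "Gc_topology = topology Gc_open"

section \<open>Functionals\<close>

text \<open>Functionals on \<^term>\<open>Gc\<close> are total functions on \<^typ>\<open>'n gfun\<close> of which only the values
  on \<^term>\<open>Gc\<close> matter.\<close>

definition Gc_dual :: "('n::{finite,linorder} gfun \<Rightarrow> gcomplex) set" where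
  "Gc_dual = {T. (\<forall>u\<in>Gc. \<forall>v\<in>Gc. T (u + v) = T u + T v) \<and>
     (\<forall>z. \<forall>u\<in>Gc. T (z *\<^sub>G u) = z * T u) \<and> continuous_map Gc_topology gc_topology T}"

definition test_functions_on :: "('n::finite) space set \<Rightarrow> ('n space \<Rightarrow> complex) set" where
  "test_functions_on K = {f. smooth f \<and> (\<forall>x. x \<notin> K \<longrightarrow> f x = 0)}"

definition distribution :: "((('n::{finite,linorder}) space \<Rightarrow> complex) \<Rightarrow> complex) \<Rightarrow> bool" where
  "distribution S \<longleftrightarrow> (\<forall>K. compact K \<longrightarrow>
     (\<forall>f\<in>test_functions_on K. \<forall>g\<in>test_functions_on K. \<forall>a b.
        S (\<lambda>x. a * f x + b * g x) = a * S f + b * S g) \<and>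
     (\<exists>C j. \<forall>f\<in>test_functions_on K. norm (S f) \<le> C * Cj_norm K j f))"

definition Gc_dual_basic :: "('n::{finite,linorder} gfun \<Rightarrow> gcomplex) set" where
  "Gc_dual_basic = {T \<in> Gc_dual. \<exists>S :: real \<Rightarrow> ('n space \<Rightarrow> complex) \<Rightarrow> complex.
     (\<forall>\<epsilon>\<in>{0<..1}. distribution (S \<epsilon>)) \<and>
     (\<forall>K. compact K \<longrightarrow> (\<exists>(j::nat) (N::nat). \<exists>c>0. \<exists>\<eta>\<in>{0<..1}. \<forall>f\<in>test_functions_on K. \<forall>\<epsilon>\<in>{0<..\<eta>}.
        norm (S \<epsilon> f) \<le> c * \<epsilon> powr (- real N) * Cj_norm K j f)) \<and>
     (\<forall>u\<in>Gc. \<forall>r. gf_represents r u \<and> (\<exists>L. compact L \<and> (\<forall>\<epsilon>\<in>{0<..1}. r \<epsilon> \<in> test_functions_on L)) \<longrightarrow>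
        gc_represents (\<lambda>\<epsilon>. S \<epsilon> (r \<epsilon>)) (T u))}"

text \<open>Generalized functions with compact support in an open \<open>V\<close> are identified with their extensions
  by zero, so that the restriction of \<open>T\<close> to \<open>V\<close> is its restriction to the \<open>u\<close> with support in \<open>V\<close>.\<close>

definition functional_zero_on :: "('n::{finite,linorder} gfun \<Rightarrow> gcomplex) \<Rightarrow> 'n space set \<Rightarrow> bool" where
  "functional_zero_on T V \<longleftrightarrow> (\<forall>u\<in>Gc. gf_supp u \<subseteq> V \<longrightarrow> T u = 0)"

definition functional_supp :: "('n::{finite,linorder} gfun \<Rightarrow> gcomplex) \<Rightarrow> 'n space set" where
  "functional_supp T = - \<Union>{V. open V \<and> functional_zero_on T V}"

section \<open>Polynomials and differential operators\<close>

text \<open>A polynomial \<open>\<Sum>\<^bsub>|\<alpha>| \<le> m\<^esub> a\<^sub>\<alpha> \<zeta>\<^sup>\<alpha>\<close> is given by \<open>m\<close> and its coefficient family \<open>a\<close>; values of \<open>a\<close> at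
  multi-indices of order greater than \<open>m\<close> are ignored.\<close>

definition mi_upto :: "nat \<Rightarrow> ('n::finite \<Rightarrow> nat) set" where
  "mi_upto m = {\<alpha>. mi_order \<alpha> \<le> m}"

definition poly_value :: "nat \<Rightarrow> (('n::finite \<Rightarrow> nat) \<Rightarrow> complex) \<Rightarrow> complex^'n \<Rightarrow> complex" where
  "poly_value m a \<zeta> = (\<Sum>\<alpha>\<in>mi_upto m. a \<alpha> * (\<Prod>i\<in>UNIV. (\<zeta> $ i) ^ \<alpha> i))"

definition transpose_op :: "nat \<Rightarrow> (('n::{finite,linorder} \<Rightarrow> nat) \<Rightarrow> gcomplex) \<Rightarrow> 'n gfun \<Rightarrow> 'n gfun" where
  "transpose_op m a u = (\<Sum>\<alpha>\<in>mi_upto m. ((-1) ^ mi_order \<alpha> * a \<alpha>) *\<^sub>G gf_D \<alpha> u)"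

definition diff_op :: "nat \<Rightarrow> (('n::{finite,linorder} \<Rightarrow> nat) \<Rightarrow> gcomplex) \<Rightarrow>
    ('n gfun \<Rightarrow> gcomplex) \<Rightarrow> 'n gfun \<Rightarrow> gcomplex" where
  "diff_op m a T = (\<lambda>u. T (transpose_op m a u))"

definition fundamental_solution :: "nat \<Rightarrow> (('n::{finite,linorder} \<Rightarrow> nat) \<Rightarrow> gcomplex) \<Rightarrow>
    ('n gfun \<Rightarrow> gcomplex) \<Rightarrow> bool" where
  "fundamental_solution m a E \<longleftrightarrow> E \<in> Gc_dual \<and> (\<forall>u\<in>Gc. diff_op m a E u = gf_dirac u)"

definition evolution_operator :: "nat \<Rightarrow> (('n::{finite,linorder} \<Rightarrow> nat) \<Rightarrow> gcomplex) \<Rightarrow>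
    'n space set \<Rightarrow> bool" where
  "evolution_operator m a H \<longleftrightarrow>
     (\<exists>E\<in>Gc_dual_basic. fundamental_solution m a E \<and> functional_supp E \<subseteq> H)"

text \<open>The index of the last coordinate \<open>x\<^sub>n\<close>.\<close>

definition last_index :: "'n::{finite,linorder}" where
  "last_index = Max UNIV"

text \<open>The coefficient of \<open>\<zeta>\<^sub>n\<^sup>j\<close> is a polynomial in the remaining variables \<open>\<zeta>'\<close>; it is given here by its
  coefficient family, whose multi-indices have last entry \<open>0\<close>.\<close>

definition last_coeff :: "nat \<Rightarrow> (('n::{finite,linorder} \<Rightarrow> nat) \<Rightarrow> 'a::zero) \<Rightarrow> nat \<Rightarrow> ('n \<Rightarrow> nat) \<Rightarrow> 'a" where
  "last_coeff m a j = (\<lambda>\<beta>. if \<beta> last_index = 0 \<and> \<beta>(last_index := j) \<in> mi_upto m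
     then a (\<beta>(last_index := j)) else 0)"

definition last_degree :: "nat \<Rightarrow> (('n::{finite,linorder} \<Rightarrow> nat) \<Rightarrow> 'a::zero) \<Rightarrow> nat" where
  "last_degree m a = Max {j. last_coeff m a j \<noteq> (\<lambda>\<beta>. 0)}"

definition const_coeff :: "'a::zero \<Rightarrow> ('n \<Rightarrow> nat) \<Rightarrow> 'a" where
  "const_coeff b = (\<lambda>\<beta>. if \<beta> = (\<lambda>_. 0) then b else 0)"

section \<open>Consistency checks\<close>

lemma finite_last_coeff: "finite {j. last_coeff m (a :: ('n::{finite,linorder} \<Rightarrow> nat) \<Rightarrow> 'a::zero) j \<noteq> (\<lambda>\<beta>. 0)}"
proof (rule finite_subset)
  show "{j. last_coeff m a j \<noteq> (\<lambda>\<beta>. 0)} \<subseteq> {..m}"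
  proof (rule subsetI, rule ccontr)
    fix j assume "j \<in> {j. last_coeff m a j \<noteq> (\<lambda>\<beta>. 0)}" "j \<notin> {..m}"
    then have *: "last_coeff m a j \<noteq> (\<lambda>\<beta>. 0)" "\<not> j \<le> m" by auto
    have "(\<beta>(last_index := j)) last_index \<le> mi_order (\<beta>(last_index := j))" for \<beta> :: "'n \<Rightarrow> nat"
      unfolding mi_order_def by (rule member_le_sum) auto
    then have "\<beta>(last_index := j) \<notin> mi_upto m" for \<beta> :: "'n \<Rightarrow> nat"
      using *(2) by (metis fun_upd_same le_trans mem_Collect_eq mi_upto_def)
    with *(1) show False by (auto simp: last_coeff_def)
  qed
qed simp

lemma finite_mi_upto: "finite (mi_upto m :: ('n::finite \<Rightarrow> nat) set)"
proof (rule finite_subset)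
  show "mi_upto m \<subseteq> (PiE UNIV (\<lambda>_. {..m}) :: ('n \<Rightarrow> nat) set)"
  proof
    fix \<alpha> :: "'n \<Rightarrow> nat" assume "\<alpha> \<in> mi_upto m"
    moreover have "\<alpha> i \<le> (\<Sum>i\<in>UNIV. \<alpha> i)" for i by (rule member_le_sum) auto
    ultimately show "\<alpha> \<in> PiE UNIV (\<lambda>_. {..m})"
      unfolding mi_upto_def mi_order_def by (auto simp: PiE_UNIV_domain intro: le_trans)
  qed
qed (simp add: finite_PiE)

lemma Cj_norm_bounds:
  assumes "compact K" "smooth f"
  shows "\<And>y. y \<in> insert 0 {norm (multi_deriv \<alpha> f x) | \<alpha> x. mi_order \<alpha> \<le> j \<and> x \<in> K} \<Longrightarrow>
      y \<le> (\<Sum>\<alpha>\<in>mi_upto j. sup_norm K (multi_deriv \<alpha> f))"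
    and "0 \<le> Cj_norm K j f"
    and "Cj_norm K j f \<le> (\<Sum>\<alpha>\<in>mi_upto j. sup_norm K (multi_deriv \<alpha> f))"
proof -
  have c: "continuous_on K (multi_deriv \<alpha> f)" for \<alpha>
    using assms by (simp add: smooth_continuous smooth_multi_deriv)
  show *: "y \<le> (\<Sum>\<alpha>\<in>mi_upto j. sup_norm K (multi_deriv \<alpha> f))"
    if y: "y \<in> insert 0 {norm (multi_deriv \<alpha> f x) | \<alpha> x. mi_order \<alpha> \<le> j \<and> x \<in> K}" for y
  proof (cases "y = 0")
    case True
    then show ?thesis using assms c by (auto intro!: sum_nonneg sup_norm_nonneg)
  next
    case False
    then obtain \<alpha> x where x: "y = norm (multi_deriv \<alpha> f x)" "mi_order \<alpha> \<le> j" "x \<in> K" using y by blast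
    have "y \<le> sup_norm K (multi_deriv \<alpha> f)" using x assms c by (simp add: sup_norm_upper)
    also have "\<dots> \<le> (\<Sum>\<alpha>\<in>mi_upto j. sup_norm K (multi_deriv \<alpha> f))"
      by (rule member_le_sum[where f="\<lambda>\<alpha>. sup_norm K (multi_deriv \<alpha> f)"])
         (use x assms c finite_mi_upto in \<open>auto simp: mi_upto_def intro!: sup_norm_nonneg\<close>)
    finally show ?thesis .
  qed
  show "0 \<le> Cj_norm K j f"
    unfolding Cj_norm_def by (rule cSup_upper[OF insertI1]) (rule bdd_aboveI[OF *])
  show "Cj_norm K j f \<le> (\<Sum>\<alpha>\<in>mi_upto j. sup_norm K (multi_deriv \<alpha> f))"
    unfolding Cj_norm_def by (rule cSup_least) (blast, rule *)
qed

lemma Cj_norm_mono: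
  assumes "compact K'" "smooth f" "K \<subseteq> K'" "j \<le> j'"
  shows "Cj_norm K j f \<le> Cj_norm K' j' f"
  unfolding Cj_norm_def
proof (rule cSup_subset_mono)
  show "bdd_above (insert 0 {norm (multi_deriv \<alpha> f x) | \<alpha> x. mi_order \<alpha> \<le> j' \<and> x \<in> K'})"
    by (rule bdd_aboveI[OF Cj_norm_bounds(1)[OF assms(1,2)]])
  show "insert 0 {norm (multi_deriv \<alpha> f x) | \<alpha> x. mi_order \<alpha> \<le> j \<and> x \<in> K}
     \<subseteq> insert 0 {norm (multi_deriv \<alpha> f x) | \<alpha> x. mi_order \<alpha> \<le> j' \<and> x \<in> K'}"
    using assms(3,4) le_trans by (intro insert_mono) blast
qed blast

lemma gf_represents_ex: "\<exists>r. gf_represents r u"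
proof -
  have "gf_rel (rep_gfun u) (rep_gfun u)" "abs_gfun (rep_gfun u) = u"
    using Quotient_rep_reflp[OF Quotient_gfun] Quotient_abs_rep[OF Quotient_gfun] by blast+
  then show ?thesis by (auto simp: gf_represents_def gf_rel_def)
qed

lemma gf_represents_smooth: "gf_represents r u \<Longrightarrow> \<epsilon> \<in> {0<..1} \<Longrightarrow> smooth (r \<epsilon>)"
  by (auto simp: gf_represents_def gf_moderate_def smooth_net_def)

lemma gf_val_not_MInf:
  assumes "compact K" shows "gf_val K j u \<noteq> -\<infinity>"
proof -
  obtain r where r: "gf_represents r u" using gf_represents_ex by blast
  have "eps_moderate (\<lambda>\<epsilon>. \<Sum>\<alpha>\<in>A. sup_norm K (multi_deriv \<alpha> (r \<epsilon>)))" if "finite A" for A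
    using that r assms
    by (induction A rule: finite_induct) (auto intro!: eps_moderate_add simp: gf_represents_def gf_moderate_def)
  from this[OF finite_mi_upto[of j]] have "eps_moderate (\<lambda>\<epsilon>. Cj_norm K j (r \<epsilon>))"
  proof (rule eps_moderate_dom)
    fix \<epsilon> :: real assume e: "\<epsilon> \<in> {0<..1}"
    note * = Cj_norm_bounds(2,3)[OF assms gf_represents_smooth[OF r e], of j]
    show "\<bar>Cj_norm K j (r \<epsilon>)\<bar> \<le> \<bar>\<Sum>\<alpha>\<in>mi_upto j. sup_norm K (multi_deriv \<alpha> (r \<epsilon>))\<bar>" using * by linarith
  qed
  then obtain N :: nat where "(\<lambda>\<epsilon>. Cj_norm K j (r \<epsilon>)) \<in> O[at_right 0](\<lambda>\<epsilon>. \<epsilon> powr (- real N))"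
    unfolding eps_moderate_def by blast
  then have "ereal (- real N) \<le> gf_val K j u"
    unfolding gf_val_def using r by (intro Sup_upper) blast
  then show ?thesis by auto
qed

lemma exp_minus_antimono: "v \<noteq> -\<infinity> \<Longrightarrow> v \<le> w \<Longrightarrow> exp_minus w \<le> exp_minus v"
  by (cases v; cases w) (auto simp: exp_minus_def)

lemma seminorm_mono:
  assumes "compact K'" "K \<subseteq> K'" "j \<le> j'"
  shows "exp_minus (gf_val K j u) \<le> exp_minus (gf_val K' j' u)"
proof (rule exp_minus_antimono)
  show "gf_val K' j' u \<noteq> -\<infinity>" using assms by (simp add: gf_val_not_MInf)
  show "gf_val K' j' u \<le> gf_val K j u"
    unfolding gf_val_def
  proof (rule Sup_subset_mono, clarify)
    fix b r assume r: "gf_represents r u" "(\<lambda>\<epsilon>. Cj_norm K' j' (r \<epsilon>)) \<in> O[at_right 0](\<lambda>\<epsilon>. \<epsilon> powr b)"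
    have "(\<lambda>\<epsilon>. Cj_norm K j (r \<epsilon>)) \<in> O[at_right 0](\<lambda>\<epsilon>. \<epsilon> powr b)"
    proof (rule bigo_dom[OF r(2)])
      fix \<epsilon> :: real assume "\<epsilon> \<in> {0<..1}"
      then have s: "smooth (r \<epsilon>)" by (rule gf_represents_smooth[OF r(1)])
      have "0 \<le> Cj_norm K j (r \<epsilon>)"
        unfolding Cj_norm_def
      proof (rule cSup_upper[OF insertI1], rule bdd_above_mono)
        show "bdd_above (insert 0 {norm (multi_deriv \<alpha> (r \<epsilon>) x) | \<alpha> x. mi_order \<alpha> \<le> j' \<and> x \<in> K'})"
          by (rule bdd_aboveI[OF Cj_norm_bounds(1)[OF assms(1) s]])
      qed (use assms(2,3) le_trans in blast)
      then show "\<bar>Cj_norm K j (r \<epsilon>)\<bar> \<le> \<bar>Cj_norm K' j' (r \<epsilon>)\<bar>"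
        using Cj_norm_mono[OF assms(1) s assms(2,3)] by linarith
    qed
    with r(1) show "\<exists>b' r. ereal b = ereal b' \<and> gf_represents r u \<and>
        (\<lambda>\<epsilon>. Cj_norm K j (r \<epsilon>)) \<in> O[at_right 0](\<lambda>\<epsilon>. \<epsilon> powr b')" by blast
  qed
qed

lemma GK_nhd0_mono: "GK_nhd0 K W \<Longrightarrow> W \<subseteq> W' \<Longrightarrow> GK_nhd0 K W'"
  unfolding GK_nhd0_def by (meson subset_trans)

lemma GK_nhd0_Int:
  assumes "GK_nhd0 K W1" "GK_nhd0 K W2" shows "GK_nhd0 K (W1 \<inter> W2)"
proof -
  obtain K1 j1 d1 where 1: "d1 > 0" "compact K1" "K \<subseteq> interior K1"
    "{u \<in> GK K. exp_minus (gf_val K1 j1 u) < d1} \<subseteq> W1" using assms(1) unfolding GK_nhd0_def by blast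
  obtain K2 j2 d2 where 2: "d2 > 0" "compact K2" "K \<subseteq> interior K2"
    "{u \<in> GK K. exp_minus (gf_val K2 j2 u) < d2} \<subseteq> W2" using assms(2) unfolding GK_nhd0_def by blast
  let ?s = "\<lambda>u. exp_minus (gf_val (K1 \<union> K2) (max j1 j2) u)"
  have c: "compact (K1 \<union> K2)" using 1 2 by blast
  have le: "exp_minus (gf_val K1 j1 u) \<le> ?s u" "exp_minus (gf_val K2 j2 u) \<le> ?s u" for u
    by (rule seminorm_mono[OF c]; simp)+
  have "{u \<in> GK K. ?s u < min d1 d2} \<subseteq> W1 \<inter> W2"
  proof
    fix u assume u: "u \<in> {u \<in> GK K. ?s u < min d1 d2}"
    then have "exp_minus (gf_val K1 j1 u) < d1" "exp_minus (gf_val K2 j2 u) < d2"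
      using le[of u] by auto
    with u 1(4) 2(4) show "u \<in> W1 \<inter> W2" by blast
  qed
  moreover have "K \<subseteq> interior (K1 \<union> K2)"
    using 1(3) interior_mono[of K1 "K1 \<union> K2"] by blast
  ultimately show ?thesis
    unfolding GK_nhd0_def using c 1(1) 2(1) by (intro exI[of _ "K1 \<union> K2"] exI[of _ "max j1 j2"] exI[of _ "min d1 d2"]) auto
qed

lemma gf_scale_eps_inverse: "gc_eps_powr (- b) *\<^sub>G (gc_eps_powr b *\<^sub>G w) = w"
proof (transfer, goal_cases)
  case (1 b w)
  then have w: "gf_moderate w" by (simp add: gf_rel_def)
  have m: "gc_moderate (\<lambda>\<epsilon>. complex_of_real (\<epsilon> powr b))" for b
    by (simp add: gc_moderate_def eps_moderate_powr)
  let ?v = "\<lambda>\<epsilon> x. complex_of_real (\<epsilon> powr (- b)) * (complex_of_real (\<epsilon> powr b) * w \<epsilon> x)"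
  have "gf_moderate (\<lambda>\<epsilon> x. complex_of_real (\<epsilon> powr b) * w \<epsilon> x)"
    using gf_moderate_lin[OF m gc_moderate_const w w, of b 0] by simp
  from gf_moderate_lin[OF m gc_moderate_const this this, of "-b" 0]
  have "gf_moderate ?v" by simp
  moreover have "gf_negligible_on UNIV (\<lambda>\<epsilon> x. ?v \<epsilon> x - w \<epsilon> x)"
    unfolding gf_negligible_on_def
  proof (intro allI impI)
    fix K \<alpha>
    have z: "(\<lambda>x. ?v \<epsilon> x - w \<epsilon> x) = (\<lambda>x. 0)" if "\<epsilon> \<in> {0<..1}" for \<epsilon>
    proof -
      have "complex_of_real (\<epsilon> powr (- b)) * complex_of_real (\<epsilon> powr b) = 1"
        using that by (simp add: of_real_mult[symmetric] powr_add[symmetric] del: of_real_mult)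
      then show ?thesis by (simp add: mult.assoc[symmetric])
    qed
    show "eps_negligible (\<lambda>\<epsilon>. sup_norm K (multi_deriv \<alpha> (\<lambda>x. ?v \<epsilon> x - w \<epsilon> x)))"
      by (rule eps_negligible_dom[OF eps_negligible_zero]) (simp only: z multi_deriv_zero_fun sup_norm_zero order_refl)
  qed
  ultimately show ?case using w by (simp add: gf_rel_def)
qed

lemma Gc_base_Int:
  assumes "Gc_base U" "Gc_base V" shows "Gc_base (U \<inter> V)"
proof -
  have "gc_absorbent (U \<inter> V)"
    unfolding gc_absorbent_def
  proof
    fix u :: "'a gfun" assume u: "u \<in> Gc"
    obtain a1 where a1: "\<And>b. b \<le> a1 \<Longrightarrow> \<exists>w\<in>U. u = gc_eps_powr b *\<^sub>G w"
      using assms(1) u unfolding Gc_base_def gc_absorbent_def by blast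
    obtain a2 where a2: "\<And>b. b \<le> a2 \<Longrightarrow> \<exists>w\<in>V. u = gc_eps_powr b *\<^sub>G w"
      using assms(2) u unfolding Gc_base_def gc_absorbent_def by blast
    show "\<exists>a::real. \<forall>b\<le>a. \<exists>w\<in>U \<inter> V. u = gc_eps_powr b *\<^sub>G w"
    proof (intro exI[of _ "min a1 a2"] allI impI)
      fix b assume "b \<le> min a1 a2"
      then obtain w1 w2 where w: "w1 \<in> U" "u = gc_eps_powr b *\<^sub>G w1" "w2 \<in> V" "u = gc_eps_powr b *\<^sub>G w2"
        using a1[of b] a2[of b] by auto
      have "w1 = gc_eps_powr (- b) *\<^sub>G u"
        by (subst w(2)) (rule gf_scale_eps_inverse[symmetric])
      also have "\<dots> = w2"
        by (subst w(4)) (rule gf_scale_eps_inverse)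
      finally have "w1 \<in> U \<inter> V" using w(1,3) by blast
      with w(2) show "\<exists>w\<in>U \<inter> V. u = gc_eps_powr b *\<^sub>G w" by blast
    qed
  qed
  moreover have "GK_nhd0 K ((U \<inter> V) \<inter> GK K)" if K: "compact K" for K
  proof -
    have "GK_nhd0 K (U \<inter> GK K)" "GK_nhd0 K (V \<inter> GK K)"
      using assms K unfolding Gc_base_def by blast+
    then have "GK_nhd0 K ((U \<inter> GK K) \<inter> (V \<inter> GK K))" by (rule GK_nhd0_Int)
    then show ?thesis by (rule GK_nhd0_mono) blast
  qed
  moreover have "gc_balanced (U \<inter> V)"
    using assms by (simp add: Gc_base_def gc_balanced_def)
  moreover have "gc_convex (U \<inter> V)"
    using assms by (simp add: Gc_base_def gc_convex_def)
  ultimately show ?thesis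
    using assms by (simp add: Gc_base_def le_infI1)
qed

lemma istopology_Gc_open: "istopology (Gc_open :: 'n::{finite,linorder} gfun set \<Rightarrow> bool)"
  unfolding istopology_def
proof (intro conjI allI impI)
  fix S T :: "'n gfun set" assume *: "Gc_open S" "Gc_open T"
  have "\<exists>U. Gc_base U \<and> (\<forall>w\<in>U. u + w \<in> S \<inter> T)" if u: "u \<in> S \<inter> T" for u
  proof -
    obtain U V where U: "Gc_base U" "\<forall>w\<in>U. u + w \<in> S" and V: "Gc_base V" "\<forall>w\<in>V. u + w \<in> T"
      using * u unfolding Gc_open_def by blast
    have "Gc_base (U \<inter> V)"
      using Gc_base_Int U V by blast
    with U V show ?thesis by blast
  qed
  with * show "Gc_open (S \<inter> T)" unfolding Gc_open_def by blast
next
  fix \<S> :: "'n gfun set set" assume "\<forall>S\<in>\<S>. Gc_open S"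
  then show "Gc_open (\<Union>\<S>)" unfolding Gc_open_def by (meson Union_iff Sup_least)
qed

lemma openin_Gc_topology: "openin Gc_topology S \<longleftrightarrow> Gc_open S"
  by (simp add: Gc_topology_def istopology_Gc_open topology_inverse')

lemma gf_zero_on_mono: "gf_zero_on u V \<Longrightarrow> W \<subseteq> V \<Longrightarrow> gf_zero_on u W"
  by transfer (auto simp: gf_negligible_on_def)

lemma gf_zero_on_add: "gf_zero_on u V \<Longrightarrow> gf_zero_on v V \<Longrightarrow> gf_zero_on (u + v) V"
proof (transfer, goal_cases)
  case (1 u V v)
  then show ?case
    using gf_negligible_lin'[of u v "\<lambda>_. 1" "\<lambda>_. 1" V] by (simp add: gf_rel_def gf_moderate_smooth)
qed

lemma gf_zero_on_scale: "gf_zero_on u V \<Longrightarrow> gf_zero_on (z *\<^sub>G u) V"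
proof (transfer, goal_cases)
  case (1 u V z)
  then show ?case
    using gf_negligible_lin'[of u u z "\<lambda>_. 0" V] by (simp add: gf_rel_def gc_rel_def gf_moderate_smooth)
qed

lemma gf_supp_add: "gf_supp (u + v) \<subseteq> gf_supp u \<union> gf_supp v"
proof
  fix x assume x: "x \<in> gf_supp (u + v)"
  show "x \<in> gf_supp u \<union> gf_supp v"
  proof (rule ccontr)
    assume "x \<notin> gf_supp u \<union> gf_supp v"
    then obtain V W where V: "open V" "gf_zero_on u V" "x \<in> V" and W: "open W" "gf_zero_on v W" "x \<in> W"
      unfolding gf_supp_def by blast
    have "gf_zero_on (u + v) (V \<inter> W)"
      using gf_zero_on_mono[OF V(2)] gf_zero_on_mono[OF W(2)] by (intro gf_zero_on_add) auto
    with V W x show False unfolding gf_supp_def by blast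
  qed
qed

lemma gf_supp_scale: "gf_supp (z *\<^sub>G u) \<subseteq> gf_supp u"
  unfolding gf_supp_def using gf_zero_on_scale by blast

lemma closed_gf_supp: "closed (gf_supp u)"
  unfolding gf_supp_def by (intro closed_Compl open_Union) auto

lemma Gc_add: "u \<in> Gc \<Longrightarrow> v \<in> Gc \<Longrightarrow> u + v \<in> Gc"
  unfolding Gc_def using compact_Int_closed[OF compact_Un closed_gf_supp] gf_supp_add
  by (metis (no_types, lifting) Int_absorb1 mem_Collect_eq)

lemma Gc_scale: "u \<in> Gc \<Longrightarrow> z *\<^sub>G u \<in> Gc"
  unfolding Gc_def using compact_Int_closed[OF _ closed_gf_supp] gf_supp_scale
  by (metis (no_types, lifting) Int_absorb1 mem_Collect_eq)

lemma topspace_Gc_topology: "topspace Gc_topology = (Gc :: 'a::{finite,linorder} gfun set)"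
proof -
  have "gc_absorbent (Gc :: 'a gfun set)"
    unfolding gc_absorbent_def
  proof (intro ballI exI[of _ 0] allI impI)
    fix u :: "'a gfun" and b :: real assume u: "u \<in> Gc"
    show "\<exists>w\<in>Gc. u = gc_eps_powr b *\<^sub>G w"
      using gf_scale_eps_inverse[of "-b" u] Gc_scale[OF u] by (metis minus_minus)
  qed
  moreover have "GK_nhd0 K (Gc \<inter> GK K)" if "compact K" for K :: "'a space set"
  proof -
    obtain e where "K \<subseteq> ball 0 e"
      using compact_imp_bounded[OF \<open>compact K\<close>] bounded_subset_ballD by blast
    then have "compact (cball 0 e :: 'a space set)" "K \<subseteq> interior (cball 0 e)" by auto
    then show ?thesis
      unfolding GK_nhd0_def
      by (intro exI[of _ "cball 0 e"] exI[of _ 0] exI[of _ "1::real"]) (auto simp: GK_def)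
  qed
  ultimately have "Gc_base (Gc :: 'a gfun set)"
    by (simp add: Gc_base_def gc_balanced_def gc_convex_def Gc_add Gc_scale)
  then have "Gc_open (Gc :: 'a gfun set)"
    unfolding Gc_open_def using Gc_add by blast
  then show ?thesis
    by (metis Gc_open_def openin_Gc_topology openin_subset openin_topspace subset_antisym)
qed

end

theory Submission
  imports Defs "HOL-Computational_Algebra.Fundamental_Theorem_Algebra"
begin

text \<open>The Fourier transform in the first \<open>n - 1\<close> variables turns \<open>P\<^sub>\<epsilon>(D)\<close> into the ordinary differential
  operators \<open>P\<^sub>\<epsilon>(\<xi>', D\<^sub>n)\<close>. By hypothesis all roots \<open>z\<close> of \<open>P\<^sub>\<epsilon>(\<xi>', \<cdot>)\<close> satisfy \<open>Im z \<ge> c \<omega>\<^sub>\<epsilon>\<close>, and each factor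
  \<open>-D\<^sub>n - z\<close> of the transposed operator is inverted by \<open>g \<mapsto> \<i> \<integral>\<^sub>s\<^sup>\<infinity> e\<^sup>i\<^sup>z\<^sup>(\<^sup>t\<^sup>-\<^sup>s\<^sup>) g(t) dt\<close>. On functions supported in
  \<open>t \<le> A\<close> this costs \<open>exp (|c| \<omega>\<^sub>\<epsilon> A)\<close>, which is moderate because \<open>\<omega>\<^sub>\<epsilon> \<le> ln (1/\<epsilon>) + 1\<close>. The value of the solution
  at \<open>s = 0\<close> depends only on \<open>t \<ge> 0\<close>. By Fourier inversion, superposition of these values over \<open>\<xi>'\<close> gives a functional \<open>S\<^sub>\<epsilon>\<close>
  that sees \<open>f\<close> on \<open>x\<^sub>n \<ge> 0\<close> only, and for which \<open>S\<^sub>\<epsilon>(\<^sup>tP\<^sub>\<epsilon>(D) f)\<close> is \<open>f(0)\<close> up to the error of the inversion.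

  Two points need care. First, \<open>S\<^sub>\<epsilon>\<close> must be bounded by a power of \<open>1/\<epsilon>\<close>, although in the given
  representatives the coefficients of powers of \<open>\<zeta>\<^sub>n\<close> beyond the degree \<open>d\<close> may be nonzero negligible
  numbers, so that the leading coefficient of \<open>P\<^sub>\<epsilon>(\<xi>', \<cdot>)\<close> has no useful lower bound. Giving up one derivative of
  \<open>g\<close> gains a factor \<open>1 + |z|\<close> for each root (\<open>tail_op_bound_gain\<close>), and the leading coefficient times
  \<open>\<Prod>(1 + |z|)\<close> dominates every coefficient of the polynomial (\<open>norm_coeff_le_prod_roots\<close>), in particular the
  coefficient of \<open>\<zeta>\<^sub>n\<^sup>d\<close>; see \<open>ode_inverse_bound\<close>.

  Second, that coefficient is an invertible constant only up to terms with negligible coefficients, which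
  can be controlled only for bounded \<open>\<xi>'\<close>. The frequencies are therefore cut off at a level \<open>M\<^sub>\<epsilon>\<close> that grows
  faster than any power of \<open>1/\<epsilon>\<close> and yet so slowly that \<open>M\<^sub>\<epsilon>\<^sup>m\<close> times the negligible coefficients is negligible
  (\<open>superpolynomial_choice\<close>). The superposition is the finite sum given by a product of Fejer kernels on a
  box of half-width \<open>1/\<epsilon>\<close>. Its inversion error is \<open>O(\<epsilon>\<^sup>-\<^sup>1 M\<^sub>\<epsilon>\<^sup>-\<^sup>1\<^sup>/\<^sup>2)\<close> times a first order norm of \<open>f\<close>
  (\<open>approx_solution_transpose\<close>), hence negligible. The bound for \<open>S\<^sub>\<epsilon>\<close> is independent of \<open>M\<^sub>\<epsilon>\<close>, since two
  integrations by parts in each variable make the sum over frequencies converge (\<open>approx_solution_bound\<close>).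

  It remains to pass from the net \<open>S\<^sub>\<epsilon>\<close> to a continuous functional. Every compactly supported generalized
  function has a compactly supported representative (\<open>compact_representative\<close>, by a smooth cutoff), and a net
  with moderate bounds on a closed set \<open>H\<close> defines a basic functional with support in \<open>H\<close>
  (\<open>net_functional_basic\<close>, \<open>net_functional_supp\<close>).\<close>

section \<open>Solving ordinary differential equations backwards in time\<close>

text \<open>With \<open>D = -\<i> d/dt\<close> this is the inverse of \<open>-D - z\<close> on functions that vanish from \<open>B\<close> on. Of the two
  natural choices it is the one that integrates over later times: its value at \<open>0\<close> sees only
  \<open>t \<ge> 0\<close>, and this is where the support of the fundamental solution comes from.\<close>

definition tail_op :: "complex \<Rightarrow> real \<Rightarrow> (real \<Rightarrow> complex) \<Rightarrow> real \<Rightarrow> complex" where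
  "tail_op z B g s = \<i> * integral {s..B} (\<lambda>t. exp (\<i> * z * of_real (t - s)) * g t)"

lemma tail_op_deriv:
  assumes g: "continuous_on {0..B} g" and s: "s \<in> {0..B}"
  shows "(tail_op z B g has_vector_derivative (- \<i> * z * tail_op z B g s - \<i> * g s)) (at s within {0..B})"
proof -
  let ?h = "\<lambda>t. exp (\<i> * z * of_real t) * g t"
  have eq: "tail_op z B g u = \<i> * exp (- \<i> * z * of_real u) * integral {u..B} ?h" for u
  proof -
    have "(\<lambda>t. exp (\<i> * z * of_real (t - u)) * g t) = (\<lambda>t. exp (- \<i> * z * of_real u) * ?h t)"
      by (simp add: fun_eq_iff algebra_simps flip: exp_add)
    then show ?thesis unfolding tail_op_def by (simp add: mult.assoc)
  qed
  have "continuous_on {0..B} ?h" by (intro continuous_intros g)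
  from integral_has_vector_derivative'[OF this s]
  have 1: "((\<lambda>u. integral {u..B} ?h) has_vector_derivative - ?h s) (at s within {0..B})" .
  have 2: "((\<lambda>u. exp (- \<i> * z * complex_of_real u)) has_vector_derivative - \<i> * z * exp (- \<i> * z * of_real s)) (at s within {0..B})"
    by (rule has_vector_derivative_real_field) (auto intro!: derivative_eq_intros)
  have e: "exp (\<i> * (z * complex_of_real s)) * exp (- (\<i> * (z * complex_of_real s))) = 1"
    by (simp flip: exp_add)
  have 3: "((\<lambda>u. \<i> * (exp (- \<i> * z * of_real u) * integral {u..B} ?h)) has_vector_derivative
      \<i> * (exp (- \<i> * z * of_real s) * (- ?h s) + (- \<i> * z * exp (- \<i> * z * of_real s)) * integral {s..B} ?h)) (at s within {0..B})"
    by (intro has_vector_derivative_mult_right has_vector_derivative_mult 1 2)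
  have val: "\<i> * (exp (- \<i> * z * of_real s) * (- ?h s) + (- \<i> * z * exp (- \<i> * z * of_real s)) * integral {s..B} ?h)
     = - \<i> * z * tail_op z B g s - \<i> * g s"
    unfolding eq using e by (simp add: algebra_simps)
  show ?thesis
    using 3 unfolding val unfolding eq by (simp add: mult.assoc)
qed

lemma tail_op_continuous:
  "continuous_on {0..B} g \<Longrightarrow> continuous_on {0..B} (tail_op z B g)"
  by (rule continuous_on_vector_derivative, rule tail_op_deriv)

text \<open>Comparison with the derivative of \<^term>\<open>tail_op z B g\<close> shows that the operator commutes with
  \<open>d/dt\<close> when \<open>g\<close> vanishes at \<open>B\<close>.\<close>

lemma tail_op_by_parts:
  assumes g: "\<And>t. t \<in> {0..B} \<Longrightarrow> (g has_vector_derivative g' t) (at t within {0..B})"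
    and g': "continuous_on {0..B} g'" and gB: "g B = 0" and s: "s \<in> {0..B}"
  shows "tail_op z B g' s = - \<i> * z * tail_op z B g s - \<i> * g s"
proof -
  let ?e = "\<lambda>t. exp (\<i> * z * complex_of_real (t - s))"
  have sub: "{s..B} \<subseteq> {0..B}" using s by auto
  have gc: "continuous_on {s..B} g" "continuous_on {s..B} g'"
    using continuous_on_vector_derivative[OF g] g' continuous_on_subset sub by blast+
  have ge: "(?e has_vector_derivative \<i> * z * ?e t) (at t within {s..B})" for t
  proof -
    have "((\<lambda>w. exp (\<i> * z * (w - of_real s))) has_field_derivative \<i> * z * ?e t) (at (of_real t))"
      by (auto intro!: derivative_eq_intros)
    from has_vector_derivative_real_field[OF this] show ?thesis by simp
  qed
  have "((\<lambda>t. ?e t * g' t + \<i> * z * ?e t * g t) has_integral ?e B * g B - ?e s * g s) {s..B}"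
  proof (rule fundamental_theorem_of_calculus)
    fix t assume t: "t \<in> {s..B}"
    show "((\<lambda>t. ?e t * g t) has_vector_derivative ?e t * g' t + \<i> * z * ?e t * g t) (at t within {s..B})"
      using g[of t] t sub by (intro has_vector_derivative_mult ge) (auto intro: has_vector_derivative_within_subset)
  qed (use s in auto)
  then have I: "integral {s..B} (\<lambda>t. ?e t * g' t + \<i> * z * (?e t * g t)) = - g s"
    using gB by (simp add: integral_unique mult.assoc)
  have "integral {s..B} (\<lambda>t. ?e t * g' t + \<i> * z * (?e t * g t))
     = integral {s..B} (\<lambda>t. ?e t * g' t) + \<i> * z * integral {s..B} (\<lambda>t. ?e t * g t)"
    by (subst integral_add) (auto intro!: integrable_continuous_interval continuous_intros gc)
  with I have "integral {s..B} (\<lambda>t. ?e t * g' t) = - g s - \<i> * z * integral {s..B} (\<lambda>t. ?e t * g t)"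
    by (simp add: algebra_simps)
  then show ?thesis unfolding tail_op_def by (simp only:) (simp add: algebra_simps)
qed

lemma tail_op_cong:
  assumes "\<And>t. t \<in> {0..B} \<Longrightarrow> g t = h t" "s \<in> {0..B}"
  shows "tail_op z B g s = tail_op z B h s"
  unfolding tail_op_def by (intro arg_cong2[where f="(*)"] refl integral_cong) (use assms in auto)

lemma tail_op_lin:
  assumes "continuous_on {0..B} g" "continuous_on {0..B} h" "s \<in> {0..B}"
  shows "tail_op z B (\<lambda>t. a * g t + b * h t) s = a * tail_op z B g s + b * tail_op z B h s"
proof -
  have c: "continuous_on {s..B} g" "continuous_on {s..B} h"
    using assms by (auto intro: continuous_on_subset)
  let ?e = "\<lambda>t. exp (\<i> * z * complex_of_real (t - s))"
  have "(\<lambda>t. ?e t * (a * g t + b * h t)) = (\<lambda>t. a * (?e t * g t) + b * (?e t * h t))"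
    by (simp add: algebra_simps)
  then have "integral {s..B} (\<lambda>t. ?e t * (a * g t + b * h t))
    = a * integral {s..B} (\<lambda>t. ?e t * g t) + b * integral {s..B} (\<lambda>t. ?e t * h t)"
    by (simp only:, subst integral_add) (auto intro!: integrable_continuous_interval continuous_intros c)
  then show ?thesis unfolding tail_op_def by (simp add: algebra_simps)
qed

text \<open>The exponential is paid for the length \<open>A\<close> of the support and not for the length \<open>B\<close> of the
  interval. This matters because \<open>B\<close> will tend to infinity while \<open>A\<close> stays fixed.\<close>

lemma tail_op_bound:
  assumes g: "continuous_on {0..B} g" and s: "s \<in> {0..B}" and A: "0 \<le> A" "A \<le> B"
    and z: "- \<gamma> \<le> Im z" and \<gamma>: "0 \<le> \<gamma>" and X: "\<And>t. t \<in> {0..B} \<Longrightarrow> norm (g t) \<le> X"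
    and v: "\<And>t. A < B \<Longrightarrow> t \<in> {A..B} \<Longrightarrow> g t = 0"
  shows "norm (tail_op z B g s) \<le> A * exp (\<gamma> * A) * X"
proof -
  let ?f = "\<lambda>t. exp (\<i> * z * complex_of_real (t - s)) * g t"
  have c: "continuous_on {s..B} g" using s by (auto intro: continuous_on_subset[OF g])
  have X0: "0 \<le> X" using X[OF s] norm_ge_zero order_trans by blast
  have fb: "norm (?f t) \<le> exp (\<gamma> * A) * X" if t: "t \<in> {s..B}" for t
  proof (cases "t \<le> A")
    case True
    have "- Im z * (t - s) \<le> \<gamma> * (t - s)" using z t by (intro mult_right_mono) auto
    also have "\<dots> \<le> \<gamma> * A" using True s \<gamma> by (intro mult_left_mono) auto
    finally have "norm (exp (\<i> * z * complex_of_real (t - s))) \<le> exp (\<gamma> * A)" by (simp add: algebra_simps)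
    with X[of t] show ?thesis unfolding norm_mult using t s by (intro mult_mono) auto
  next
    case False
    then show ?thesis using v[of t] t X0 by simp
  qed
  have "norm (integral {s..B} ?f) \<le> A * (exp (\<gamma> * A) * X)"
  proof (cases "s \<le> A")
    case True
    have "?f integrable_on {s..B}"
      by (auto intro!: integrable_continuous_interval continuous_intros c)
    from Henstock_Kurzweil_Integration.integral_combine[OF True A(2) this]
    have "integral {s..B} ?f = integral {s..A} ?f + integral {A..B} ?f" by simp
    also have "integral {A..B} ?f = 0"
    proof (cases "A < B")
      case True
      then have "integral {A..B} ?f = integral {A..B} (\<lambda>t. 0)" by (intro integral_cong) (use v in auto)
      then show ?thesis by simp
    qed (use A(2) in simp)
    finally have "integral {s..B} ?f = integral {s..A} ?f" by simp
    also have "norm \<dots> \<le> exp (\<gamma> * A) * X * (A - s)"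
      by (rule integral_bound) (use True fb A s in \<open>auto intro!: continuous_intros continuous_on_subset[OF c]\<close>)
    also have "\<dots> \<le> exp (\<gamma> * A) * X * A" using s X0 by (intro mult_left_mono) auto
    finally show ?thesis by (simp add: algebra_simps)
  next
    case False
    then have "integral {s..B} ?f = integral {s..B} (\<lambda>t. 0)"
      by (intro integral_cong) (use v in auto)
    then show ?thesis using A X0 by simp
  qed
  then show ?thesis unfolding tail_op_def by (simp add: norm_mult mult.assoc)
qed

text \<open>A function together with all its derivatives, as a sequence: the operators below act on the whole
  sequence, so that smoothness never has to be established again.\<close>

definition deriv_chain :: "real \<Rightarrow> real \<Rightarrow> (nat \<Rightarrow> real \<Rightarrow> complex) \<Rightarrow> bool" where
  "deriv_chain A B G \<longleftrightarrow>
     (\<forall>j. \<forall>t\<in>{0..B}. (G j has_vector_derivative G (Suc j) t) (at t within {0..B})) \<and>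
     (\<forall>j. \<forall>t\<in>{A..B}. G j t = 0)"

lemma deriv_chain_continuous: "deriv_chain A B G \<Longrightarrow> continuous_on {0..B} (G j)"
  unfolding deriv_chain_def by (blast intro: continuous_on_vector_derivative)

lemma deriv_chain_tail_op_Suc:
  assumes G: "deriv_chain A B G" and "A \<le> B" and s: "s \<in> {0..B}"
  shows "tail_op z B (G (Suc j)) s = - \<i> * z * tail_op z B (G j) s - \<i> * G j s"
proof (rule tail_op_by_parts)
  show "continuous_on {0..B} (G (Suc j))" by (rule deriv_chain_continuous[OF G])
qed (use G s \<open>A \<le> B\<close> in \<open>auto simp: deriv_chain_def\<close>)

lemma deriv_chain_tail_op:
  assumes G: "deriv_chain A B G" and A: "0 \<le> A" "A \<le> B"
  shows "deriv_chain A B (\<lambda>j. tail_op z B (G j))"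
  unfolding deriv_chain_def
proof (intro conjI allI ballI)
  fix j t assume t: "t \<in> {0..B}"
  show "(tail_op z B (G j) has_vector_derivative tail_op z B (G (Suc j)) t) (at t within {0..B})"
    using tail_op_deriv[OF deriv_chain_continuous[OF G] t] deriv_chain_tail_op_Suc[OF G A(2) t] by simp
next
  fix j t assume t: "t \<in> {A..B}"
  have "integral {t..B} (\<lambda>u. exp (\<i> * z * of_real (u - t)) * G j u) = integral {t..B} (\<lambda>u. 0)"
    by (rule integral_cong) (use G t in \<open>auto simp: deriv_chain_def\<close>)
  then show "tail_op z B (G j) t = 0" by (simp add: tail_op_def)
qed

text \<open>The identity \<open>z T g = \<i> T g' - g\<close> for \<open>T = tail_op z B\<close> gains a factor \<open>|z|\<close> at the price of one
  derivative of \<open>g\<close>. The estimate is uniform over all \<open>z\<close> in the half plane.\<close>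

lemma tail_op_bound_gain:
  assumes G: "deriv_chain A B G" and s: "s \<in> {0..B}" and A: "0 \<le> A" "A \<le> B"
    and z: "- \<gamma> \<le> Im z" and \<gamma>: "0 \<le> \<gamma>"
    and X: "\<And>t. t \<in> {0..B} \<Longrightarrow> norm (G j t) \<le> X" "\<And>t. t \<in> {0..B} \<Longrightarrow> norm (G (Suc j) t) \<le> X"
  shows "norm (tail_op z B (G j) s) \<le> (2 * A * exp (\<gamma> * A) + 1) / (1 + norm z) * X"
proof -
  let ?C = "A * exp (\<gamma> * A)"
  have b: "norm (tail_op z B (G j) s) \<le> ?C * X" "norm (tail_op z B (G (Suc j)) s) \<le> ?C * X"
    by (rule tail_op_bound[OF deriv_chain_continuous[OF G] s A z \<gamma>];
        use X G in \<open>auto simp: deriv_chain_def\<close>)+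
  have "z * tail_op z B (G j) s = \<i> * tail_op z B (G (Suc j)) s - G j s"
    unfolding deriv_chain_tail_op_Suc[OF G A(2) s, of z j] by (simp add: algebra_simps)
  then have "norm z * norm (tail_op z B (G j) s) \<le> norm (tail_op z B (G (Suc j)) s) + norm (G j s)"
    by (metis norm_mult norm_triangle_ineq4 norm_ii mult_1)
  also have "\<dots> \<le> ?C * X + X" using b X(1)[OF s] by simp
  finally have "(1 + norm z) * norm (tail_op z B (G j) s) \<le> (2 * A * exp (\<gamma> * A) + 1) * X"
    using b(1) by (simp add: algebra_simps)
  then show ?thesis by (simp add: field_simps add_pos_nonneg)
qed

fun tail_ops :: "complex list \<Rightarrow> real \<Rightarrow> (real \<Rightarrow> complex) \<Rightarrow> real \<Rightarrow> complex" where
  "tail_ops [] B g = g"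
| "tail_ops (z # zs) B g = tail_ops zs B (tail_op z B g)"

lemma tail_ops_cong:
  assumes "\<And>t. t \<in> {0..B} \<Longrightarrow> g t = h t" "s \<in> {0..B}"
  shows "tail_ops zs B g s = tail_ops zs B h s"
  using assms
proof (induction zs arbitrary: g h)
  case (Cons z zs)
  show ?case by simp (rule Cons.IH; use Cons.prems tail_op_cong[of B g h] in blast)
qed simp

lemma tail_ops_lin:
  assumes "continuous_on {0..B} g" "continuous_on {0..B} h" "s \<in> {0..B}"
  shows "tail_ops zs B (\<lambda>t. a * g t + b * h t) s = a * tail_ops zs B g s + b * tail_ops zs B h s"
  using assms
proof (induction zs arbitrary: g h)
  case (Cons z zs)
  have "tail_ops zs B (tail_op z B (\<lambda>t. a * g t + b * h t)) s
     = tail_ops zs B (\<lambda>t. a * tail_op z B g t + b * tail_op z B h t) s"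
    by (rule tail_ops_cong) (use Cons.prems tail_op_lin in auto)
  also have "\<dots> = a * tail_ops zs B (tail_op z B g) s + b * tail_ops zs B (tail_op z B h) s"
    by (rule Cons.IH) (use Cons.prems tail_op_continuous in auto)
  finally show ?case by simp
qed simp

text \<open>Without information on supports the constant is not controlled; that each functional is a distribution
  requires no more.\<close>

lemma tail_ops_bounded:
  assumes "0 \<le> B"
  shows "\<exists>C. \<forall>g X. continuous_on {0..B} g \<longrightarrow> (\<forall>t\<in>{0..B}. norm (g t) \<le> X) \<longrightarrow>
    (\<forall>s\<in>{0..B}. norm (tail_ops zs B g s) \<le> C * X)"
proof (induction zs)
  case Nil
  then show ?case by (intro exI[of _ 1]) auto
next
  case (Cons z zs)
  then obtain C where C: "\<And>g X s. continuous_on {0..B} g \<Longrightarrow> (\<forall>t\<in>{0..B}. norm (g t) \<le> X) \<Longrightarrow>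
     s \<in> {0..B} \<Longrightarrow> norm (tail_ops zs B g s) \<le> C * X" by blast
  let ?D = "B * exp (\<bar>Im z\<bar> * B)"
  have "norm (tail_ops (z # zs) B g s) \<le> (C * ?D) * X"
    if g: "continuous_on {0..B} g" "\<forall>t\<in>{0..B}. norm (g t) \<le> X" "s \<in> {0..B}" for g X s
  proof -
    have "norm (tail_op z B g t) \<le> ?D * X" if "t \<in> {0..B}" for t
      by (rule tail_op_bound[OF g(1) that assms order_refl]) (use g(2) in auto)
    then have "norm (tail_ops zs B (tail_op z B g) s) \<le> C * (?D * X)"
      by (intro C tail_op_continuous g) auto
    then show ?thesis by (simp add: mult.assoc)
  qed
  then show ?case by blast
qed

lemma tail_ops_bound_gain:
  assumes "deriv_chain A B G" "s \<in> {0..B}" "0 \<le> A" "A \<le> B"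
    and "\<And>z. z \<in> set zs \<Longrightarrow> - \<gamma> \<le> Im z" "0 \<le> \<gamma>"
    and "\<And>j t. j \<le> length zs \<Longrightarrow> t \<in> {0..B} \<Longrightarrow> norm (G j t) \<le> X"
  shows "norm (tail_ops zs B (G 0) s) \<le> (2 * A * exp (\<gamma> * A) + 1) ^ length zs / (\<Prod>z\<leftarrow>zs. 1 + norm z) * X"
  using assms
proof (induction zs arbitrary: G X)
  case (Cons z zs)
  let ?C = "2 * A * exp (\<gamma> * A) + 1"
  have "norm (tail_ops zs B (tail_op z B (G 0)) s)
     \<le> ?C ^ length zs / (\<Prod>z\<leftarrow>zs. 1 + norm z) * (?C / (1 + norm z) * X)"
  proof (rule Cons.IH[of "\<lambda>j. tail_op z B (G j)"])
    show "deriv_chain A B (\<lambda>j. tail_op z B (G j))" by (rule deriv_chain_tail_op) (use Cons.prems in auto)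
    fix j t assume "j \<le> length zs" "t \<in> {0..B}"
    then show "norm (tail_op z B (G j) t) \<le> ?C / (1 + norm z) * X"
      by (intro tail_op_bound_gain[OF Cons.prems(1)]) (use Cons.prems in auto)
  qed (use Cons.prems in auto)
  then show ?case by (simp add: mult_ac)
qed simp

text \<open>This is \<open>p(-D) g\<close> for the function \<open>g = G 0\<close>, because \<open>-D = \<i> d/dt\<close>.\<close>

definition symbol_op :: "complex poly \<Rightarrow> (nat \<Rightarrow> real \<Rightarrow> complex) \<Rightarrow> real \<Rightarrow> complex" where
  "symbol_op p G t = (\<Sum>j\<le>degree p. coeff p j * \<i> ^ j * G j t)"

lemma symbol_op_upto: "degree p \<le> N \<Longrightarrow> symbol_op p G t = (\<Sum>j\<le>N. coeff p j * \<i> ^ j * G j t)"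
  unfolding symbol_op_def by (rule sum.mono_neutral_left) (auto simp: coeff_eq_0)

lemma symbol_op_factor:
  "symbol_op ([:- z, 1:] * p) G t = \<i> * symbol_op p (\<lambda>j. G (Suc j)) t - z * symbol_op p G t"
proof -
  let ?N = "degree p"
  have 1: "symbol_op p G t = (\<Sum>j\<le>Suc ?N. coeff p j * \<i> ^ j * G j t)"
    by (rule symbol_op_upto) simp
  have 2: "\<i> * symbol_op p (\<lambda>j. G (Suc j)) t
      = (\<Sum>j\<le>Suc ?N. (if j = 0 then 0 else coeff p (j - 1)) * \<i> ^ j * G j t)"
    by (subst sum.atMost_Suc_shift) (simp add: symbol_op_def sum_distrib_left mult_ac)
  have "degree ([:- z, 1:] * p) \<le> Suc ?N"
    by (rule order_trans[OF degree_mult_le]) simp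
  then have 3: "symbol_op ([:- z, 1:] * p) G t = (\<Sum>j\<le>Suc ?N. coeff ([:- z, 1:] * p) j * \<i> ^ j * G j t)"
    by (rule symbol_op_upto)
  show ?thesis
    unfolding 1 2 3 sum_distrib_left sum_subtractf[symmetric]
    by (rule sum.cong) (auto simp: coeff_pCons split: nat.splits, auto simp: algebra_simps)
qed

lemma deriv_chain_symbol_op:
  assumes "deriv_chain A B G"
  shows "deriv_chain A B (\<lambda>k. symbol_op p (\<lambda>j. G (k + j)))"
  using assms unfolding deriv_chain_def symbol_op_def
  by (auto intro!: derivative_eq_intros simp: algebra_simps)

text \<open>Peeling off one linear factor of the polynomial cancels one of the operators.\<close>

lemma tail_ops_inverse:
  assumes "deriv_chain A B G" "0 \<le> A" "A \<le> B" "s \<in> {0..B}"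
  shows "tail_ops zs B (symbol_op (smult l (\<Prod>z\<leftarrow>zs. [:- z, 1:])) G) s = l * G 0 s"
  using assms
proof (induction zs arbitrary: G)
  case Nil
  then show ?case by (simp add: symbol_op_def)
next
  case (Cons z zs)
  let ?p = "smult l (\<Prod>z\<leftarrow>zs. [:- z, 1:])"
  let ?Q = "\<lambda>k. symbol_op ?p (\<lambda>j. G (k + j))"
  have Q: "deriv_chain A B ?Q" by (rule deriv_chain_symbol_op) (rule Cons.prems)
  have c: "continuous_on {0..B} (?Q k)" for k by (rule deriv_chain_continuous[OF Q])
  have "smult l (\<Prod>z\<leftarrow>z # zs. [:- z, 1:]) = [:- z, 1:] * ?p" by simp
  then have f: "symbol_op (smult l (\<Prod>z\<leftarrow>z # zs. [:- z, 1:])) G = (\<lambda>t. \<i> * ?Q (Suc 0) t + (- z) * ?Q 0 t)"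
    using symbol_op_factor[of z ?p G] by (simp only:) (simp add: fun_eq_iff)
  have "tail_op z B (\<lambda>t. \<i> * ?Q (Suc 0) t + (- z) * ?Q 0 t) t = ?Q 0 t" if t: "t \<in> {0..B}" for t
    unfolding tail_op_lin[OF c c t] deriv_chain_tail_op_Suc[OF Q Cons.prems(3) t]
    by (simp add: algebra_simps)
  then have "tail_ops zs B (tail_op z B (\<lambda>t. \<i> * ?Q (Suc 0) t + (- z) * ?Q 0 t)) s = tail_ops zs B (?Q 0) s"
    by (rule tail_ops_cong) (use Cons.prems in auto)
  also have "\<dots> = l * G 0 s" using Cons.IH[of G] Cons.prems by simp
  finally show ?case unfolding f by simp
qed

text \<open>Every coefficient is \<open>l\<close> times a signed sum of products of distinct roots, and \<open>\<Prod>(1 + |z|)\<close> expands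
  into all such products. Combined with the gain of \<open>1 + |z|\<close> for each root, this bounds the inverse of
  \<open>p(-D)\<close> by the reciprocal of any coefficient of \<open>p\<close>, not just of the leading one.\<close>

lemma norm_coeff_le_prod_roots:
  "norm (coeff (smult l (\<Prod>z\<leftarrow>zs. [:- z, 1:])) j) \<le> norm l * (\<Prod>z\<leftarrow>zs. 1 + norm (z::complex))"
proof (induction zs arbitrary: j)
  case Nil
  then show ?case by (cases j) (auto simp: coeff_pCons one_pCons)
next
  case (Cons z zs)
  let ?p = "smult l (\<Prod>z\<leftarrow>zs. [:- z, 1:])" and ?X = "norm l * (\<Prod>z\<leftarrow>zs. 1 + norm z)"
  have "coeff (smult l (\<Prod>z\<leftarrow>z # zs. [:- z, 1:])) j
      = - z * coeff ?p j + (case j of 0 \<Rightarrow> 0 | Suc i \<Rightarrow> coeff ?p i)"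
    by (simp add: coeff_pCons algebra_simps split: nat.splits)
  also have "norm \<dots> \<le> norm z * ?X + ?X"
  proof (rule order_trans[OF norm_triangle_ineq], rule add_mono)
    show "norm (- z * coeff ?p j) \<le> norm z * ?X"
      unfolding norm_mult norm_minus_cancel by (rule mult_left_mono[OF Cons.IH]) simp
    show "norm (case j of 0 \<Rightarrow> 0 | Suc i \<Rightarrow> coeff ?p i) \<le> ?X"
      using order_trans[OF norm_ge_zero Cons.IH] Cons.IH by (auto split: nat.splits)
  qed
  finally show ?case by (simp add: algebra_simps)
qed

section \<open>Iterated integrals and the partial Fourier transform\<close>

definition coord_update :: "'n \<Rightarrow> real \<Rightarrow> ('n::finite) space \<Rightarrow> 'n space" where
  "coord_update i s x = (\<chi> j. if j = i then s else x $ j)"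

lemma coord_update_nth [simp]: "coord_update i s x $ j = (if j = i then s else x $ j)"
  by (simp add: coord_update_def)

lemma coord_update_eq: "coord_update i s x = x + (s - x $ i) *\<^sub>R axis i 1"
  by (simp add: vec_eq_iff axis_def)

lemma coord_update_commute:
  "i \<noteq> j \<Longrightarrow> coord_update i s (coord_update j t x) = coord_update j t (coord_update i s x)"
  by (simp add: vec_eq_iff)

lemma coord_update_twice [simp]: "coord_update i s (coord_update i t x) = coord_update i s x"
  by (simp add: vec_eq_iff)

lemma continuous_on_coord_update [continuous_intros]:
  assumes "continuous_on S g" "continuous_on S h"
  shows "continuous_on S (\<lambda>p. coord_update i (g p) (h p))"
  unfolding coord_update_eq by (intro continuous_intros assms)

text \<open>Differentiability along one coordinate direction is all that iterated one-dimensional integrals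
  require; continuity of both functions is included for differentiation under the integral.\<close>

definition line_deriv :: "'n \<Rightarrow> (('n::finite) space \<Rightarrow> complex) \<Rightarrow> ('n space \<Rightarrow> complex) \<Rightarrow> bool" where
  "line_deriv i F F' \<longleftrightarrow> continuous_on UNIV F \<and> continuous_on UNIV F' \<and>
     (\<forall>x s. ((\<lambda>s. F (coord_update i s x)) has_vector_derivative F' (coord_update i s x)) (at s))"

lemma line_deriv_smooth:
  assumes "smooth f" shows "line_deriv i f (partial_deriv i f)"
  unfolding line_deriv_def
proof (intro conjI allI)
  fix x s
  let ?z = "coord_update i s x"
  have f: "(f has_derivative frechet_derivative f (at ?z)) (at ?z)"
    using smooth_differentiable[OF assms] frechet_derivative_works by blast
  have g: "((\<lambda>s::real. coord_update i s x) has_derivative (\<lambda>h. h *\<^sub>R axis i 1)) (at s)"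
    unfolding coord_update_eq by (auto intro!: derivative_eq_intros)
  have "((\<lambda>s::real. f (coord_update i s x)) has_derivative (\<lambda>h. frechet_derivative f (at ?z) (h *\<^sub>R axis i 1))) (at s)"
    using diff_chain_at[OF g f] by (simp add: o_def)
  moreover have "frechet_derivative f (at ?z) (h *\<^sub>R axis i 1) = h *\<^sub>R partial_deriv i f ?z" for h
    unfolding partial_deriv_def using has_derivative_linear[OF f] linear_scale by blast
  ultimately show "((\<lambda>s. f (coord_update i s x)) has_vector_derivative partial_deriv i f ?z) (at s)"
    by (simp add: has_vector_derivative_def)
qed (use assms in \<open>auto intro: smooth_continuous smooth_partial\<close>)

primrec iter_integral :: "real \<Rightarrow> 'n list \<Rightarrow> (('n::finite) space \<Rightarrow> complex) \<Rightarrow> 'n space \<Rightarrow> complex" where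
  "iter_integral B [] F x = F x"
| "iter_integral B (i # is) F x = integral {-B..B} (\<lambda>s. iter_integral B is F (coord_update i s x))"

lemma iter_integral_continuous:
  "continuous_on UNIV F \<Longrightarrow> continuous_on UNIV (iter_integral B is F)"
proof (induction "is")
  case (Cons i "is")
  have "continuous_on (UNIV \<times> cbox (-B) B) (\<lambda>(x, s). iter_integral B is F (coord_update i s x))"
    unfolding split_beta
    by (rule continuous_on_compose2[OF Cons.IH[OF Cons.prems]]) (auto intro!: continuous_intros)
  from integral_continuous_on_param[OF this] show ?case by (simp add: fun_eq_iff[symmetric])
qed simp

lemma iter_integral_line_continuous:
  assumes "continuous_on UNIV F"
  shows "continuous_on S (\<lambda>s. iter_integral B is F (coord_update i s x))"
  by (rule continuous_on_compose2[OF iter_integral_continuous[OF assms]]) (auto intro!: continuous_intros)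

lemma iter_integral_lin:
  assumes "continuous_on UNIV F" "continuous_on UNIV G"
  shows "iter_integral B is (\<lambda>x. a * F x + b * G x) x = a * iter_integral B is F x + b * iter_integral B is G x"
proof (induction "is" arbitrary: x)
  case (Cons i "is")
  show ?case
    by (simp add: Cons, subst integral_add)
       (auto intro!: integrable_continuous_interval continuous_intros iter_integral_line_continuous assms)
qed simp

lemma iter_integral_scale:
  assumes "continuous_on UNIV F"
  shows "iter_integral B is (\<lambda>x. a * F x) x = a * iter_integral B is F x"
  using iter_integral_lin[OF assms assms, of B "is" a 0 x] by simp

lemma iter_integral_zero [simp]: "iter_integral B is (\<lambda>x. 0) x = 0"
  by (induction "is" arbitrary: x) simp_all

lemma iter_integral_sum:
  assumes "finite S" "\<And>k. k \<in> S \<Longrightarrow> continuous_on UNIV (F k)"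
  shows "iter_integral B is (\<lambda>x. \<Sum>k\<in>S. F k x) x = (\<Sum>k\<in>S. iter_integral B is (F k) x)"
  using assms
proof (induction S)
  case (insert k S)
  have "iter_integral B is (\<lambda>x. 1 * F k x + 1 * (\<Sum>k\<in>S. F k x)) x
     = 1 * iter_integral B is (F k) x + 1 * iter_integral B is (\<lambda>x. \<Sum>k\<in>S. F k x) x"
    by (rule iter_integral_lin) (use insert.prems in \<open>auto intro!: continuous_intros\<close>)
  with insert show ?case by simp
qed simp

lemma iter_integral_cong:
  assumes "\<And>y. (\<And>j. j \<notin> set is \<Longrightarrow> y $ j = x $ j) \<Longrightarrow> F y = G y"
  shows "iter_integral B is F x = iter_integral B is G x"
  using assms
proof (induction "is" arbitrary: x)
  case Nil
  then show ?case by simp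
next
  case (Cons i "is")
  have "iter_integral B is F (coord_update i s x) = iter_integral B is G (coord_update i s x)" for s
    by (rule Cons.IH, rule Cons.prems) auto
  then show ?case by simp
qed

lemma iter_integral_bound:
  assumes F: "continuous_on UNIV F" and "0 \<le> B"
    and X: "\<And>y. (\<And>j. j \<notin> set is \<Longrightarrow> y $ j = x $ j) \<Longrightarrow> norm (F y) \<le> X"
  shows "norm (iter_integral B is F x) \<le> (2 * B) ^ length is * X"
  using X
proof (induction "is" arbitrary: x)
  case Nil
  then show ?case by simp
next
  case (Cons i "is")
  have "norm (integral {-B..B} (\<lambda>s. iter_integral B is F (coord_update i s x))) \<le> (2 * B) ^ length is * X * (B - (- B))"
  proof (rule integral_bound)
    fix s assume "s \<in> {-B..B}"
    show "norm (iter_integral B is F (coord_update i s x)) \<le> (2 * B) ^ length is * X"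
      by (rule Cons.IH, rule Cons.prems) auto
  qed (use assms in \<open>auto intro!: iter_integral_line_continuous\<close>)
  then show ?case by (simp add: algebra_simps)
qed

lemma iter_integral_line_deriv:
  assumes F: "line_deriv j F F'" and j: "j \<notin> set is"
  shows "line_deriv j (iter_integral B is F) (iter_integral B is F')"
  using j
proof (induction "is")
  case Nil
  then show ?case using F by (simp add: line_deriv_def)
next
  case (Cons i "is")
  have c: "continuous_on UNIV F" "continuous_on UNIV F'" using F by (auto simp: line_deriv_def)
  have ij: "i \<noteq> j" using Cons.prems by auto
  have IH: "line_deriv j (iter_integral B is F) (iter_integral B is F')" using Cons by simp
  show ?case unfolding line_deriv_def
  proof (intro conjI allI)
    fix x s
    have "((\<lambda>s. integral (cbox (-B) B) (\<lambda>t. iter_integral B is F (coord_update i t (coord_update j s x))))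
        has_vector_derivative integral (cbox (-B) B) (\<lambda>t. iter_integral B is F' (coord_update i t (coord_update j s x))))
        (at s within UNIV)"
    proof (rule leibniz_rule_vector_derivative)
      fix s t
      show "((\<lambda>s. iter_integral B is F (coord_update i t (coord_update j s x))) has_vector_derivative
         iter_integral B is F' (coord_update i t (coord_update j s x))) (at s within UNIV)"
        unfolding coord_update_commute[OF ij] using IH by (simp add: line_deriv_def)
      show "(\<lambda>t. iter_integral B is F (coord_update i t (coord_update j s x))) integrable_on cbox (-B) B"
        using iter_integral_line_continuous[OF c(1)] by (intro integrable_continuous)
      show "continuous_on (UNIV \<times> cbox (-B) B) (\<lambda>(s, t). iter_integral B is F' (coord_update i t (coord_update j s x)))"
        unfolding split_beta
        by (rule continuous_on_compose2[OF iter_integral_continuous[OF c(2)]]) (auto intro!: continuous_intros)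
    qed auto
    then show "((\<lambda>s. iter_integral B (i # is) F (coord_update j s x)) has_vector_derivative
        iter_integral B (i # is) F' (coord_update j s x)) (at s)" by simp
  qed (intro iter_integral_continuous c)+
qed

text \<open>The fundamental theorem of calculus in the coordinate \<open>i\<close>; the integrals nested inside the
  \<open>i\<close>-th one commute with the derivative.\<close>

lemma iter_integral_deriv_zero:
  assumes F: "line_deriv i F F'" and B: "0 \<le> B" and i: "i \<in> set is" "distinct is"
    and v: "\<And>x. \<bar>x $ i\<bar> = B \<Longrightarrow> F x = 0"
  shows "iter_integral B is F' x = 0"
  using i
proof (induction "is" arbitrary: x)
  case (Cons j "is")
  show ?case
  proof (cases "j = i")
    case True
    then have ni: "i \<notin> set is" using Cons.prems by auto
    have 0: "iter_integral B is F (coord_update i s x) = 0" if "\<bar>s\<bar> = B" for s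
    proof -
      have "iter_integral B is F (coord_update i s x) = iter_integral B is (\<lambda>x. 0) (coord_update i s x)"
      proof (rule iter_integral_cong)
        fix y assume "\<And>j. j \<notin> set is \<Longrightarrow> y $ j = coord_update i s x $ j"
        from this[OF ni] show "F y = 0" using v that by simp
      qed
      then show ?thesis by simp
    qed
    have "((\<lambda>s. iter_integral B is F' (coord_update i s x)) has_integral
        iter_integral B is F (coord_update i B x) - iter_integral B is F (coord_update i (- B) x)) {-B..B}"
      using iter_integral_line_deriv[OF F ni, of B] B
      by (intro fundamental_theorem_of_calculus)
         (auto simp: line_deriv_def intro: has_vector_derivative_at_within)
    then show ?thesis using True 0 B by (auto dest: integral_unique)
  next
    case False
    then show ?thesis using Cons by simp
  qed
qed simp

definition character :: "('n \<Rightarrow> real) \<Rightarrow> ('n::finite) space \<Rightarrow> complex" where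
  "character \<xi> x = cis (\<Sum>i\<in>UNIV. \<xi> i * x $ i)"

lemma continuous_on_character [continuous_intros]: "continuous_on S (character \<xi>)"
  unfolding character_def by (intro continuous_intros)

lemma norm_character [simp]: "norm (character \<xi> x) = 1"
  by (simp add: character_def)

lemma character_deriv:
  "((\<lambda>s. character \<xi> (coord_update i s x)) has_vector_derivative \<i> * \<xi> i * character \<xi> (coord_update i s x)) (at s)"
proof -
  let ?r = "\<Sum>j\<in>UNIV - {i}. \<xi> j * x $ j"
  have "(\<Sum>j\<in>UNIV. \<xi> j * coord_update i s x $ j) = \<xi> i * s + ?r" for s
    by (subst sum.remove[of _ i]) (auto intro!: sum.cong)
  then have eq: "character \<xi> (coord_update i s x) = exp (\<i> * of_real (\<xi> i) * of_real s + \<i> * of_real ?r)" for s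
    unfolding character_def cis_conv_exp by (simp add: algebra_simps)
  have "((\<lambda>s. exp (\<i> * of_real (\<xi> i) * of_real s + \<i> * of_real ?r)) has_vector_derivative
     \<i> * of_real (\<xi> i) * exp (\<i> * of_real (\<xi> i) * of_real s + \<i> * of_real ?r)) (at s)"
    by (rule has_vector_derivative_real_field) (auto intro!: derivative_eq_intros)
  then show ?thesis unfolding eq .
qed

lemma line_deriv_character_mult:
  assumes "line_deriv i F F'"
  shows "line_deriv i (\<lambda>x. character \<xi> x * F x) (\<lambda>x. 1 * (character \<xi> x * F' x) + \<i> * \<xi> i * (character \<xi> x * F x))"
proof -
  have c: "continuous_on UNIV F" "continuous_on UNIV F'" and d: "\<And>x s. ((\<lambda>s. F (coord_update i s x)) has_vector_derivative F' (coord_update i s x)) (at s)"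
    using assms by (auto simp: line_deriv_def)
  show ?thesis unfolding line_deriv_def
  proof (intro conjI allI)
    fix x s
    show "((\<lambda>s. character \<xi> (coord_update i s x) * F (coord_update i s x)) has_vector_derivative
      1 * (character \<xi> (coord_update i s x) * F' (coord_update i s x)) +
          \<i> * \<xi> i * (character \<xi> (coord_update i s x) * F (coord_update i s x))) (at s)"
      using has_vector_derivative_mult[OF character_deriv[of \<xi> i x s] d[of x s]] by (simp add: mult.assoc)
  qed (intro continuous_intros c)+
qed

definition cube :: "real \<Rightarrow> ('n::finite) space set" where
  "cube A = {x. \<forall>i. \<bar>x $ i\<bar> \<le> A}"

lemma cube_eq_cbox: "cube A = cbox (\<chi> i. - A) (\<chi> i. A)"
  by (auto simp: cube_def mem_box_cart abs_le_iff minus_le_iff)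

lemma compact_cube [simp]: "compact (cube A)"
  by (simp add: cube_eq_cbox)

lemma test_functions_on_partial:
  assumes "closed K" "f \<in> test_functions_on K"
  shows "partial_deriv i f \<in> test_functions_on K"
proof -
  have "partial_deriv i f x = 0" if "x \<notin> K" for x
  proof -
    have "((\<lambda>x. 0) has_derivative (\<lambda>h. 0)) (at x within - K)" by simp
    then have "(f has_derivative (\<lambda>h. 0)) (at x within - K)"
      by (rule has_derivative_transform[rotated 2]) (use assms that in \<open>auto simp: test_functions_on_def\<close>)
    then have "(f has_derivative (\<lambda>h. 0)) (at x)"
      using at_within_open[of x "- K"] assms(1) that by (simp add: open_Compl)
    then show ?thesis unfolding partial_deriv_def using frechet_derivative_at by metis
  qed
  then show ?thesis using assms by (auto simp: test_functions_on_def smooth_partial)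
qed

lemma test_functions_on_funpow:
  "closed K \<Longrightarrow> f \<in> test_functions_on K \<Longrightarrow> (partial_deriv i ^^ k) f \<in> test_functions_on K"
  by (induction k) (auto intro: test_functions_on_partial)

lemma test_functions_on_foldr:
  "closed K \<Longrightarrow> f \<in> test_functions_on K \<Longrightarrow> foldr (\<lambda>i. partial_deriv i ^^ \<alpha> i) xs f \<in> test_functions_on K"
  by (induction xs) (auto intro: test_functions_on_funpow)

lemma test_functions_on_multi_deriv:
  "closed K \<Longrightarrow> f \<in> test_functions_on K \<Longrightarrow> multi_deriv \<alpha> f \<in> test_functions_on K"
  unfolding multi_deriv_def by (rule test_functions_on_foldr)

definition space_indices :: "'n::{finite,linorder} list" where
  "space_indices = sorted_list_of_set (UNIV - {last_index})"

lemma set_space_indices [simp]: "set space_indices = UNIV - {last_index}"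
  and distinct_space_indices [simp]: "distinct space_indices"
  by (simp_all add: space_indices_def)

text \<open>Fourier transform in all coordinates but the last, over a box of half-width \<open>B\<close>; the last
  coordinate \<open>t\<close> remains. The base point \<open>0\<close> is arbitrary, since its other coordinates are integrated out.\<close>

definition partial_fourier :: "real \<Rightarrow> ('n::{finite,linorder} \<Rightarrow> real) \<Rightarrow> ('n space \<Rightarrow> complex) \<Rightarrow> real \<Rightarrow> complex" where
  "partial_fourier B \<xi> f t = iter_integral B space_indices (\<lambda>x. character \<xi> x * f x) (coord_update last_index t 0)"

lemma partial_fourier_lin:
  assumes "continuous_on UNIV f" "continuous_on UNIV g"
  shows "partial_fourier B \<xi> (\<lambda>x. a * f x + b * g x) t = a * partial_fourier B \<xi> f t + b * partial_fourier B \<xi> g t"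
proof -
  have "(\<lambda>x. character \<xi> x * (a * f x + b * g x)) = (\<lambda>x. a * (character \<xi> x * f x) + b * (character \<xi> x * g x))"
    by (simp add: algebra_simps)
  then show ?thesis unfolding partial_fourier_def
    by (simp only:) (intro iter_integral_lin continuous_intros assms)
qed

lemma partial_fourier_continuous:
  assumes "continuous_on UNIV f"
  shows "continuous_on S (partial_fourier B \<xi> f)"
  unfolding partial_fourier_def
  by (intro iter_integral_line_continuous continuous_intros assms)

lemma partial_fourier_space_deriv:
  assumes f: "f \<in> test_functions_on (cube A)" and AB: "0 \<le> A" "A < B" and i: "i \<noteq> last_index"
  shows "partial_fourier B \<xi> (partial_deriv i f) t = - \<i> * \<xi> i * partial_fourier B \<xi> f t"
proof -
  have s: "smooth f" using f by (simp add: test_functions_on_def)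
  let ?y = "coord_update last_index t 0"
  have "iter_integral B space_indices (\<lambda>x. 1 * (character \<xi> x * partial_deriv i f x) + \<i> * \<xi> i * (character \<xi> x * f x)) ?y = 0"
  proof (rule iter_integral_deriv_zero[OF line_deriv_character_mult[OF line_deriv_smooth[OF s]]])
    fix x :: "'a space" assume "\<bar>x $ i\<bar> = B"
    then have "x \<notin> cube A" using AB unfolding cube_def by (auto intro!: exI[of _ i])
    then show "character \<xi> x * f x = 0" using f by (auto simp: test_functions_on_def)
  qed (use AB i in auto)
  also have "iter_integral B space_indices (\<lambda>x. 1 * (character \<xi> x * partial_deriv i f x) + \<i> * \<xi> i * (character \<xi> x * f x)) ?y
     = 1 * partial_fourier B \<xi> (partial_deriv i f) t + \<i> * \<xi> i * partial_fourier B \<xi> f t"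
    unfolding partial_fourier_def
    by (intro iter_integral_lin continuous_intros smooth_continuous smooth_partial s)
  finally show ?thesis by (simp add: eq_neg_iff_add_eq_0)
qed

lemma partial_fourier_space_derivs:
  assumes f: "f \<in> test_functions_on (cube A)" and AB: "0 \<le> A" "A < B" and i: "i \<noteq> last_index"
  shows "partial_fourier B \<xi> ((partial_deriv i ^^ k) f) t = (- \<i> * \<xi> i) ^ k * partial_fourier B \<xi> f t"
proof (induction k)
  case (Suc k)
  have "(partial_deriv i ^^ k) f \<in> test_functions_on (cube A)"
    by (intro test_functions_on_funpow f compact_imp_closed compact_cube)
  from partial_fourier_space_deriv[OF this AB i] Suc show ?case by simp
qed simp

lemma partial_fourier_time_deriv:
  assumes s: "smooth f" and z: "\<xi> last_index = 0"
  shows "(partial_fourier B \<xi> f has_vector_derivative partial_fourier B \<xi> (partial_deriv last_index f) t) (at t)"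
proof -
  have "line_deriv last_index (iter_integral B space_indices (\<lambda>x. character \<xi> x * f x))
     (iter_integral B space_indices (\<lambda>x. 1 * (character \<xi> x * partial_deriv last_index f x) + \<i> * \<xi> last_index * (character \<xi> x * f x)))"
    by (intro iter_integral_line_deriv line_deriv_character_mult line_deriv_smooth s) simp
  then show ?thesis
    unfolding line_deriv_def partial_fourier_def using z by simp
qed

text \<open>Derivatives in the integrated coordinates become factors, those in the last coordinate stay. The
  latter are first moved past the others, which smoothness permits.\<close>

lemma partial_fourier_foldr:
  assumes f: "f \<in> test_functions_on (cube A)" and AB: "0 \<le> A" "A < B" and d: "distinct xs"
  shows "partial_fourier B \<xi> (foldr (\<lambda>i. partial_deriv i ^^ \<alpha> i) xs f) t =
    (\<Prod>i\<in>set xs - {last_index}. (- \<i> * \<xi> i) ^ \<alpha> i) *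
      partial_fourier B \<xi> (if last_index \<in> set xs then (partial_deriv last_index ^^ \<alpha> last_index) f else f) t"
  using f d
proof (induction xs arbitrary: f)
  case Nil
  then show ?case by simp
next
  case (Cons y ys)
  have cl: "closed (cube A :: 'a space set)" by (simp add: compact_imp_closed)
  have s: "smooth f" using Cons.prems by (simp add: test_functions_on_def)
  show ?case
  proof (cases "y = last_index")
    case True
    have "foldr (\<lambda>i. partial_deriv i ^^ \<alpha> i) (y # ys) f = foldr (\<lambda>i. partial_deriv i ^^ \<alpha> i) ys ((partial_deriv y ^^ \<alpha> y) f)"
      by (simp add: partial_deriv_commute_foldr[OF s])
    moreover have "partial_fourier B \<xi> (foldr (\<lambda>i. partial_deriv i ^^ \<alpha> i) ys ((partial_deriv y ^^ \<alpha> y) f)) t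
       = (\<Prod>i\<in>set ys - {last_index}. (- \<i> * \<xi> i) ^ \<alpha> i) * partial_fourier B \<xi> ((partial_deriv y ^^ \<alpha> y) f) t"
      using Cons.IH[of "(partial_deriv y ^^ \<alpha> y) f"] Cons.prems True by (auto intro: test_functions_on_funpow[OF cl])
    ultimately show ?thesis using True by simp
  next
    case False
    have "foldr (\<lambda>i. partial_deriv i ^^ \<alpha> i) ys f \<in> test_functions_on (cube A)"
      by (intro test_functions_on_foldr Cons.prems cl)
    from partial_fourier_space_derivs[OF this AB False]
    have "partial_fourier B \<xi> (foldr (\<lambda>i. partial_deriv i ^^ \<alpha> i) (y # ys) f) t
       = (- \<i> * \<xi> y) ^ \<alpha> y * partial_fourier B \<xi> (foldr (\<lambda>i. partial_deriv i ^^ \<alpha> i) ys f) t" by simp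
    moreover have "set (y # ys) - {last_index} = insert y (set ys - {last_index})" using False by auto
    ultimately show ?thesis using Cons False by (simp add: mult.assoc)
  qed
qed

lemma partial_fourier_multi_deriv:
  assumes f: "f \<in> test_functions_on (cube A)" and AB: "0 \<le> A" "A < B"
  shows "partial_fourier B \<xi> (multi_deriv \<alpha> f) t =
    (\<Prod>i\<in>UNIV - {last_index}. (- \<i> * \<xi> i) ^ \<alpha> i) * partial_fourier B \<xi> ((partial_deriv last_index ^^ \<alpha> last_index) f) t"
  unfolding multi_deriv_def using partial_fourier_foldr[OF f AB, of "sorted_list_of_set UNIV"] by simp

section \<open>Fejer kernels and Fourier inversion\<close>

text \<open>The Fejer kernel of period \<open>2B\<close>. As a squared modulus it is nonnegative, and expanding the square
  shows its finitely many frequencies.\<close>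

definition fejer :: "real \<Rightarrow> nat \<Rightarrow> real \<Rightarrow> real" where
  "fejer B M s = (norm (\<Sum>j<M. cis (pi / B * real j * s)))\<^sup>2 / (2 * B * M)"

lemma fejer_nonneg: "0 < B \<Longrightarrow> 0 \<le> fejer B M s"
  by (simp add: fejer_def)

lemma continuous_on_fejer [continuous_intros]:
  assumes "continuous_on S g" shows "continuous_on S (\<lambda>x. fejer B M (g x))"
  unfolding fejer_def divide_inverse by (intro continuous_intros assms)

lemma fejer_integrable: "continuous_on {-B..B} g \<Longrightarrow> (\<lambda>s. g s * fejer B M s) integrable_on {-B..B}"
  for g :: "real \<Rightarrow> real"
  by (intro integrable_continuous_interval continuous_intros)

lemma cmod_sum_cis_square:
  "complex_of_real ((norm (\<Sum>j<M. cis (a * real j * s)))\<^sup>2) =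
     (\<Sum>(j, l)\<in>{..<M} \<times> {..<M}. cis (a * (real j - real l) * s))"
proof -
  have "complex_of_real ((norm (\<Sum>j<M. cis (a * real j * s)))\<^sup>2)
      = (\<Sum>j<M. cis (a * real j * s)) * (\<Sum>l<M. cis (- (a * real l * s)))"
    unfolding complex_norm_square by (simp add: cnj_sum cis_cnj)
  also have "\<dots> = (\<Sum>j<M. \<Sum>l<M. cis (a * (real j - real l) * s))"
    by (simp add: sum_product cis_mult algebra_simps)
  finally show ?thesis by (simp add: sum.cartesian_product)
qed

lemma fejer_expansion:
  "complex_of_real (fejer B M s) =
     (\<Sum>(j, l)\<in>{..<M} \<times> {..<M}. of_real (1 / (2 * B * M)) * cis (pi / B * (real j - real l) * s))"
  unfolding fejer_def of_real_divide cmod_sum_cis_square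
  by (simp add: sum_divide_distrib case_prod_beta)

lemma integral_cis_period:
  assumes B: "0 < B"
  shows "((\<lambda>s. cis (pi / B * of_int k * s)) has_integral (if k = 0 then 2 * of_real B else 0)) {-B..B}"
proof (cases "k = 0")
  case True
  then show ?thesis using has_integral_const_real[of "1::complex" "-B" B] B by (simp add: scaleR_conv_of_real)
next
  case False
  let ?a = "pi / B * of_int k"
  have a: "?a \<noteq> 0" using False B by simp
  have "((\<lambda>s. cis (?a * s)) has_integral cis (?a * B) / (\<i> * of_real ?a) - cis (?a * - B) / (\<i> * of_real ?a)) {-B..B}"
  proof (rule fundamental_theorem_of_calculus)
    fix s
    have "((\<lambda>w. exp (\<i> * of_real ?a * w) / (\<i> * of_real ?a)) has_field_derivative exp (\<i> * of_real ?a * of_real s)) (at (of_real s))"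
      using a by (auto intro!: derivative_eq_intros)
    from has_vector_derivative_real_field[OF this]
    show "((\<lambda>s. cis (?a * s) / (\<i> * of_real ?a)) has_vector_derivative cis (?a * s)) (at s within {-B..B})"
      by (simp add: cis_conv_exp mult.assoc has_vector_derivative_at_within)
  qed (use B in auto)
  also have "cis (?a * B) = cis (?a * - B)"
  proof -
    have e: "?a * B = ?a * - B + 2 * pi * of_int k" using B by (simp add: field_simps)
    have "cis (x + 2 * pi * of_int k) = cis x" for x
      by (simp add: cis_mult[symmetric] cis_multiple_2pi)
    then show ?thesis by (simp only: e)
  qed
  finally show ?thesis using False by simp
qed

lemma integral_fejer:
  assumes B: "0 < B" and M: "0 < M"
  shows "(fejer B M has_integral 1) {-B..B}"
proof -
  let ?P = "{..<M} \<times> {..<M}"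
  have "((\<lambda>s. complex_of_real (fejer B M s)) has_integral
     (\<Sum>p\<in>?P. of_real (1 / (2 * B * M)) * (if int (fst p) - int (snd p) = 0 then 2 * of_real B else 0))) {-B..B}"
    unfolding fejer_expansion split_beta
  proof (intro has_integral_sum has_integral_mult_right)
    fix p
    show "((\<lambda>s. cis (pi / B * (real (fst p) - real (snd p)) * s)) has_integral
       (if int (fst p) - int (snd p) = 0 then 2 * of_real B else 0)) {-B..B}"
      using integral_cis_period[OF B, of "int (fst p) - int (snd p)"] by simp
  qed simp
  also have "(\<Sum>p\<in>?P. of_real (1 / (2 * B * M)) * (if int (fst p) - int (snd p) = 0 then 2 * complex_of_real B else 0))
     = (\<Sum>j<M. \<Sum>l<M. if j = l then of_real (1 / (2 * B * M)) * (2 * of_real B) else 0)"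
    by (subst sum.cartesian_product) (auto intro!: sum.cong)
  also have "\<dots> = 1" using B M by simp
  finally have "((\<lambda>s. complex_of_real (fejer B M s)) has_integral 1) {-B..B}" .
  from has_integral_Re[OF this] show ?thesis by simp
qed

text \<open>Concavity of the sine on \<open>[0, \<pi>/2]\<close>.\<close>

lemma jordan_sin:
  assumes "0 \<le> x" "x \<le> pi / 2" shows "2 / pi * x \<le> sin x"
proof -
  have "convex_on {0..pi/2} (\<lambda>x. - sin x)"
  proof (rule f''_ge0_imp_convex)
    show "((\<lambda>x. - sin x) has_real_derivative - cos x) (at x)" "((\<lambda>x. - cos x) has_real_derivative sin x) (at x)" for x
      by (auto intro!: derivative_eq_intros)
  qed (auto intro!: sin_ge_zero)
  from convex_onD[OF this, of "2 / pi * x" 0 "pi / 2"] show ?thesis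
    using assms by (simp add: field_simps)
qed

lemma norm_one_minus_cis: "(norm (1 - cis x))\<^sup>2 = 2 - 2 * cos x"
  by (simp add: cmod_power2 power2_diff)

text \<open>The factor \<open>|1 - e\<^sup>i\<^sup>\<pi>\<^sup>s\<^sup>/\<^sup>B|\<^sup>2\<close> telescopes the geometric sum in the kernel, which gives the second moment
  of the kernel up to constants; the first moment follows from \<open>2 \<delta> |s| \<le> \<delta>\<^sup>2 + s\<^sup>2\<close>.\<close>

lemma integral_fejer_abs:
  assumes B: "0 < B" and M: "0 < M"
  shows "integral {-B..B} (\<lambda>s. \<bar>s\<bar> * fejer B M s) \<le> B / sqrt M"
proof -
  let ?z = "\<lambda>s. cis (pi / B * s)"
  have sq: "s\<^sup>2 \<le> B\<^sup>2 / 4 * (norm (1 - ?z s))\<^sup>2" if s: "s \<in> {-B..B}" for s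
  proof -
    let ?x = "pi * \<bar>s\<bar> / (2 * B)"
    have "?x \<le> pi / 2" using s B by (auto simp: field_simps)
    then have "2 / pi * ?x \<le> sin ?x" using B by (intro jordan_sin) auto
    then have j: "\<bar>s\<bar> / B \<le> sin ?x" by simp
    then have "(\<bar>s\<bar> / B)\<^sup>2 \<le> (sin ?x)\<^sup>2" using B by (intro power_mono) auto
    also have "(sin ?x)\<^sup>2 = (sin (pi * s / (2 * B)))\<^sup>2" by (cases "s \<ge> 0") auto
    finally have "(s / B)\<^sup>2 \<le> (sin (pi * s / (2 * B)))\<^sup>2" by (simp add: power_divide)
    moreover have "(norm (1 - ?z s))\<^sup>2 = 4 * (sin (pi * s / (2 * B)))\<^sup>2"
    proof -
      have e: "pi / B * s = 2 * (pi * s / (2 * B))" by simp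
      have "(norm (1 - ?z s))\<^sup>2 = 2 - 2 * cos (2 * (pi * s / (2 * B)))"
        by (simp only: norm_one_minus_cis e)
      also have "2 - 2 * cos (2 * (pi * s / (2 * B))) = 4 * (sin (pi * s / (2 * B)))\<^sup>2"
        by (simp only: cos_double_sin)  simp
      finally show ?thesis .
    qed
    ultimately have "(s / B)\<^sup>2 \<le> (norm (1 - ?z s))\<^sup>2 / 4" by simp
    then show ?thesis using B by (simp add: field_simps)
  qed
  have tel: "(norm (1 - ?z s))\<^sup>2 * fejer B M s = (2 - 2 * cos (pi / B * of_int (int M) * s)) / (2 * B * M)" for s
  proof -
    have p: "cis (pi / B * real j * s) = ?z s ^ j" for j
      unfolding Complex.DeMoivre by (rule arg_cong[where f=cis]) (simp add: mult_ac)
    have "(norm (1 - ?z s))\<^sup>2 * (norm (\<Sum>j<M. cis (pi / B * real j * s)))\<^sup>2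
       = (norm ((1 - ?z s) * (\<Sum>j<M. ?z s ^ j)))\<^sup>2"
      by (simp only: p norm_mult power_mult_distrib)
    also have "(1 - ?z s) * (\<Sum>j<M. ?z s ^ j) = 1 - ?z s ^ M"
      by (simp add: one_diff_power_eq)
    also have "?z s ^ M = cis (pi / B * of_int (int M) * s)"
      unfolding Complex.DeMoivre by (rule arg_cong[where f=cis]) (simp add: mult_ac)
    also have "(norm (1 - cis (pi / B * of_int (int M) * s)))\<^sup>2 = 2 - 2 * cos (pi / B * of_int (int M) * s)"
      by (rule norm_one_minus_cis)
    finally show ?thesis by (simp add: fejer_def)
  qed
  have "((\<lambda>s. cos (pi / B * of_int (int M) * s)) has_integral 0) {-B..B}"
    using has_integral_Re[OF integral_cis_period[OF B, of "int M"]] M by simp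
  then have "((\<lambda>s. (2 - 2 * cos (pi / B * of_int (int M) * s)) / (2 * B * M)) has_integral
      ((2 * B) *\<^sub>R 2 - 2 * 0) / (2 * B * M)) {-B..B}"
    using has_integral_const_real[of "2::real" "-B" B] B
    by (intro has_integral_divide has_integral_diff has_integral_mult_right) auto
  then have I: "((\<lambda>s. (norm (1 - ?z s))\<^sup>2 * fejer B M s) has_integral 2 / M) {-B..B}"
    unfolding tel using B by simp
  \<comment> \<open>the value that balances the two terms of the estimate below, up to a constant\<close>
  define \<delta> where "\<delta> = B / sqrt M"
  have \<delta>: "\<delta> > 0" using B M by (simp add: \<delta>_def)
  have "integral {-B..B} (\<lambda>s. \<bar>s\<bar> * fejer B M s)
     \<le> \<delta> / 2 * 1 + B\<^sup>2 / (8 * \<delta>) * (2 / M)"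
  proof (rule has_integral_le[OF integrable_integral])
    show "((\<lambda>s. \<delta> / 2 * fejer B M s + B\<^sup>2 / (8 * \<delta>) * ((norm (1 - ?z s))\<^sup>2 * fejer B M s)) has_integral
       \<delta> / 2 * 1 + B\<^sup>2 / (8 * \<delta>) * (2 / M)) {-B..B}"
      by (intro has_integral_add has_integral_mult_right integral_fejer B M I)
    show "(\<lambda>s. \<bar>s\<bar> * fejer B M s) integrable_on {-B..B}"
      by (intro fejer_integrable continuous_intros)
    fix s assume s: "s \<in> {-B..B}"
    have "0 \<le> (\<bar>s\<bar> - \<delta>)\<^sup>2" by simp
    then have "2 * \<delta> * \<bar>s\<bar> \<le> \<delta>\<^sup>2 + s\<^sup>2" by (simp add: power2_eq_square algebra_simps)
    then have "\<bar>s\<bar> \<le> \<delta> / 2 + s\<^sup>2 / (2 * \<delta>)" using \<delta> by (simp add: field_simps power2_eq_square)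
    also have "\<dots> \<le> \<delta> / 2 + (B\<^sup>2 / 4 * (norm (1 - ?z s))\<^sup>2) / (2 * \<delta>)"
      using sq[OF s] \<delta> by (intro add_left_mono divide_right_mono) auto
    finally have "\<bar>s\<bar> * fejer B M s \<le> (\<delta> / 2 + (B\<^sup>2 / 4 * (norm (1 - ?z s))\<^sup>2) / (2 * \<delta>)) * fejer B M s"
      by (rule mult_right_mono) (rule fejer_nonneg[OF B])
    then show "\<bar>s\<bar> * fejer B M s \<le> \<delta> / 2 * fejer B M s + B\<^sup>2 / (8 * \<delta>) * ((norm (1 - ?z s))\<^sup>2 * fejer B M s)"
      by (simp add: algebra_simps)
  qed
  also have "\<dots> \<le> B / sqrt M"
  proof -
    have "B\<^sup>2 / (8 * \<delta>) * (2 / M) = B / sqrt M / 4"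
      using B M unfolding \<delta>_def by (simp add: power2_eq_square field_simps)
    then show ?thesis using \<delta> unfolding \<delta>_def[symmetric] by simp
  qed
  finally show ?thesis .
qed

text \<open>A product of Fejer kernels is an approximate identity: positivity and total mass \<open>1\<close> turn the first
  moment into an error bound, one coordinate at a time.\<close>

lemma iter_integral_fejer_approx:
  assumes F: "continuous_on UNIV F" and B: "0 < B" and M: "0 < M" and d: "distinct is"
    and \<Lambda>: "\<And>i x s. i \<in> set is \<Longrightarrow> norm (F (coord_update i s x) - F (coord_update i 0 x)) \<le> \<Lambda> * \<bar>s\<bar>"
  shows "norm (iter_integral B is (\<lambda>x. of_real (\<Prod>i\<in>set is. fejer B M (x $ i)) * F x) x - F (\<chi> j. if j \<in> set is then 0 else x $ j))
     \<le> length is * (B / sqrt M * \<Lambda>)"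
  using d \<Lambda>
proof (induction "is" arbitrary: x)
  case Nil
  then show ?case by simp
next
  case (Cons i "is")
  let ?W = "\<lambda>x. complex_of_real (\<Prod>i\<in>set is. fejer B M (x $ i)) * F x"
  let ?Z = "F (\<chi> j. if j \<in> set (i # is) then 0 else x $ j)"
  have cW: "continuous_on UNIV ?W" by (intro continuous_intros F)
  have i: "i \<notin> set is" using Cons.prems by simp
  have \<Lambda>0: "0 \<le> \<Lambda>"
  proof -
    have "norm (F (coord_update i 1 0) - F (coord_update i 0 0)) \<le> \<Lambda> * \<bar>1\<bar>"
      by (rule Cons.prems(2)) simp
    from order_trans[OF norm_ge_zero this] show ?thesis by simp
  qed
  have step: "iter_integral B is (\<lambda>x. of_real (\<Prod>i\<in>set (i # is). fejer B M (x $ i)) * F x) (coord_update i s x)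
      = of_real (fejer B M s) * iter_integral B is ?W (coord_update i s x)" for s
  proof -
    have "iter_integral B is (\<lambda>x. of_real (\<Prod>i\<in>set (i # is). fejer B M (x $ i)) * F x) (coord_update i s x)
      = iter_integral B is (\<lambda>x. of_real (fejer B M s) * ?W x) (coord_update i s x)"
    proof (rule iter_integral_cong)
      fix y assume "\<And>j. j \<notin> set is \<Longrightarrow> y $ j = coord_update i s x $ j"
      from this[OF i] have "y $ i = s" by simp
      then show "of_real (\<Prod>i\<in>set (i # is). fejer B M (y $ i)) * F y = of_real (fejer B M s) * ?W y"
        using i by simp
    qed
    then show ?thesis by (simp only: iter_integral_scale[OF cW])
  qed
  have int1: "(\<lambda>s. of_real (fejer B M s) * iter_integral B is ?W (coord_update i s x)) integrable_on {-B..B}"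
    by (intro integrable_continuous_interval continuous_intros iter_integral_line_continuous cW)
  have int2: "((\<lambda>s. of_real (fejer B M s) * ?Z) has_integral ?Z) {-B..B}"
    using has_integral_mult_left[OF has_integral_of_real[OF integral_fejer[OF B M]], of ?Z] by simp
  let ?r = "real (length is) * (B / sqrt M * \<Lambda>)"
  let ?D = "iter_integral B (i # is) (\<lambda>x. of_real (\<Prod>i\<in>set (i # is). fejer B M (x $ i)) * F x) x - ?Z"
  let ?b = "\<lambda>s. ?r * fejer B M s + \<Lambda> * (\<bar>s\<bar> * fejer B M s)"
  have D: "?D = integral {-B..B} (\<lambda>s. of_real (fejer B M s) * iter_integral B is ?W (coord_update i s x) - of_real (fejer B M s) * ?Z)"
    unfolding iter_integral.simps step integral_diff[OF int1 has_integral_integrable[OF int2]] integral_unique[OF int2] ..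
  have 1: "norm ?D \<le> integral {-B..B} ?b"
    unfolding D
  proof (rule integral_norm_bound_integral)
    show "(\<lambda>s. of_real (fejer B M s) * iter_integral B is ?W (coord_update i s x) - of_real (fejer B M s) * ?Z) integrable_on {-B..B}"
      using int1 int2 by (intro integrable_diff) auto
    show "(\<lambda>s. ?r * fejer B M s + \<Lambda> * (\<bar>s\<bar> * fejer B M s)) integrable_on {-B..B}"
      by (intro integrable_continuous_interval continuous_intros)
    fix s assume "s \<in> {-B..B}"
    let ?Y = "F (\<chi> j. if j \<in> set is then 0 else coord_update i s x $ j)"
    have 1: "norm (iter_integral B is ?W (coord_update i s x) - ?Y) \<le> ?r"
      by (rule Cons.IH) (use Cons.prems in auto)
    have "(\<chi> j. if j \<in> set is then 0 else coord_update i s x $ j) = coord_update i s (\<chi> j. if j \<in> set is then 0 else x $ j)"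
      "(\<chi> j. if j \<in> set (i # is) then 0 else x $ j) = coord_update i 0 (\<chi> j. if j \<in> set is then 0 else x $ j)"
      using i by (auto simp: vec_eq_iff)
    then have 2: "norm (?Y - ?Z) \<le> \<Lambda> * \<bar>s\<bar>" using Cons.prems(2)[of i] by simp
    have "norm (iter_integral B is ?W (coord_update i s x) - ?Z) \<le> ?r + \<Lambda> * \<bar>s\<bar>"
      using 1 2 norm_triangle_le_diff norm_diff_triangle_le by blast
    then have "fejer B M s * norm (iter_integral B is ?W (coord_update i s x) - ?Z) \<le> fejer B M s * (?r + \<Lambda> * \<bar>s\<bar>)"
      by (rule mult_left_mono) (rule fejer_nonneg[OF B])
    then show "norm (of_real (fejer B M s) * iter_integral B is ?W (coord_update i s x) - of_real (fejer B M s) * ?Z)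
       \<le> ?r * fejer B M s + \<Lambda> * (\<bar>s\<bar> * fejer B M s)"
      using fejer_nonneg[OF B, of M s]
      by (simp add: right_diff_distrib[symmetric] norm_mult del: set_simps) (simp add: algebra_simps)
  qed
  have "(\<lambda>s. \<bar>s\<bar> * fejer B M s) integrable_on {-B..B}" by (intro fejer_integrable continuous_intros)
  then have "(?b has_integral (?r * 1 + \<Lambda> * integral {-B..B} (\<lambda>s. \<bar>s\<bar> * fejer B M s))) {-B..B}"
    by (intro has_integral_add[OF has_integral_mult_right[OF integral_fejer[OF B M]]]
        has_integral_mult_right[OF integrable_integral])
  then have 2: "integral {-B..B} ?b = ?r + \<Lambda> * integral {-B..B} (\<lambda>s. \<bar>s\<bar> * fejer B M s)"
    by (simp only: integral_unique mult_1_right)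
  have 3: "\<Lambda> * integral {-B..B} (\<lambda>s. \<bar>s\<bar> * fejer B M s) \<le> \<Lambda> * (B / sqrt M)"
    by (rule mult_left_mono[OF integral_fejer_abs[OF B M] \<Lambda>0])
  have 4: "real (length (i # is)) * (B / sqrt M * \<Lambda>) = ?r + \<Lambda> * (B / sqrt M)"
    by (simp add: algebra_simps add_divide_distrib)
  show ?case unfolding 4 using 1 2 3 by linarith
qed

lemma line_deriv_lipschitz:
  assumes F: "line_deriv i F F'" and b: "\<And>x. norm (F' x) \<le> \<Lambda>"
  shows "norm (F (coord_update i s x) - F (coord_update i t x)) \<le> \<Lambda> * \<bar>s - t\<bar>"
proof -
  have "norm (F (coord_update i s x) - F (coord_update i t x)) \<le> \<Lambda> * norm (s - t)"
  proof (rule differentiable_bound[of UNIV "\<lambda>s. F (coord_update i s x)" "\<lambda>s h. h *\<^sub>R F' (coord_update i s x)"])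
    fix u
    show "((\<lambda>s. F (coord_update i s x)) has_derivative (\<lambda>h. h *\<^sub>R F' (coord_update i u x))) (at u within UNIV)"
      using F by (simp add: line_deriv_def has_vector_derivative_def)
    show "onorm (\<lambda>h. h *\<^sub>R F' (coord_update i u x)) \<le> \<Lambda>"
      by (rule onorm_le) (simp add: mult.commute[of \<Lambda>] mult_left_mono b)
  qed auto
  then show ?thesis by simp
qed

text \<open>Pairs \<open>(j, l)\<close> in each coordinate rather than differences \<open>j - l\<close>: the double sum in the square
  need not be collected.\<close>

definition freq_index :: "nat \<Rightarrow> ('n::{finite,linorder} \<Rightarrow> nat \<times> nat) set" where
  "freq_index M = PiE (UNIV - {last_index}) (\<lambda>_. {..<M} \<times> {..<M})"

definition freq :: "real \<Rightarrow> ('n::{finite,linorder} \<Rightarrow> nat \<times> nat) \<Rightarrow> 'n \<Rightarrow> real" where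
  "freq B k i = (if i = last_index then 0 else pi / B * (real (fst (k i)) - real (snd (k i))))"

lemma finite_freq_index [simp]: "finite (freq_index M)"
  unfolding freq_index_def by (intro finite_PiE) auto

lemma freq_last [simp]: "freq B k last_index = 0"
  by (simp add: freq_def)

lemma cis_sum: "finite S \<Longrightarrow> cis (\<Sum>i\<in>S. g i) = (\<Prod>i\<in>S. cis (g i))"
  by (induction S rule: finite_induct) (simp_all add: cis_mult[symmetric])

lemma prod_fejer_expansion:
  fixes x :: "('n::{finite,linorder}) space"
  shows "complex_of_real (\<Prod>i\<in>UNIV - {last_index}. fejer B M (x $ i)) =
   (\<Sum>k\<in>freq_index M. of_real ((1 / (2 * B * M)) ^ card (UNIV - {last_index :: 'n})) * character (freq B k) x)"
proof -
  let ?I = "UNIV - {last_index :: 'n}"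
  have "complex_of_real (\<Prod>i\<in>?I. fejer B M (x $ i)) =
     (\<Prod>i\<in>?I. \<Sum>p\<in>{..<M} \<times> {..<M}. of_real (1 / (2 * B * M)) * cis (pi / B * (real (fst p) - real (snd p)) * x $ i))"
    unfolding of_real_prod fejer_expansion split_beta ..
  also have "\<dots> = (\<Sum>k\<in>freq_index M. \<Prod>i\<in>?I. of_real (1 / (2 * B * M)) * cis (pi / B * (real (fst (k i)) - real (snd (k i))) * x $ i))"
    unfolding freq_index_def by (rule prod_sum_PiE) auto
  also have "\<dots> = (\<Sum>k\<in>freq_index M. of_real ((1 / (2 * B * M)) ^ card ?I) * character (freq B k) x)"
  proof (rule sum.cong[OF refl])
    fix k :: "'n \<Rightarrow> nat \<times> nat"
    have "(\<Sum>i\<in>UNIV. freq B k i * x $ i) = (\<Sum>i\<in>?I. freq B k i * x $ i)"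
      by (subst sum.remove[of _ "last_index :: 'n"]) auto
    also have "\<dots> = (\<Sum>i\<in>?I. pi / B * (real (fst (k i)) - real (snd (k i))) * x $ i)"
      by (rule sum.cong) (auto simp: freq_def)
    finally have "character (freq B k) x = (\<Prod>i\<in>?I. cis (pi / B * (real (fst (k i)) - real (snd (k i))) * x $ i))"
      unfolding character_def by (simp add: cis_sum)
    then show "(\<Prod>i\<in>?I. of_real (1 / (2 * B * M)) * cis (pi / B * (real (fst (k i)) - real (snd (k i))) * x $ i))
      = of_real ((1 / (2 * B * M)) ^ card ?I) * character (freq B k) x"
      by (simp only: prod.distrib prod_constant of_real_power)
  qed
  finally show ?thesis .
qed

lemma length_space_indices: "length (space_indices :: 'n::{finite,linorder} list) = card (UNIV - {last_index :: 'n})"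
  by (metis distinct_card distinct_space_indices set_space_indices)

text \<open>Pointwise Fourier inversion at the origin, with finitely many frequencies and a rate.\<close>

lemma fourier_fejer_approx:
  fixes f :: "('n::{finite,linorder}) space \<Rightarrow> complex"
  defines "N \<equiv> card (UNIV - {last_index :: 'n})"
  assumes f: "smooth f" and B: "0 < B" and M: "0 < M" and \<Lambda>: "\<And>i x. norm (partial_deriv i f x) \<le> \<Lambda>"
  shows "norm ((\<Sum>k\<in>freq_index M. of_real ((1 / (2 * B * M)) ^ N) * partial_fourier B (freq B k) f 0) - f 0)
    \<le> N * (B / sqrt M * \<Lambda>)"
proof -
  have c: "continuous_on UNIV f" using f by (rule smooth_continuous)
  let ?c = "complex_of_real ((1 / (2 * B * M)) ^ N)"
  have "(\<Sum>k\<in>freq_index M. ?c * partial_fourier B (freq B k) f 0)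
     = (\<Sum>k\<in>freq_index M. iter_integral B space_indices (\<lambda>x. ?c * (character (freq B k) x * f x)) (coord_update last_index 0 0))"
    unfolding partial_fourier_def
    by (intro sum.cong refl iter_integral_scale[symmetric] continuous_intros c)
  also have "\<dots> = iter_integral B space_indices (\<lambda>x. \<Sum>k\<in>freq_index M. ?c * (character (freq B k) x * f x)) (coord_update last_index 0 0)"
    by (intro iter_integral_sum[symmetric] continuous_intros c) simp
  also have "(\<lambda>x. \<Sum>k\<in>freq_index M. ?c * (character (freq B k) x * f x)) = (\<lambda>x. of_real (\<Prod>i\<in>set space_indices. fejer B M (x $ i)) * f x)"
    unfolding set_space_indices prod_fejer_expansion N_def sum_distrib_right by (simp add: mult.assoc)
  finally have eq: "(\<Sum>k\<in>freq_index M. ?c * partial_fourier B (freq B k) f 0) = iter_integral B space_indices (\<lambda>x. of_real (\<Prod>i\<in>set space_indices. fejer B M (x $ i)) * f x) (coord_update last_index 0 0)" .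
  have "norm (iter_integral B space_indices (\<lambda>x. of_real (\<Prod>i\<in>set space_indices. fejer B M (x $ i)) * f x) (coord_update last_index 0 0)
     - f (\<chi> j. if j \<in> set space_indices then 0 else coord_update last_index 0 0 $ j)) \<le> length (space_indices :: 'n list) * (B / sqrt M * \<Lambda>)"
  proof (rule iter_integral_fejer_approx[OF c B M])
    fix i x s
    show "norm (f (coord_update i s x) - f (coord_update i 0 x)) \<le> \<Lambda> * \<bar>s\<bar>"
      using line_deriv_lipschitz[OF line_deriv_smooth[OF f] \<Lambda>, of i s x 0] by simp
  qed simp
  also have "(\<chi> j. if j \<in> set space_indices then 0 else coord_update last_index 0 0 $ j) = (0 :: 'n space)"
    by (auto simp: vec_eq_iff)
  finally show ?thesis unfolding eq unfolding length_space_indices N_def .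
qed

text \<open>Split at \<open>l = j\<close>; each side is a part of \<open>1 + \<Sum>1/d\<^sup>2\<close>, which is compared with a telescoping sum.\<close>

lemma sum_inverse_max_square: "(\<Sum>l<M. 1 / max 1 ((real j - real l)\<^sup>2)) \<le> 6"
proof -
  define a where "a d = 1 / max 1 ((real d)\<^sup>2)" for d
  have a0: "0 \<le> a d" for d by (simp add: a_def)
  have "(\<Sum>d<Suc (Suc n). a d) \<le> 3 - 1 / Suc n" for n
  proof (induction n)
    case 0
    then show ?case by (simp add: a_def)
  next
    case (Suc n)
    have "a (Suc (Suc n)) = 1 / (real (Suc (Suc n)))\<^sup>2" by (simp add: a_def max_def)
    also have "\<dots> \<le> 1 / (real (Suc n) * real (Suc (Suc n)))"
      unfolding power2_eq_square by (intro divide_left_mono mult_right_mono) auto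
    also have "\<dots> = 1 / Suc n - 1 / Suc (Suc n)" by (simp add: field_simps)
    finally show ?case using Suc by simp
  qed
  then have "(\<Sum>d<Suc (Suc n). a d) \<le> 3" for n
    by (rule order_trans) simp
  moreover have "(\<Sum>d<n. a d) \<le> (\<Sum>d<Suc (Suc n). a d)" for n
    by (rule sum_mono2) (auto simp: a0)
  ultimately have a3: "(\<Sum>d<n. a d) \<le> 3" for n using order_trans by blast
  define g where "g l = 1 / max 1 ((real j - real l)\<^sup>2)" for l
  have g0: "0 \<le> g l" for l by (simp add: g_def)
  have "(\<Sum>l<M. g l) \<le> (\<Sum>l\<in>{..<Suc j} \<union> {j..<j + M}. g l)"
    by (rule sum_mono2) (auto simp: g0)
  also have "\<dots> \<le> (\<Sum>l<Suc j. g l) + (\<Sum>l\<in>{j..<j + M}. g l)"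
    using sum.union_inter[of "{..<Suc j}" "{j..<j + M}" g] sum_nonneg[of "{..<Suc j} \<inter> {j..<j + M}" g] g0 by simp
  also have "(\<Sum>l<Suc j. g l) = (\<Sum>d<Suc j. a d)"
    by (subst sum.nat_diff_reindex[symmetric]) (auto intro!: sum.cong simp: g_def a_def of_nat_diff)
  also have "(\<Sum>l\<in>{j..<j + M}. g l) = (\<Sum>d<M. a d)"
    by (subst sum.atLeastLessThan_shift_0) (auto intro!: sum.cong simp: g_def a_def)
  also have "(\<Sum>d<Suc j. a d) + (\<Sum>d<M. a d) \<le> 3 + 3" by (intro add_mono a3)
  finally show ?thesis by (simp add: g_def)
qed

text \<open>After division by \<open>M\<close> per coordinate this is bounded independently of \<open>M\<close>: quadratic decay in each
  frequency suffices for a sum whose number of terms will not be moderate.\<close>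

lemma sum_freq_decay:
  assumes B: "0 < B"
  shows "(\<Sum>k\<in>freq_index M. \<Prod>i\<in>UNIV - {last_index :: 'n}. 1 / max 1 ((freq B k i)\<^sup>2))
    \<le> (real M * 6 * (1 + (B / pi)\<^sup>2)) ^ card (UNIV - {last_index :: 'n::{finite,linorder}})"
proof -
  let ?I = "UNIV - {last_index :: 'n}"
  let ?q = "\<lambda>p. 1 / max 1 ((pi / B * (real (fst p) - real (snd p)))\<^sup>2)"
  have "(\<Sum>k\<in>freq_index M. \<Prod>i\<in>?I. 1 / max 1 ((freq B k i)\<^sup>2)) = (\<Sum>k\<in>freq_index M. \<Prod>i\<in>?I. ?q (k i))"
    by (intro sum.cong prod.cong refl) (auto simp: freq_def)
  also have "\<dots> = (\<Prod>i\<in>?I. \<Sum>p\<in>{..<M} \<times> {..<M}. ?q p)"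
    unfolding freq_index_def by (rule prod_sum_PiE[symmetric]) auto
  also have "\<dots> \<le> (\<Prod>i\<in>?I. real M * 6 * (1 + (B / pi)\<^sup>2))"
  proof (rule prod_mono, intro conjI)
    show "0 \<le> (\<Sum>p\<in>{..<M} \<times> {..<M}. ?q p)" by (intro sum_nonneg) simp
    have q: "1 / max 1 ((pi / B * d)\<^sup>2) \<le> (1 + (B / pi)\<^sup>2) * (1 / max 1 (d\<^sup>2))" for d :: real
    proof -
      have "max 1 (d\<^sup>2) \<le> (1 + (B / pi)\<^sup>2) * max 1 ((pi / B * d)\<^sup>2)"
      proof (rule max.boundedI)
        show "1 \<le> (1 + (B / pi)\<^sup>2) * max 1 ((pi / B * d)\<^sup>2)"
          using mult_mono[of 1 "1 + (B / pi)\<^sup>2" 1 "max 1 ((pi / B * d)\<^sup>2)"] by simp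
        have "d\<^sup>2 = (B / pi)\<^sup>2 * (pi / B * d)\<^sup>2" using B by (simp add: field_simps)
        also have "\<dots> \<le> (1 + (B / pi)\<^sup>2) * max 1 ((pi / B * d)\<^sup>2)" by (intro mult_mono) auto
        finally show "d\<^sup>2 \<le> (1 + (B / pi)\<^sup>2) * max 1 ((pi / B * d)\<^sup>2)" .
      qed
      moreover have "1 / v \<le> w * (1 / u)" if "u \<le> w * v" "0 < u" "0 < v" for u v w :: real
        using that by (simp add: field_simps)
      ultimately show ?thesis by simp
    qed
    have "(\<Sum>p\<in>{..<M} \<times> {..<M}. ?q p) \<le> (\<Sum>p\<in>{..<M} \<times> {..<M}. (1 + (B / pi)\<^sup>2) * (1 / max 1 ((real (fst p) - real (snd p))\<^sup>2)))"
      by (intro sum_mono q)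
    also have "\<dots> = (1 + (B / pi)\<^sup>2) * (\<Sum>j<M. \<Sum>l<M. 1 / max 1 ((real j - real l)\<^sup>2))"
      by (simp add: sum_distrib_left sum.cartesian_product case_prod_beta)
    also have "\<dots> \<le> (1 + (B / pi)\<^sup>2) * (\<Sum>j<M. 6)"
      by (intro mult_left_mono sum_mono sum_inverse_max_square) auto
    finally show "(\<Sum>p\<in>{..<M} \<times> {..<M}. ?q p) \<le> real M * 6 * (1 + (B / pi)\<^sup>2)" by (simp add: mult_ac)
  qed
  finally show ?thesis by simp
qed

section \<open>The approximate fundamental solution\<close>

definition root_list :: "complex poly \<Rightarrow> complex list" where
  "root_list p = (SOME zs. p = smult (lead_coeff p) (\<Prod>z\<leftarrow>zs. [:- z, 1:]))"

lemma root_list: "smult (lead_coeff p) (\<Prod>z\<leftarrow>root_list p. [:- z, 1:]) = p"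
proof -
  obtain zs where "mset zs = proots p" using ex_mset by blast
  then have "p = smult (lead_coeff p) (\<Prod>z\<leftarrow>zs. [:- z, 1:])"
    using complex_poly_decompose_multiset[of p] prod_mset_prod_list by (metis mset_map)
  then have "\<exists>zs. p = smult (lead_coeff p) (\<Prod>z\<leftarrow>zs. [:- z, 1:])" by blast
  from someI_ex[OF this] show ?thesis unfolding root_list_def by (rule sym)
qed

lemma root_list_root:
  assumes "z \<in> set (root_list p)" shows "poly p z = 0"
proof -
  have "poly (\<Prod>z\<leftarrow>zs. [:- z, 1:]) z = 0" if "z \<in> set zs" for zs
    using that by (induction zs) auto
  from this[OF assms] show ?thesis by (subst root_list[symmetric]) simp
qed

lemma length_root_list: "p \<noteq> 0 \<Longrightarrow> length (root_list p) = degree p"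
proof -
  assume p: "p \<noteq> 0"
  have "degree (\<Prod>z\<leftarrow>zs. [:- z, 1:]) = length zs" for zs :: "complex list"
  proof (induction zs)
    case (Cons z zs)
    have "(\<Prod>z\<leftarrow>zs. [:- z, 1:]) \<noteq> 0" by (auto simp: prod_list_zero_iff)
    then have "degree ([:- z, 1:] * (\<Prod>z\<leftarrow>zs. [:- z, 1:])) = 1 + degree (\<Prod>z\<leftarrow>zs. [:- z, 1:])"
      by (subst degree_mult_eq) auto
    then show ?case using Cons by simp
  qed simp
  then have "degree (smult (lead_coeff p) (\<Prod>z\<leftarrow>root_list p. [:- z, 1:])) = length (root_list p)"
    using p by (simp add: degree_smult_eq)
  then show ?thesis by (simp add: root_list)
qed

text \<open>The value at time \<open>0\<close> of the solution \<open>v\<close> of \<open>p(-D) v = g\<close> that vanishes for late times.\<close>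

definition ode_inverse :: "real \<Rightarrow> complex poly \<Rightarrow> (real \<Rightarrow> complex) \<Rightarrow> complex" where
  "ode_inverse B p g = tail_ops (root_list p) B g 0 / lead_coeff p"

lemma ode_inverse_lin:
  assumes "0 \<le> B" "continuous_on {0..B} g" "continuous_on {0..B} h"
  shows "ode_inverse B p (\<lambda>t. a * g t + b * h t) = a * ode_inverse B p g + b * ode_inverse B p h"
  unfolding ode_inverse_def using assms by (simp add: tail_ops_lin add_divide_distrib)

lemma ode_inverse_bounded:
  assumes "0 \<le> B"
  shows "\<exists>C. \<forall>g X. continuous_on {0..B} g \<longrightarrow> (\<forall>t\<in>{0..B}. norm (g t) \<le> X) \<longrightarrow> norm (ode_inverse B p g) \<le> C * X"
proof -
  obtain C where C: "\<And>g X s. continuous_on {0..B} g \<Longrightarrow> (\<forall>t\<in>{0..B}. norm (g t) \<le> X) \<Longrightarrow>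
    s \<in> {0..B} \<Longrightarrow> norm (tail_ops (root_list p) B g s) \<le> C * X"
    using tail_ops_bounded[OF assms] by blast
  show ?thesis
  proof (intro exI[of _ "C / norm (lead_coeff p)"] allI impI)
    fix g :: "real \<Rightarrow> complex" and X :: real assume "continuous_on {0..B} g" "\<forall>t\<in>{0..B}. norm (g t) \<le> X"
    from C[OF this, of 0] have "norm (tail_ops (root_list p) B g 0) / norm (lead_coeff p) \<le> C * X / norm (lead_coeff p)"
      using assms by (intro divide_right_mono) auto
    then show "norm (ode_inverse B p g) \<le> C / norm (lead_coeff p) * X"
      by (simp add: ode_inverse_def norm_divide)
  qed
qed

lemma ode_inverse_symbol_op:
  assumes "deriv_chain A B G" "0 \<le> A" "A \<le> B" "p \<noteq> 0"
  shows "ode_inverse B p (symbol_op p G) = G 0 0"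
  using tail_ops_inverse[OF assms(1-3), of 0 "root_list p" "lead_coeff p"] assms
  by (simp add: ode_inverse_def root_list)

text \<open>The index \<open>d\<close> is free. If the leading coefficients are tiny but some other coefficient is not, then
  some roots are large, and the gain from these roots compensates.\<close>

lemma ode_inverse_bound:
  assumes G: "deriv_chain A B G" and A: "0 \<le> A" "A \<le> B" and \<gamma>: "0 \<le> \<gamma>"
    and r: "\<And>z. poly p z = 0 \<Longrightarrow> - \<gamma> \<le> Im z" and m: "degree p \<le> m"
    and \<beta>: "0 < \<beta>" "\<beta> \<le> norm (coeff p d)"
    and X: "\<And>j t. j \<le> m \<Longrightarrow> t \<in> {0..B} \<Longrightarrow> norm (G j t) \<le> X"
  shows "norm (ode_inverse B p (G 0)) \<le> (2 * A * exp (\<gamma> * A) + 1) ^ m / \<beta> * X"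
proof -
  let ?zs = "root_list p" and ?l = "norm (lead_coeff p)" and ?C = "2 * A * exp (\<gamma> * A) + 1"
  let ?\<Pi> = "\<Prod>z\<leftarrow>?zs. 1 + norm z"
  have p: "p \<noteq> 0" using \<beta> by auto
  have len: "length ?zs \<le> m" using length_root_list[OF p] m by simp
  have X0: "0 \<le> X" using order_trans[OF norm_ge_zero X[of 0 0]] A by simp
  have C1: "1 \<le> ?C" using A by simp
  have \<Pi>: "0 < (\<Prod>z\<leftarrow>zs. 1 + norm z)" for zs :: "complex list"
    by (induction zs) (auto intro!: mult_pos_pos add_pos_nonneg)
  have "norm (tail_ops ?zs B (G 0) 0) \<le> ?C ^ length ?zs / ?\<Pi> * X"
    by (rule tail_ops_bound_gain[OF G _ A _ \<gamma>]) (use A len r root_list_root X in auto)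
  also have "\<dots> \<le> ?C ^ m / ?\<Pi> * X"
    using len C1 X0 \<Pi> by (intro mult_right_mono divide_right_mono power_increasing) (auto intro: less_imp_le)
  finally have 1: "norm (tail_ops ?zs B (G 0) 0) \<le> ?C ^ m / ?\<Pi> * X" .
  have "\<beta> \<le> ?l * ?\<Pi>"
    using norm_coeff_le_prod_roots[of "lead_coeff p" ?zs d] \<beta> by (simp add: root_list)
  moreover have l: "0 < ?l" using p by simp
  ultimately have 2: "1 / (?l * ?\<Pi>) \<le> 1 / \<beta>" using \<beta> by (intro divide_left_mono) (auto simp: \<Pi>)
  have "norm (ode_inverse B p (G 0)) \<le> (?C ^ m / ?\<Pi> * X) / ?l"
    unfolding ode_inverse_def norm_divide using 1 l by (intro divide_right_mono) auto
  also have "\<dots> = ?C ^ m * X * (1 / (?l * ?\<Pi>))" by simp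
  also have "\<dots> \<le> ?C ^ m * X * (1 / \<beta>)" using 2 X0 C1 by (intro mult_left_mono) auto
  finally show ?thesis by simp
qed

lemma Cj_norm_upper:
  assumes "compact K" "smooth f" "mi_order \<alpha> \<le> j" "x \<in> K"
  shows "norm (multi_deriv \<alpha> f x) \<le> Cj_norm K j f"
  unfolding Cj_norm_def
proof (rule cSup_upper)
  show "bdd_above (insert 0 {norm (multi_deriv \<alpha> f x) | \<alpha> x. mi_order \<alpha> \<le> j \<and> x \<in> K})"
    by (rule bdd_aboveI[OF Cj_norm_bounds(1)[OF assms(1,2)]])
qed (use assms in blast)

lemma test_functions_on_smooth: "f \<in> test_functions_on K \<Longrightarrow> smooth f"
  by (simp add: test_functions_on_def)

lemma test_functions_on_zero: "f \<in> test_functions_on K \<Longrightarrow> x \<notin> K \<Longrightarrow> f x = 0"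
  by (simp add: test_functions_on_def)

lemma partial_fourier_bound:
  fixes f :: "('n::{finite,linorder}) space \<Rightarrow> complex"
  assumes f: "continuous_on UNIV f" and B: "0 \<le> B" and X: "\<And>y. y $ last_index = t \<Longrightarrow> norm (f y) \<le> X"
  shows "norm (partial_fourier B \<xi> f t) \<le> (2 * B) ^ card (UNIV - {last_index :: 'n}) * X"
  unfolding partial_fourier_def length_space_indices[symmetric]
proof (rule iter_integral_bound)
  show "continuous_on UNIV (\<lambda>x. character \<xi> x * f x)" by (intro continuous_intros f)
  fix y :: "'n space" assume "\<And>j. j \<notin> set space_indices \<Longrightarrow> y $ j = coord_update last_index t 0 $ j"
  from this[of last_index] have "y $ last_index = t" by simp
  then show "norm (character \<xi> y * f y) \<le> X" by (simp add: norm_mult X)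
qed (rule B)

lemma partial_fourier_chain:
  fixes f :: "('n::{finite,linorder}) space \<Rightarrow> complex"
  assumes f: "f \<in> test_functions_on (cube A)" and A: "0 \<le> A" "A < A'" "A' \<le> B" and \<xi>: "\<xi> last_index = 0"
  shows "deriv_chain A' B (\<lambda>j. partial_fourier B \<xi> ((partial_deriv last_index ^^ j) f))"
  unfolding deriv_chain_def
proof (intro conjI allI ballI)
  fix j t
  have t: "(partial_deriv last_index ^^ j) f \<in> test_functions_on (cube A)" for j
    by (intro test_functions_on_funpow f compact_imp_closed compact_cube)
  show "(partial_fourier B \<xi> ((partial_deriv last_index ^^ j) f) has_vector_derivative
     partial_fourier B \<xi> ((partial_deriv last_index ^^ Suc j) f) t) (at t within {0..B})"
    using partial_fourier_time_deriv[of "(partial_deriv last_index ^^ j) f" \<xi> B t, OF test_functions_on_smooth[OF t] \<xi>]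
    by (simp add: has_vector_derivative_at_within)
  assume tt: "t \<in> {A'..B}"
  have "norm (partial_fourier B \<xi> ((partial_deriv last_index ^^ j) f) t) \<le> (2 * B) ^ card (UNIV - {last_index :: 'n}) * 0"
  proof (rule partial_fourier_bound)
    fix y :: "'n space" assume "y $ last_index = t"
    then have "y \<notin> cube A" using tt A by (auto simp: cube_def intro!: exI[of _ last_index])
    then show "norm ((partial_deriv last_index ^^ j) f y) \<le> 0" using test_functions_on_zero[OF t] by simp
  qed (use A in \<open>auto intro: smooth_continuous[OF test_functions_on_smooth[OF t]]\<close>)
  then show "partial_fourier B \<xi> ((partial_deriv last_index ^^ j) f) t = 0" by simp
qed

text \<open>Two integrations by parts in each coordinate with \<open>|\<xi>\<^sub>i| > 1\<close>. Only derivatives at points with last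
  coordinate \<open>t\<close> enter, hence the restriction to a half space.\<close>

lemma partial_fourier_decay:
  fixes f :: "('n::{finite,linorder}) space \<Rightarrow> complex"
  defines "N \<equiv> card (UNIV - {last_index :: 'n})"
  assumes f: "f \<in> test_functions_on (cube A)" and A: "0 \<le> A" "A < B" and t: "0 \<le> t" and j: "j \<le> m"
  shows "norm (partial_fourier B \<xi> ((partial_deriv last_index ^^ j) f) t)
    \<le> (2 * B) ^ N * Cj_norm (cube A \<inter> {x. 0 \<le> x $ last_index}) (m + 2 * N) f *
       (\<Prod>i\<in>UNIV - {last_index}. 1 / max 1 ((\<xi> i)\<^sup>2))"
proof -
  let ?D = "cube A \<inter> {x :: 'n space. 0 \<le> x $ last_index}" and ?I = "UNIV - {last_index :: 'n}"
  \<comment> \<open>so that the factors produced by \<open>\<partial>\<^sup>\<alpha>\<close> have modulus \<open>max 1 \<xi>\<^sub>i\<^sup>2\<close>\<close>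
  define \<alpha> where "\<alpha> i = (if i = last_index then j else if \<bar>\<xi> i\<bar> > 1 then 2 else 0)" for i
  have "closed {x :: 'n space. 0 \<le> x $ last_index}" by (intro closed_Collect_le continuous_intros)
  then have D: "compact ?D" by (intro compact_Int_closed compact_cube)
  have s: "smooth f" using f by (rule test_functions_on_smooth)
  have "mi_order \<alpha> = j + (\<Sum>i\<in>?I. \<alpha> i)"
    unfolding mi_order_def by (subst sum.remove[of _ last_index]) (auto simp: \<alpha>_def)
  also have "(\<Sum>i\<in>?I. \<alpha> i) \<le> (\<Sum>i\<in>?I. 2)" by (intro sum_mono) (auto simp: \<alpha>_def)
  finally have \<alpha>: "mi_order \<alpha> \<le> m + 2 * N" using j by (simp add: N_def)
  have tf: "multi_deriv \<alpha> f \<in> test_functions_on (cube A)"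
    by (intro test_functions_on_multi_deriv f compact_imp_closed compact_cube)
  have 1: "norm (partial_fourier B \<xi> (multi_deriv \<alpha> f) t) \<le> (2 * B) ^ N * Cj_norm ?D (m + 2 * N) f"
    unfolding N_def
  proof (rule partial_fourier_bound)
    fix y :: "'n space" assume y: "y $ last_index = t"
    show "norm (multi_deriv \<alpha> f y) \<le> Cj_norm ?D (m + 2 * card ?I) f"
    proof (cases "y \<in> cube A")
      case True
      then show ?thesis using Cj_norm_upper[OF D s \<alpha>] y t by (simp add: N_def)
    next
      case False
      then show ?thesis using test_functions_on_zero[OF tf] Cj_norm_bounds(2)[OF D s] by simp
    qed
  qed (use A s in \<open>auto intro: smooth_continuous smooth_multi_deriv\<close>)
  have "norm ((- \<i> * \<xi> i) ^ \<alpha> i) = max 1 ((\<xi> i)\<^sup>2)" if "i \<in> ?I" for i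
  proof -
    have "\<xi> i * \<xi> i > 1 \<longleftrightarrow> \<bar>\<xi> i\<bar> > 1"
      using abs_square_le_1[of "\<xi> i"] by (auto simp: power2_eq_square not_le[symmetric])
    then show ?thesis using that
      by (auto simp: \<alpha>_def norm_mult norm_power power2_eq_square max_def)
  qed
  then have "norm (\<Prod>i\<in>?I. (- \<i> * \<xi> i) ^ \<alpha> i) = (\<Prod>i\<in>?I. max 1 ((\<xi> i)\<^sup>2))"
    unfolding prod_norm[symmetric] by (intro prod.cong) auto
  with 1 have 2: "(\<Prod>i\<in>?I. max 1 ((\<xi> i)\<^sup>2)) * norm (partial_fourier B \<xi> ((partial_deriv last_index ^^ j) f) t)
     \<le> (2 * B) ^ N * Cj_norm ?D (m + 2 * N) f"
    unfolding partial_fourier_multi_deriv[OF f A] norm_mult by (simp add: \<alpha>_def)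
  have 3: "0 < (\<Prod>i\<in>?I. max 1 ((\<xi> i)\<^sup>2))" by (intro prod_pos) auto
  have "norm (partial_fourier B \<xi> ((partial_deriv last_index ^^ j) f) t) \<le> (2 * B) ^ N * Cj_norm ?D (m + 2 * N) f / (\<Prod>i\<in>?I. max 1 ((\<xi> i)\<^sup>2))"
    using 2 3 by (simp add: field_simps)
  then show ?thesis by (simp add: prod_dividef)
qed

text \<open>The functional \<open>f \<mapsto> \<Sum>\<^sub>k w\<^sub>k v\<^sub>k(0)\<close>, where \<open>v\<^sub>k\<close> solves the ordinary differential equation with symbol
  \<open>P \<xi>\<^sub>k\<close> and right-hand side the partial Fourier transform of \<open>f\<close> at \<open>\<xi>\<^sub>k\<close>, and \<open>w\<^sub>k\<close> are the coefficients of
  the product of Fejer kernels.\<close>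

definition approx_solution :: "real \<Rightarrow> nat \<Rightarrow> (('n::{finite,linorder} \<Rightarrow> real) \<Rightarrow> complex poly) \<Rightarrow> ('n space \<Rightarrow> complex) \<Rightarrow> complex" where
  "approx_solution B M P f = (\<Sum>k\<in>freq_index M. of_real ((1 / (2 * B * M)) ^ card (UNIV - {last_index :: 'n})) *
     ode_inverse B (P (freq B k)) (partial_fourier B (freq B k) f))"

lemma approx_solution_lin:
  assumes "0 \<le> B" "continuous_on UNIV f" "continuous_on UNIV g"
  shows "approx_solution B M P (\<lambda>x. a * f x + b * g x) = a * approx_solution B M P f + b * approx_solution B M P g"
proof -
  have "partial_fourier B \<xi> (\<lambda>x. a * f x + b * g x) = (\<lambda>t. a * partial_fourier B \<xi> f t + b * partial_fourier B \<xi> g t)" for \<xi>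
    using partial_fourier_lin[OF assms(2,3)] by blast
  then show ?thesis unfolding approx_solution_def
    by (simp add: ode_inverse_lin partial_fourier_continuous assms sum_distrib_left algebra_simps flip: sum.distrib)
qed

lemma distribution_approx_solution:
  fixes P :: "('n::{finite,linorder} \<Rightarrow> real) \<Rightarrow> complex poly"
  assumes B: "0 \<le> B"
  shows "distribution (approx_solution B M P)"
  unfolding distribution_def
proof (intro allI impI conjI ballI)
  fix K :: "'n space set" assume K: "compact K"
  show "approx_solution B M P (\<lambda>x. a * f x + b * g x) = a * approx_solution B M P f + b * approx_solution B M P g"
    if "f \<in> test_functions_on K" "g \<in> test_functions_on K" for f g a b
    using that by (intro approx_solution_lin B smooth_continuous test_functions_on_smooth)
  obtain C where C: "\<And>p g X. continuous_on {0..B} g \<Longrightarrow> (\<forall>t\<in>{0..B}. norm (g t) \<le> X) \<Longrightarrow> norm (ode_inverse B p g) \<le> C p * X"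
    using ode_inverse_bounded[OF B] by metis
  let ?N = "card (UNIV - {last_index :: 'n})"
  let ?c = "\<Sum>k\<in>freq_index M. norm (complex_of_real ((1 / (2 * B * M)) ^ ?N)) * (C (P (freq B k)) * (2 * B) ^ ?N)"
  have "norm (approx_solution B M P f) \<le> ?c * Cj_norm K 0 f" if f: "f \<in> test_functions_on K" for f
  proof -
    have s: "smooth f" using f by (rule test_functions_on_smooth)
    have sup: "norm (f x) \<le> Cj_norm K 0 f" for x
      using Cj_norm_upper[OF K s, of "\<lambda>_. 0" 0 x] test_functions_on_zero[OF f, of x] Cj_norm_bounds(2)[OF K s, of 0]
      by (cases "x \<in> K") (auto simp: mi_order_def)
    have "norm (ode_inverse B (P \<xi>) (partial_fourier B \<xi> f)) \<le> C (P \<xi>) * ((2 * B) ^ ?N * Cj_norm K 0 f)" for \<xi>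
      by (intro C ballI partial_fourier_continuous partial_fourier_bound smooth_continuous s sup B)
    then show ?thesis unfolding approx_solution_def sum_distrib_right
      by (intro sum_norm_le) (simp only: norm_mult mult.assoc mult_left_mono norm_ge_zero)
  qed
  then show "\<exists>C j. \<forall>f\<in>test_functions_on K. norm (approx_solution B M P f) \<le> C * Cj_norm K j f" by blast
qed

text \<open>The decay of the transform absorbs the sum over frequencies, so that the bound is uniform in \<open>M\<close>. This
  is what permits a number of frequencies that is not moderate.\<close>

lemma approx_solution_bound:
  fixes f :: "('n::{finite,linorder}) space \<Rightarrow> complex"
  defines "N \<equiv> card (UNIV - {last_index :: 'n})"
  assumes f: "f \<in> test_functions_on (cube A)" and A: "0 \<le> A" "A + 1 \<le> B" and M: "0 < M" and \<gamma>: "0 \<le> \<gamma>"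
    and r: "\<And>k z. k \<in> freq_index M \<Longrightarrow> poly (P (freq B k)) z = 0 \<Longrightarrow> - \<gamma> \<le> Im z"
    and m: "\<And>k. k \<in> freq_index M \<Longrightarrow> degree (P (freq B k)) \<le> m"
    and \<beta>: "0 < \<beta>" "\<And>k. k \<in> freq_index M \<Longrightarrow> \<beta> \<le> norm (coeff (P (freq B k)) d)"
  shows "norm (approx_solution B M P f) \<le> (6 * (1 + (B / pi)\<^sup>2)) ^ N *
     ((2 * (A + 1) * exp (\<gamma> * (A + 1)) + 1) ^ m / \<beta>) * Cj_norm (cube A \<inter> {x. 0 \<le> x $ last_index}) (m + 2 * N) f"
proof -
  let ?X = "Cj_norm (cube A \<inter> {x. 0 \<le> x $ last_index}) (m + 2 * N) f" and ?I = "UNIV - {last_index :: 'n}"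
  let ?C = "(2 * (A + 1) * exp (\<gamma> * (A + 1)) + 1) ^ m / \<beta>"
  let ?q = "\<lambda>k. \<Prod>i\<in>?I. 1 / max 1 ((freq B k i)\<^sup>2)"
  have B: "0 < B" using A by simp
  have "closed {x :: 'n space. 0 \<le> x $ last_index}" by (intro closed_Collect_le continuous_intros)
  then have X0: "0 \<le> ?X"
    by (intro Cj_norm_bounds(2) compact_Int_closed compact_cube test_functions_on_smooth[OF f])
  have C0: "0 \<le> ?C" using A \<beta> by simp
  have each: "norm (ode_inverse B (P (freq B k)) (partial_fourier B (freq B k) f)) \<le> ?C * ((2 * B) ^ N * ?X * ?q k)"
    if k: "k \<in> freq_index M" for k
  proof -
    let ?G = "\<lambda>j. partial_fourier B (freq B k) ((partial_deriv last_index ^^ j) f)"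
    \<comment> \<open>The support condition alone does not exclude \<open>t = A\<close>, hence \<open>A + 1\<close>.\<close>
    have "deriv_chain (A + 1) B ?G" by (rule partial_fourier_chain[OF f]) (use A in auto)
    then have "norm (ode_inverse B (P (freq B k)) (?G 0)) \<le> ?C * ((2 * B) ^ N * ?X * ?q k)"
    proof (rule ode_inverse_bound)
      fix j t assume "j \<le> m" "t \<in> {0..B}"
      then show "norm (?G j t) \<le> (2 * B) ^ N * ?X * ?q k"
        unfolding N_def by (intro partial_fourier_decay[OF f]) (use A in auto)
    qed (use A \<gamma> r[OF k] m[OF k] \<beta> k in auto)
    then show ?thesis by simp
  qed
  have "norm (approx_solution B M P f) \<le> (\<Sum>k\<in>freq_index M. (1 / (2 * B * M)) ^ N * (?C * ((2 * B) ^ N * ?X * ?q k)))"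
    unfolding approx_solution_def N_def[symmetric]
  proof (rule sum_norm_le)
    fix k :: "'n \<Rightarrow> nat \<times> nat" assume "k \<in> freq_index M"
    from each[OF this] show "norm (complex_of_real ((1 / (2 * B * M)) ^ N) * ode_inverse B (P (freq B k)) (partial_fourier B (freq B k) f))
       \<le> (1 / (2 * B * M)) ^ N * (?C * ((2 * B) ^ N * ?X * ?q k))"
      unfolding norm_mult norm_of_real using B by (intro mult_mono) auto
  qed
  also have "\<dots> = ?C * ?X * (1 / M) ^ N * (\<Sum>k\<in>freq_index M. ?q k)"
  proof -
    have *: "x * (c * (y * w * q)) = c * w * z * q" if "x * y = z" for x y z c w q :: real
      unfolding that[symmetric] by (simp only: mult_ac)
    have "(1 / (2 * B * M)) ^ N * (2 * B) ^ N = (1 / real M) ^ N"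
      unfolding power_mult_distrib[symmetric] using B by simp
    from *[OF this] show ?thesis by (simp only: sum_distrib_left)
  qed
  also have "\<dots> \<le> ?C * ?X * (1 / M) ^ N * (real M * 6 * (1 + (B / pi)\<^sup>2)) ^ N"
  proof -
    have "0 \<le> ?C * ?X * (1 / M) ^ N" by (intro mult_nonneg_nonneg C0 X0) simp
    from mult_left_mono[OF sum_freq_decay[OF B, of M, where 'n='n] this] show ?thesis
      unfolding N_def .
  qed
  also have "\<dots> = ?C * ?X * (6 * (1 + (B / pi)\<^sup>2)) ^ N"
  proof -
    have "(1 / M) ^ N * (real M * 6 * (1 + (B / pi)\<^sup>2)) ^ N = (6 * (1 + (B / pi)\<^sup>2)) ^ N"
      unfolding power_mult_distrib[symmetric] using M by simp
    then show ?thesis by (simp only: mult.assoc)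
  qed
  finally show ?thesis by (simp only: mult_ac)
qed

text \<open>The polynomial \<open>P(\<xi>', \<cdot>)\<close> in the last variable.\<close>

definition slice_poly :: "nat \<Rightarrow> (('n::{finite,linorder} \<Rightarrow> nat) \<Rightarrow> complex) \<Rightarrow> ('n \<Rightarrow> real) \<Rightarrow> complex poly" where
  "slice_poly m a \<xi> = (\<Sum>\<alpha>\<in>mi_upto m. monom (a \<alpha> * (\<Prod>i\<in>UNIV - {last_index}. of_real (\<xi> i) ^ \<alpha> i)) (\<alpha> last_index))"

lemma poly_slice_poly:
  "poly (slice_poly m a \<xi>) z = poly_value m a (\<chi> i. if i = last_index then z else of_real (\<xi> i))"
proof -
  have "(\<Prod>i\<in>UNIV. (if i = last_index then z else complex_of_real (\<xi> i)) ^ \<alpha> i)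
     = z ^ \<alpha> last_index * (\<Prod>i\<in>UNIV - {last_index}. of_real (\<xi> i) ^ \<alpha> i)" for \<alpha> :: "'a \<Rightarrow> nat"
    by (subst prod.remove[of _ last_index]) auto
  then show ?thesis
    by (simp add: slice_poly_def poly_value_def poly_sum poly_monom mult_ac)
qed

lemma mi_le_order: "\<alpha> i \<le> mi_order \<alpha>"
  unfolding mi_order_def by (rule member_le_sum) auto

lemma degree_slice_poly: "degree (slice_poly m a \<xi>) \<le> m"
  unfolding slice_poly_def
proof (rule degree_sum_le[OF finite_mi_upto])
  fix \<alpha> :: "'a \<Rightarrow> nat" assume "\<alpha> \<in> mi_upto m"
  then show "degree (monom (a \<alpha> * (\<Prod>i\<in>UNIV - {last_index}. of_real (\<xi> i) ^ \<alpha> i)) (\<alpha> last_index)) \<le> m"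
    using mi_le_order[of \<alpha> last_index] by (intro order_trans[OF degree_monom_le]) (simp add: mi_upto_def)
qed

lemma symbol_op_slice_poly:
  "symbol_op (slice_poly m a \<xi>) G t =
     (\<Sum>\<alpha>\<in>mi_upto m. a \<alpha> * (\<Prod>i\<in>UNIV - {last_index}. of_real (\<xi> i) ^ \<alpha> i) * \<i> ^ \<alpha> last_index * G (\<alpha> last_index) t)"
proof -
  let ?c = "\<lambda>\<alpha>. a \<alpha> * (\<Prod>i\<in>UNIV - {last_index}. of_real (\<xi> i) ^ \<alpha> i)"
  have "symbol_op (slice_poly m a \<xi>) G t = (\<Sum>j\<le>m. \<Sum>\<alpha>\<in>mi_upto m. if \<alpha> last_index = j then ?c \<alpha> * \<i> ^ j * G j t else 0)"
    unfolding symbol_op_upto[OF degree_slice_poly] unfolding slice_poly_def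
    by (auto simp: coeff_sum sum_distrib_right intro!: sum.cong)
  also have "\<dots> = (\<Sum>\<alpha>\<in>mi_upto m. \<Sum>j\<le>m. if \<alpha> last_index = j then ?c \<alpha> * \<i> ^ j * G j t else 0)"
    by (rule sum.swap)
  also have "\<dots> = (\<Sum>\<alpha>\<in>mi_upto m. ?c \<alpha> * \<i> ^ \<alpha> last_index * G (\<alpha> last_index) t)"
    using le_trans[OF mi_le_order] by (intro sum.cong refl) (auto simp: mi_upto_def)
  finally show ?thesis .
qed

text \<open>The transposed operator \<open>\<^sup>tP(D)\<close> for complex coefficients, acting on functions.\<close>

definition transpose_fun :: "nat \<Rightarrow> (('n::{finite,linorder} \<Rightarrow> nat) \<Rightarrow> complex) \<Rightarrow> ('n space \<Rightarrow> complex) \<Rightarrow> 'n space \<Rightarrow> complex" where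
  "transpose_fun m a f x = (\<Sum>\<alpha>\<in>mi_upto m. ((-1) ^ mi_order \<alpha> * a \<alpha>) * ((- \<i>) ^ mi_order \<alpha> * multi_deriv \<alpha> f x))"

lemma partial_fourier_sum:
  assumes "finite S" "\<And>k. k \<in> S \<Longrightarrow> continuous_on UNIV (F k)"
  shows "partial_fourier B \<xi> (\<lambda>x. \<Sum>k\<in>S. c k * F k x) t = (\<Sum>k\<in>S. c k * partial_fourier B \<xi> (F k) t)"
  using assms
proof (induction S)
  case empty
  show ?case by (simp add: partial_fourier_def)
next
  case (insert k S)
  have "partial_fourier B \<xi> (\<lambda>x. c k * F k x + 1 * (\<Sum>k\<in>S. c k * F k x)) t
     = c k * partial_fourier B \<xi> (F k) t + 1 * partial_fourier B \<xi> (\<lambda>x. \<Sum>k\<in>S. c k * F k x) t"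
    by (rule partial_fourier_lin) (use insert.prems in \<open>auto intro!: continuous_intros\<close>)
  with insert show ?case by simp
qed

text \<open>For each \<open>\<alpha>\<close> the signs combine to \<open>\<i>\<^sup>|\<^sup>\<alpha>\<^sup>|\<close>. Integration by parts contributes \<open>-\<i> \<xi>\<^sub>i\<close> for each
  derivative in an integrated coordinate, and a factor \<open>\<i>\<close> is left for each derivative in \<open>t\<close>.\<close>

lemma partial_fourier_transpose:
  fixes f :: "('n::{finite,linorder}) space \<Rightarrow> complex"
  assumes f: "f \<in> test_functions_on (cube A)" and A: "0 \<le> A" "A < B"
  shows "partial_fourier B \<xi> (transpose_fun m a f) t =
     symbol_op (slice_poly m a \<xi>) (\<lambda>j. partial_fourier B \<xi> ((partial_deriv last_index ^^ j) f)) t"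
proof -
  let ?I = "UNIV - {last_index :: 'n}"
  have s: "smooth f" using f by (rule test_functions_on_smooth)
  have "partial_fourier B \<xi> (transpose_fun m a f) t
     = (\<Sum>\<alpha>\<in>mi_upto m. ((-1) ^ mi_order \<alpha> * a \<alpha> * (- \<i>) ^ mi_order \<alpha>) * partial_fourier B \<xi> (multi_deriv \<alpha> f) t)"
    unfolding transpose_fun_def[abs_def] mult.assoc[symmetric]
    by (rule partial_fourier_sum) (auto intro: finite_mi_upto smooth_continuous smooth_multi_deriv s)
  also have "\<dots> = (\<Sum>\<alpha>\<in>mi_upto m. a \<alpha> * (\<Prod>i\<in>?I. of_real (\<xi> i) ^ \<alpha> i) * \<i> ^ \<alpha> last_index *
      partial_fourier B \<xi> ((partial_deriv last_index ^^ \<alpha> last_index) f) t)"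
  proof (rule sum.cong[OF refl])
    fix \<alpha> :: "'n \<Rightarrow> nat"
    have rearrange: "x * c * y * (q * w) = c * r * u * w" if "x * y = u * v" "v * q = r" for x y u v q r c w :: complex
    proof -
      have "x * c * y * (q * w) = c * (x * y) * q * w" by (simp only: mult_ac)
      also have "\<dots> = c * (v * q) * u * w" unfolding that(1) by (simp only: mult_ac)
      finally show ?thesis unfolding that(2) .
    qed
    have e: "mi_order \<alpha> = \<alpha> last_index + (\<Sum>i\<in>?I. \<alpha> i)"
      unfolding mi_order_def by (subst sum.remove[of _ last_index]) auto
    have "(-1) ^ mi_order \<alpha> * (- \<i>) ^ mi_order \<alpha> = \<i> ^ mi_order \<alpha>"
      unfolding power_mult_distrib[symmetric] by simp
    also have "\<dots> = \<i> ^ \<alpha> last_index * (\<Prod>i\<in>?I. \<i> ^ \<alpha> i)"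
      unfolding e power_add power_sum ..
    finally have "(-1) ^ mi_order \<alpha> * (- \<i>) ^ mi_order \<alpha> = \<i> ^ \<alpha> last_index * (\<Prod>i\<in>?I. \<i> ^ \<alpha> i)" .
    moreover have "(\<Prod>i\<in>?I. \<i> ^ \<alpha> i) * (\<Prod>i\<in>?I. (- \<i> * \<xi> i) ^ \<alpha> i) = (\<Prod>i\<in>?I. of_real (\<xi> i) ^ \<alpha> i)"
      unfolding prod.distrib[symmetric] power_mult_distrib[symmetric] by simp
    ultimately show "((-1) ^ mi_order \<alpha> * a \<alpha> * (- \<i>) ^ mi_order \<alpha>) * partial_fourier B \<xi> (multi_deriv \<alpha> f) t
      = a \<alpha> * (\<Prod>i\<in>?I. of_real (\<xi> i) ^ \<alpha> i) * \<i> ^ \<alpha> last_index *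
        partial_fourier B \<xi> ((partial_deriv last_index ^^ \<alpha> last_index) f) t"
      unfolding partial_fourier_multi_deriv[OF f A] by (rule rearrange)
  qed
  finally show ?thesis unfolding symbol_op_slice_poly .
qed

text \<open>Applied to \<open>\<^sup>tP(D) f\<close>, each ordinary differential equation is solved exactly, so that only the error
  of Fourier inversion remains.\<close>

lemma approx_solution_transpose:
  fixes f :: "('n::{finite,linorder}) space \<Rightarrow> complex"
  defines "N \<equiv> card (UNIV - {last_index :: 'n})"
  assumes f: "f \<in> test_functions_on (cube A)" and A: "0 \<le> A" "A + 1 \<le> B" and M: "0 < M"
    and nz: "\<And>k. k \<in> freq_index M \<Longrightarrow> slice_poly m a (freq B k) \<noteq> 0"
    and \<Lambda>: "\<And>i x. norm (partial_deriv i f x) \<le> \<Lambda>"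
  shows "norm (approx_solution B M (slice_poly m a) (transpose_fun m a f) - f 0) \<le> N * (B / sqrt M * \<Lambda>)"
proof -
  have B: "0 < B" "A < B" using A by auto
  have "ode_inverse B (slice_poly m a (freq B k)) (partial_fourier B (freq B k) (transpose_fun m a f)) = partial_fourier B (freq B k) f 0"
    if k: "k \<in> freq_index M" for k
  proof -
    let ?G = "\<lambda>j. partial_fourier B (freq B k) ((partial_deriv last_index ^^ j) f)"
    have "deriv_chain (A + 1) B ?G" by (rule partial_fourier_chain[OF f]) (use A in auto)
    from ode_inverse_symbol_op[OF this _ _ nz[OF k]] show ?thesis
      using A unfolding partial_fourier_transpose[OF f A(1) B(2), abs_def] by simp
  qed
  then have "approx_solution B M (slice_poly m a) (transpose_fun m a f)
     = (\<Sum>k\<in>freq_index M. of_real ((1 / (2 * B * M)) ^ N) * partial_fourier B (freq B k) f 0)"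
    unfolding approx_solution_def N_def by (intro sum.cong) auto
  then show ?thesis
    using fourier_fejer_approx[OF test_functions_on_smooth[OF f] B(1) M \<Lambda>] by (simp only: N_def)
qed

section \<open>Cutoff functions and compactly supported representatives\<close>

text \<open>The functions \<open>p(1/x) e\<^sup>-\<^sup>1\<^sup>/\<^sup>x\<close>, extended by \<open>0\<close>: a class closed under differentiation that contains
  the standard flat function.\<close>

definition flat_exp :: "real poly \<Rightarrow> real \<Rightarrow> real" where
  "flat_exp p x = (if 0 < x then poly p (1 / x) * exp (- (1 / x)) else 0)"

lemma poly_exp_tendsto_0: "((\<lambda>y. poly p y * exp (- y)) \<longlongrightarrow> (0::real)) at_top"
proof -
  have "((\<lambda>y. \<Sum>i\<le>degree p. coeff p i * (y ^ i / exp y)) \<longlongrightarrow> (\<Sum>i\<le>degree p. coeff p i * 0)) at_top"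
    by (intro tendsto_sum tendsto_mult tendsto_const tendsto_power_div_exp_0)
  moreover have "(\<Sum>i\<le>degree p. coeff p i * (y ^ i / exp y)) = poly p y * exp (- y)" for y
    by (simp add: poly_altdef sum_distrib_right exp_minus divide_inverse mult.assoc)
  ultimately show ?thesis by simp
qed

lemma flat_exp_tendsto_0: "(flat_exp p \<longlongrightarrow> 0) (at 0)"
proof -
  have "((\<lambda>x. poly p (1 / x) * exp (- (1 / x))) \<longlongrightarrow> 0) (at_right (0::real))"
    using filterlim_compose[OF poly_exp_tendsto_0[of p] filterlim_inverse_at_top_right] by (simp add: inverse_eq_divide)
  then have "(flat_exp p \<longlongrightarrow> 0) (at_right 0)"
    by (rule Lim_transform_eventually) (auto simp: flat_exp_def eventually_at_filter)
  moreover have "(flat_exp p \<longlongrightarrow> 0) (at_left 0)"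
    by (rule Lim_transform_eventually[OF tendsto_const]) (auto simp: flat_exp_def eventually_at_filter)
  ultimately show ?thesis by (simp add: filterlim_split_at)
qed

lemma flat_exp_deriv:
  "(flat_exp p has_real_derivative flat_exp ([:0, 0, 1:] * (p - pderiv p)) x) (at x)"
proof -
  consider "x > 0" | "x < 0" | "x = 0" by linarith
  then show ?thesis
  proof cases
    case 1
    have "((\<lambda>x. poly p (1 / x) * exp (- (1 / x))) has_real_derivative flat_exp ([:0, 0, 1:] * (p - pderiv p)) x) (at x)"
      using 1 by (auto intro!: derivative_eq_intros DERIV_chain2[OF poly_DERIV] simp: flat_exp_def field_simps power2_eq_square)
    then show ?thesis
      by (rule has_field_derivative_transform_within_open[of _ _ _ "{0<..}"]) (use 1 in \<open>auto simp: flat_exp_def\<close>)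
  next
    case 2
    have "((\<lambda>x. 0) has_real_derivative flat_exp ([:0, 0, 1:] * (p - pderiv p)) x) (at x)"
      using 2 by (simp add: flat_exp_def)
    then show ?thesis
      by (rule has_field_derivative_transform_within_open[of _ _ _ "{..<0}"]) (use 2 in \<open>auto simp: flat_exp_def\<close>)
  next
    case 3
    have "((\<lambda>h. flat_exp p h / h) \<longlongrightarrow> 0) (at 0)"
      by (rule Lim_transform_eventually[OF flat_exp_tendsto_0[of "pCons 0 p"]])
         (auto simp: flat_exp_def eventually_at_filter)
    then show ?thesis using 3 by (simp add: DERIV_def) (simp add: flat_exp_def)
  qed
qed

lemma flat_exp_nonneg: "0 \<le> flat_exp 1 x"
  by (simp add: flat_exp_def)

lemma flat_exp_ge: "1 \<le> x \<Longrightarrow> exp (-1) \<le> flat_exp 1 x"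
  by (simp add: flat_exp_def)

text \<open>A class closed under partial derivatives; membership therefore implies smoothness.\<close>

inductive_set flat_functions :: "(('n::finite) space \<Rightarrow> real) set" where
  const: "(\<lambda>x. c) \<in> flat_functions"
| coord: "(\<lambda>x. x $ i) \<in> flat_functions"
| add: "f \<in> flat_functions \<Longrightarrow> g \<in> flat_functions \<Longrightarrow> (\<lambda>x. f x + g x) \<in> flat_functions"
| mult: "f \<in> flat_functions \<Longrightarrow> g \<in> flat_functions \<Longrightarrow> (\<lambda>x. f x * g x) \<in> flat_functions"
| flat: "f \<in> flat_functions \<Longrightarrow> (\<lambda>x. flat_exp p (f x)) \<in> flat_functions"

lemma flat_functions_sum: "finite S \<Longrightarrow> (\<And>i. i \<in> S \<Longrightarrow> f i \<in> flat_functions) \<Longrightarrow> (\<lambda>x. \<Sum>i\<in>S. f i x) \<in> flat_functions"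
  by (induction S rule: finite_induct) (auto intro: flat_functions.intros)

lemma flat_functions_deriv:
  "f \<in> flat_functions \<Longrightarrow> \<exists>f'. (\<forall>i. f' i \<in> flat_functions) \<and> (\<forall>x. (f has_derivative (\<lambda>h. \<Sum>i\<in>UNIV. f' i x * h $ i)) (at x))"
proof (induction rule: flat_functions.induct)
  case (const c)
  then show ?case by (intro exI[of _ "\<lambda>i x. 0"]) (auto intro: flat_functions.const)
next
  case (coord i)
  have "(\<Sum>j\<in>UNIV. (if j = i then 1 else 0) * h $ j) = h $ i" for h :: "'a space"
    by (simp add: if_distrib[of "\<lambda>c. c * _"] cong: if_cong)
  then show ?case
    by (intro exI[of _ "\<lambda>j x. if j = i then 1 else 0"])
       (auto intro!: flat_functions.const bounded_linear_imp_has_derivative bounded_linear_vec_nth)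
next
  case (add f g)
  then obtain f' g' where "\<forall>i. f' i \<in> flat_functions" "\<And>x. (f has_derivative (\<lambda>h. \<Sum>i\<in>UNIV. f' i x * h $ i)) (at x)"
    "\<forall>i. g' i \<in> flat_functions" "\<And>x. (g has_derivative (\<lambda>h. \<Sum>i\<in>UNIV. g' i x * h $ i)) (at x)" by blast
  then show ?case
    by (intro exI[of _ "\<lambda>i x. f' i x + g' i x"])
       (auto intro!: flat_functions.add derivative_eq_intros simp: distrib_right sum.distrib)
next
  case (mult f g)
  then obtain f' g' where *: "\<forall>i. f' i \<in> flat_functions" "\<And>x. (f has_derivative (\<lambda>h. \<Sum>i\<in>UNIV. f' i x * h $ i)) (at x)"
    "\<forall>i. g' i \<in> flat_functions" "\<And>x. (g has_derivative (\<lambda>h. \<Sum>i\<in>UNIV. g' i x * h $ i)) (at x)" by blast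
  show ?case
  proof (intro exI[of _ "\<lambda>i x. f x * g' i x + f' i x * g x"] conjI allI)
    fix x
    show "((\<lambda>x. f x * g x) has_derivative (\<lambda>h. \<Sum>i\<in>UNIV. (f x * g' i x + f' i x * g x) * h $ i)) (at x)"
      by (rule has_derivative_eq_rhs[OF has_derivative_mult[OF *(2,4)]])
         (auto simp: fun_eq_iff sum_distrib_left sum_distrib_right sum.distrib[symmetric] algebra_simps intro!: sum.cong)
  qed (use * mult.hyps in \<open>auto intro!: flat_functions.add flat_functions.mult\<close>)
next
  case (flat f p)
  then obtain f' where *: "\<forall>i. f' i \<in> flat_functions" "\<And>x. (f has_derivative (\<lambda>h. \<Sum>i\<in>UNIV. f' i x * h $ i)) (at x)" by blast
  let ?q = "[:0, 0, 1:] * (p - pderiv p)"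
  show ?case
  proof (intro exI[of _ "\<lambda>i x. flat_exp ?q (f x) * f' i x"] conjI allI)
    fix x
    have d: "(flat_exp p has_derivative (*) (flat_exp ?q (f x))) (at (f x))"
      using flat_exp_deriv by (simp add: has_field_derivative_def)
    show "((\<lambda>x. flat_exp p (f x)) has_derivative (\<lambda>h. \<Sum>i\<in>UNIV. flat_exp ?q (f x) * f' i x * h $ i)) (at x)"
      by (rule has_derivative_eq_rhs[OF has_derivative_compose[OF *(2) d]])
         (simp add: fun_eq_iff sum_distrib_left mult.assoc)
  qed (use * flat.hyps in \<open>auto intro!: flat_functions.mult flat_functions.flat\<close>)
qed

lemma smooth_flat_functions:
  fixes f :: "('n::finite) space \<Rightarrow> real"
  assumes "f \<in> flat_functions" shows "smooth (\<lambda>x. complex_of_real (f x))"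
proof -
  have "Ck k (\<lambda>x. complex_of_real (f x))" if "f \<in> flat_functions" for k and f :: "'n space \<Rightarrow> real"
    using that
  proof (induction k arbitrary: f)
    case 0
    obtain f' where "\<And>x. (f has_derivative (\<lambda>h. \<Sum>i\<in>UNIV. f' i x * h $ i)) (at x)"
      using flat_functions_deriv[OF 0] by blast
    then have "continuous_on UNIV f"
      by (meson continuous_at_imp_continuous_on has_derivative_continuous)
    then show ?case by (auto intro!: continuous_intros)
  next
    case (Suc k)
    obtain f' where f': "\<And>i. f' i \<in> flat_functions" "\<And>x. (f has_derivative (\<lambda>h. \<Sum>i\<in>UNIV. f' i x * h $ i)) (at x)"
      using flat_functions_deriv[OF Suc.prems] by blast
    have d: "((\<lambda>x. complex_of_real (f x)) has_derivative (\<lambda>h. of_real (\<Sum>i\<in>UNIV. f' i x * h $ i))) (at x)" for x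
      using f'(2) by (intro has_derivative_of_real)
    have "partial_deriv i (\<lambda>x. complex_of_real (f x)) x = of_real (f' i x)" for i x
    proof -
      have "(\<Sum>j\<in>UNIV. f' j x * axis i (1::real) $ j) = f' i x"
        by (simp add: axis_def if_distrib[of "(*) _"] cong: if_cong)
      then show ?thesis
        unfolding partial_deriv_def using frechet_derivative_at[OF d[of x]] by metis
    qed
    then have "partial_deriv i (\<lambda>x. complex_of_real (f x)) = (\<lambda>x. of_real (f' i x))" for i by blast
    then show ?case using d Suc.IH[OF f'(1)] by (auto simp: differentiable_def)
  qed
  then show ?thesis using assms by (simp add: smooth_def)
qed

text \<open>With the flat function \<open>h\<close> and \<open>s(x) = \<Sum>h(x\<^sub>i\<^sup>2 - A\<^sup>2)\<close>, the function \<open>h(h(1) - s(x))\<close> is the constant \<open>h(h(1))\<close> where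
  \<open>s = 0\<close>, and it vanishes where \<open>s \<ge> h(1)\<close>. No integration is needed to produce the plateau.\<close>

lemma cutoff_exists:
  assumes A: "0 \<le> A"
  shows "\<exists>\<theta> :: ('n::finite) space \<Rightarrow> complex. smooth \<theta> \<and> (\<forall>x\<in>cube A. \<theta> x = 1) \<and> (\<forall>x. x \<notin> cube (A + 1) \<longrightarrow> \<theta> x = 0)"
proof -
  define s where "s x = (\<Sum>i\<in>UNIV. flat_exp 1 (x $ i * x $ i + (- A * A)))" for x :: "'n space"
  define e where "e = exp (-1 :: real)"
  define \<theta> where "\<theta> x = flat_exp 1 (e + (-1) * s x) * (1 / flat_exp 1 e)" for x
  have e: "0 < e" by (simp add: e_def)
  have "s \<in> flat_functions"
    unfolding s_def[abs_def] by (intro flat_functions_sum flat_functions.intros) auto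
  then have "\<theta> \<in> flat_functions"
    unfolding \<theta>_def[abs_def] by (intro flat_functions.intros) auto
  then have "smooth (\<lambda>x. complex_of_real (\<theta> x))" by (rule smooth_flat_functions)
  moreover have "\<theta> x = 1" if "x \<in> cube A" for x
  proof -
    have "x $ i * x $ i \<le> A * A" for i
      using that abs_le_square_iff[of "x $ i" A] A by (simp add: cube_def power2_eq_square)
    then have "s x = 0" unfolding s_def by (intro sum.neutral) (simp add: flat_exp_def not_less)
    then show ?thesis using e by (simp add: \<theta>_def flat_exp_def)
  qed
  moreover have "\<theta> x = 0" if "x \<notin> cube (A + 1)" for x
  proof -
    have "\<exists>i. A + 1 < \<bar>x $ i\<bar>" using that by (simp add: cube_def not_le)
    then obtain i where "A + 1 < \<bar>x $ i\<bar>" ..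
    then have "(A + 1)\<^sup>2 \<le> (x $ i)\<^sup>2" using abs_le_square_iff[of "A + 1" "x $ i"] A by simp
    then have "1 \<le> x $ i * x $ i + (- A * A)" using A by (simp add: power2_eq_square algebra_simps)
    then have "e \<le> flat_exp 1 (x $ i * x $ i + (- A * A))" unfolding e_def by (rule flat_exp_ge)
    also have "\<dots> \<le> s x" unfolding s_def
      by (rule member_le_sum[of i UNIV "\<lambda>i. flat_exp 1 (x $ i * x $ i + (- A * A))"]) (auto intro: flat_exp_nonneg)
    finally show ?thesis by (simp add: \<theta>_def flat_exp_def)
  qed
  ultimately show ?thesis by (intro exI[of _ "\<lambda>x. complex_of_real (\<theta> x)"]) auto
qed

lemma Ck_add: "Ck k f \<Longrightarrow> Ck k g \<Longrightarrow> Ck k (\<lambda>x. f x + g x)"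
proof (induction k arbitrary: f g)
  case 0
  then show ?case by (auto intro: continuous_intros)
next
  case (Suc k)
  have "partial_deriv i (\<lambda>x. f x + g x) = (\<lambda>x. partial_deriv i f x + partial_deriv i g x)" for i
    using partial_deriv_lin[of f _ g i 1 1] Suc.prems by auto
  moreover have "(\<lambda>x. f x + g x) differentiable (at x)" for x
    using Suc.prems by (intro differentiable_add) auto
  ultimately show ?case using Suc by simp
qed

lemma partial_deriv_mult:
  assumes "smooth f" "smooth g"
  shows "partial_deriv i (\<lambda>x. f x * g x) = (\<lambda>x. 1 * (partial_deriv i f x * g x) + 1 * (f x * partial_deriv i g x))"
proof
  fix x
  have "((\<lambda>x. f x * g x) has_derivative (\<lambda>h. f x * frechet_derivative g (at x) h + frechet_derivative f (at x) h * g x)) (at x)"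
    using assms[THEN smooth_differentiable, of x, unfolded frechet_derivative_works] by (rule has_derivative_mult)
  from fun_cong[OF frechet_derivative_at[OF this], of "axis i 1"]
  show "partial_deriv i (\<lambda>x. f x * g x) x = 1 * (partial_deriv i f x * g x) + 1 * (f x * partial_deriv i g x)"
    by (simp add: partial_deriv_def add.commute)
qed

lemma smooth_mult:
  assumes "smooth f" "smooth g" shows "smooth (\<lambda>x. f x * g x)"
proof -
  have "Ck k (\<lambda>x. f x * g x)" for k
    using assms
  proof (induction k arbitrary: f g)
    case 0
    have "continuous_on UNIV f" "continuous_on UNIV g" using 0 by (auto intro: smooth_continuous)
    then show ?case by (auto intro!: continuous_intros)
  next
    case (Suc k)
    have "Ck k (\<lambda>x. partial_deriv i f x * g x + f x * partial_deriv i g x)" for i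
      by (intro Ck_add Suc.IH Suc.prems smooth_partial)
    moreover have "(\<lambda>x. f x * g x) differentiable (at x)" for x
      by (intro differentiable_mult smooth_differentiable Suc.prems)
    ultimately show ?case by (simp add: partial_deriv_mult Suc.prems)
  qed
  then show ?thesis by (simp add: smooth_def)
qed

lemma smooth_foldr_partial: "smooth f \<Longrightarrow> smooth (foldr partial_deriv is f)"
  by (induction "is") (auto intro: smooth_partial)

lemma foldr_partial_lin:
  assumes "smooth f" "smooth g"
  shows "foldr partial_deriv is (\<lambda>x. a * f x + b * g x) = (\<lambda>x. a * foldr partial_deriv is f x + b * foldr partial_deriv is g x)"
proof (induction "is")
  case (Cons i "is")
  have "partial_deriv i (\<lambda>x. a * foldr partial_deriv is f x + b * foldr partial_deriv is g x)
     = (\<lambda>x. a * partial_deriv i (foldr partial_deriv is f) x + b * partial_deriv i (foldr partial_deriv is g) x)"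
    by (rule ext, rule partial_deriv_lin)
       (rule smooth_differentiable[OF smooth_foldr_partial[OF assms(1)]] smooth_differentiable[OF smooth_foldr_partial[OF assms(2)]])+
  then show ?case by (simp only: foldr.simps o_apply Cons.IH)
qed simp

lemma multi_deriv_unit: "multi_deriv (\<lambda>j. if j = i then 1 else 0) f = partial_deriv i f"
proof -
  have "foldr (\<lambda>j. partial_deriv j ^^ (if j = i then 1 else 0)) xs f = (if i \<in> set xs then partial_deriv i f else f)"
    if "distinct xs" for xs
    using that by (induction xs) auto
  from this[of "sorted_list_of_set UNIV"] show ?thesis by (simp add: multi_deriv_def)
qed

lemma foldr_partial_eq_multi_deriv:
  fixes f :: "('n::{finite,linorder}) space \<Rightarrow> complex"
  shows "smooth f \<Longrightarrow> foldr partial_deriv is f = multi_deriv (count_list is) f"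
proof (induction "is")
  case Nil
  have "count_list [] = (\<lambda>_ :: 'n. 0)" by auto
  then show ?case by simp
next
  case (Cons i "is")
  have "foldr partial_deriv (i # is) f = multi_deriv (\<lambda>j. if j = i then 1 else 0) (multi_deriv (count_list is) f)"
    using Cons by (simp add: multi_deriv_unit)
  also have "\<dots> = multi_deriv (\<lambda>j. (if j = i then 1 else 0) + count_list is j) f"
    by (rule multi_deriv_multi_deriv[OF Cons.prems])
  also have "(\<lambda>j. (if j = i then 1 else 0) + count_list is j) = count_list (i # is)" by auto
  finally show ?case .
qed

lemma mi_order_count_list: "mi_order (count_list is) = length is"
  unfolding mi_order_def
proof (induction "is")
  case (Cons i "is")
  have "(\<Sum>j\<in>UNIV. count_list (i # is) j) = (\<Sum>j\<in>UNIV. (if j = i then 1 else 0) + count_list is j)"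
    by (rule sum.cong) auto
  then show ?case using Cons by (simp add: sum.distrib)
qed simp

lemma multi_deriv_eq_foldr_partial:
  fixes f :: "('n::{finite,linorder}) space \<Rightarrow> complex"
  assumes "smooth f"
  shows "\<exists>is. length is = mi_order \<alpha> \<and> (\<forall>f :: 'n space \<Rightarrow> complex. smooth f \<longrightarrow> multi_deriv \<alpha> f = foldr partial_deriv is f)"
proof -
  define m where "m = (\<Sum>i\<in>UNIV. replicate_mset (\<alpha> i) i)"
  obtain "is" where "mset is = m" using ex_mset by blast
  have "count_list is j = \<alpha> j" for j
  proof -
    have "count_list is j = count m j" using \<open>mset is = m\<close> by (simp add: count_mset[symmetric])
    also have "\<dots> = \<alpha> j" by (simp add: m_def count_sum)
    finally show ?thesis .
  qed
  then have "count_list is = \<alpha>" by blast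
  then show ?thesis using foldr_partial_eq_multi_deriv mi_order_count_list by metis
qed

text \<open>The Leibniz rule in the form needed for estimates. Induction from the innermost derivative splits
  the product into two products of the same kind with one derivative less.\<close>

lemma foldr_partial_mult_bound:
  fixes \<theta> :: "('n::{finite,linorder}) space \<Rightarrow> complex"
  assumes K: "compact K" and \<theta>: "smooth \<theta>"
  shows "\<exists>C\<ge>0. \<forall>f X. smooth f \<longrightarrow> (\<forall>js. length js \<le> length is \<longrightarrow> (\<forall>x\<in>K. norm (foldr partial_deriv js f x) \<le> X)) \<longrightarrow>
     (\<forall>x\<in>K. norm (foldr partial_deriv is (\<lambda>x. \<theta> x * f x) x) \<le> C * X)"
  using \<theta>
proof (induction "is" arbitrary: \<theta> rule: rev_induct)
  case Nil
  have "norm (\<theta> x * f x) \<le> sup_norm K \<theta> * X" if "x \<in> K" "\<forall>x\<in>K. norm (f x) \<le> X" for f x X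
    unfolding norm_mult using that sup_norm_upper[OF K smooth_continuous[OF Nil] that(1)]
    by (intro mult_mono) (auto intro: order_trans[OF norm_ge_zero])
  then show ?case
    by (intro exI[of _ "sup_norm K \<theta>"] conjI allI impI ballI)
       (simp_all add: sup_norm_nonneg[OF K smooth_continuous[OF Nil]])
next
  case (snoc i "is")
  let ?P = "\<lambda>\<theta> C. \<forall>f X. smooth f \<longrightarrow> (\<forall>js. length js \<le> length is \<longrightarrow> (\<forall>x\<in>K. norm (foldr partial_deriv js f x) \<le> X)) \<longrightarrow>
     (\<forall>x\<in>K. norm (foldr partial_deriv is (\<lambda>x. \<theta> x * f x) x) \<le> C * X)"
  obtain C1 where C1: "C1 \<ge> 0" "?P (partial_deriv i \<theta>) C1"
    using snoc.IH[OF smooth_partial[OF snoc.prems]] by blast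
  obtain C2 where C2: "C2 \<ge> 0" "?P \<theta> C2"
    using snoc.IH[OF snoc.prems] by blast
  show ?case
  proof (intro exI[of _ "C1 + C2"] conjI allI impI ballI)
    fix f X x assume f: "smooth f" and x: "x \<in> K"
      and b: "\<forall>js. length js \<le> length (is @ [i]) \<longrightarrow> (\<forall>x\<in>K. norm (foldr partial_deriv js f x) \<le> X)"
    have b2: "norm (foldr partial_deriv js (partial_deriv i f) x) \<le> X" if "length js \<le> length is" "x \<in> K" for js x
      using b[rule_format, of "js @ [i]" x] that by simp
    have "foldr partial_deriv (is @ [i]) (\<lambda>x. \<theta> x * f x)
       = foldr partial_deriv is (\<lambda>x. 1 * (partial_deriv i \<theta> x * f x) + 1 * (\<theta> x * partial_deriv i f x))"
      by (simp only: foldr_append foldr.simps o_apply id_apply partial_deriv_mult[OF snoc.prems f])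
    also have "\<dots> = (\<lambda>x. 1 * foldr partial_deriv is (\<lambda>x. partial_deriv i \<theta> x * f x) x + 1 * foldr partial_deriv is (\<lambda>x. \<theta> x * partial_deriv i f x) x)"
      by (intro foldr_partial_lin smooth_mult smooth_partial snoc.prems f)
    finally have "norm (foldr partial_deriv (is @ [i]) (\<lambda>x. \<theta> x * f x) x)
      \<le> norm (foldr partial_deriv is (\<lambda>x. partial_deriv i \<theta> x * f x) x) + norm (foldr partial_deriv is (\<lambda>x. \<theta> x * partial_deriv i f x) x)"
      by (simp add: norm_triangle_ineq)
    also have "\<dots> \<le> C1 * X + C2 * X"
    proof (rule add_mono)
      show "norm (foldr partial_deriv is (\<lambda>x. partial_deriv i \<theta> x * f x) x) \<le> C1 * X"
        by (rule C1(2)[rule_format, OF f _ x]) (use b in auto)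
      show "norm (foldr partial_deriv is (\<lambda>x. \<theta> x * partial_deriv i f x) x) \<le> C2 * X"
        by (rule C2(2)[rule_format, OF smooth_partial[OF f] _ x]) (use b2 in auto)
    qed
    finally show "norm (foldr partial_deriv (is @ [i]) (\<lambda>x. \<theta> x * f x) x) \<le> (C1 + C2) * X"
      by (simp add: distrib_right)
  qed (use C1 C2 in auto)
qed

lemma multi_deriv_mult_bound:
  fixes \<theta> :: "('n::{finite,linorder}) space \<Rightarrow> complex"
  assumes K: "compact K" and \<theta>: "smooth \<theta>"
  shows "\<exists>C\<ge>0. \<forall>f. smooth f \<longrightarrow> sup_norm K (multi_deriv \<alpha> (\<lambda>x. \<theta> x * f x)) \<le> C * Cj_norm K (mi_order \<alpha>) f"
proof -
  obtain "is" where ix: "length is = mi_order \<alpha>" "\<And>f :: 'n space \<Rightarrow> complex. smooth f \<Longrightarrow> multi_deriv \<alpha> f = foldr partial_deriv is f"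
    using multi_deriv_eq_foldr_partial[OF \<theta>] by blast
  obtain C where C: "C \<ge> 0" "\<forall>f X. smooth f \<longrightarrow> (\<forall>js. length js \<le> length is \<longrightarrow> (\<forall>x\<in>K. norm (foldr partial_deriv js f x) \<le> X)) \<longrightarrow>
     (\<forall>x\<in>K. norm (foldr partial_deriv is (\<lambda>x. \<theta> x * f x) x) \<le> C * X)"
    using foldr_partial_mult_bound[OF K \<theta>, of "is"] by blast
  have "sup_norm K (multi_deriv \<alpha> (\<lambda>x. \<theta> x * f x)) \<le> C * Cj_norm K (mi_order \<alpha>) f" if f: "smooth f" for f
  proof (rule sup_norm_least)
    show "0 \<le> C * Cj_norm K (mi_order \<alpha>) f" using C(1) Cj_norm_bounds(2)[OF K f] by simp
    fix x assume x: "x \<in> K"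
    show "norm (multi_deriv \<alpha> (\<lambda>x. \<theta> x * f x) x) \<le> C * Cj_norm K (mi_order \<alpha>) f"
      unfolding ix(2)[OF smooth_mult[OF \<theta> f]]
    proof (rule C(2)[rule_format, OF f _ x])
      fix js :: "'n list" and x :: "'n space" assume "length js \<le> length is" "x \<in> K"
      then show "norm (foldr partial_deriv js f x) \<le> Cj_norm K (mi_order \<alpha>) f"
        unfolding foldr_partial_eq_multi_deriv[OF f] by (intro Cj_norm_upper K f) (auto simp: mi_order_count_list ix)
    qed
  qed
  then show ?thesis using C(1) by blast
qed

lemma eps_moderate_sum: "finite S \<Longrightarrow> (\<And>i. i \<in> S \<Longrightarrow> eps_moderate (f i)) \<Longrightarrow> eps_moderate (\<lambda>\<epsilon>. \<Sum>i\<in>S. f i \<epsilon>)"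
  by (induction S rule: finite_induct) (auto intro: eps_moderate_add)

lemma eps_negligible_sum: "finite S \<Longrightarrow> (\<And>i. i \<in> S \<Longrightarrow> eps_negligible (f i)) \<Longrightarrow> eps_negligible (\<lambda>\<epsilon>. \<Sum>i\<in>S. f i \<epsilon>)"
  by (induction S rule: finite_induct) (auto intro: eps_negligible_add)

lemma abs_Cj_norm_le:
  assumes "compact K" "smooth_net r" "\<epsilon> \<in> {0<..1}"
  shows "\<bar>Cj_norm K j (r \<epsilon>)\<bar> \<le> \<bar>\<Sum>\<alpha>\<in>mi_upto j. sup_norm K (multi_deriv \<alpha> (r \<epsilon>))\<bar>"
proof -
  have "smooth (r \<epsilon>)" using assms by (simp add: smooth_net_def)
  from Cj_norm_bounds(2,3)[OF assms(1) this, of j] show ?thesis by linarith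
qed

lemma eps_negligible_Cj_norm:
  assumes "smooth_net r" "gf_negligible_on V r" "compact K" "K \<subseteq> V"
  shows "eps_negligible (\<lambda>\<epsilon>. Cj_norm K j (r \<epsilon>))"
  by (rule eps_negligible_dom[OF eps_negligible_sum[OF finite_mi_upto[of j]] abs_Cj_norm_le])
     (use assms in \<open>auto simp: gf_negligible_on_def\<close>)

lemma eps_moderate_Cj_norm:
  assumes "gf_moderate r" "compact K"
  shows "eps_moderate (\<lambda>\<epsilon>. Cj_norm K j (r \<epsilon>))"
  by (rule eps_moderate_dom[OF eps_moderate_sum[OF finite_mi_upto[of j]] abs_Cj_norm_le])
     (use assms in \<open>auto simp: gf_moderate_def\<close>)

lemma gf_rel_refl_iff: "gf_rel r r \<longleftrightarrow> gf_moderate r"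
  by (auto simp: gf_rel_def)

lemma gf_zero_on_represents: "gf_represents r u \<Longrightarrow> gf_zero_on u V \<longleftrightarrow> gf_negligible_on V r"
  unfolding gf_represents_def using gf_zero_on.abs_eq[of r] by (auto simp: gf_rel_refl_iff)

text \<open>A compact set outside the support is covered by finitely many balls on which the net is negligible.\<close>

lemma gf_negligible_off_supp:
  fixes r :: "real \<Rightarrow> ('n::{finite,linorder}) space \<Rightarrow> complex"
  assumes r: "gf_represents r u"
  shows "gf_negligible_on (- gf_supp u) r"
  unfolding gf_negligible_on_def
proof (intro allI impI, elim conjE)
  fix K :: "'n space set" and \<alpha> :: "'n \<Rightarrow> nat" assume K: "compact K" "K \<subseteq> - gf_supp u"
  have "\<exists>e>0. gf_negligible_on (cball x e) r" if "x \<in> K" for x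
  proof -
    obtain V where V: "open V" "gf_zero_on u V" "x \<in> V" using K(2) \<open>x \<in> K\<close> by (auto simp: gf_supp_def)
    obtain e where "e > 0" "cball x e \<subseteq> V" using V open_contains_cball by blast
    then show ?thesis using V(2) gf_zero_on_represents[OF r] gf_zero_on_mono by metis
  qed
  then obtain e where e: "\<And>x. x \<in> K \<Longrightarrow> e x > 0" "\<And>x. x \<in> K \<Longrightarrow> gf_negligible_on (cball x (e x)) r" by metis
  obtain F where F: "F \<subseteq> K" "finite F" "K \<subseteq> (\<Union>x\<in>F. ball x (e x))"
  proof (rule compactE_image[OF K(1), of K "\<lambda>x. ball x (e x)"])
    show "K \<subseteq> (\<Union>x\<in>K. ball x (e x))" using e(1) by force
  qed (use that in auto)
  show "eps_negligible (\<lambda>\<epsilon>. sup_norm K (multi_deriv \<alpha> (r \<epsilon>)))"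
  proof (rule eps_negligible_dom)
    show "eps_negligible (\<lambda>\<epsilon>. \<Sum>x\<in>F. sup_norm (cball x (e x)) (multi_deriv \<alpha> (r \<epsilon>)))"
      using F e(2) by (intro eps_negligible_sum) (auto simp: gf_negligible_on_def)
    fix \<epsilon> :: real assume "\<epsilon> \<in> {0<..1}"
    then have c: "continuous_on S (multi_deriv \<alpha> (r \<epsilon>))" for S
      by (intro smooth_continuous smooth_multi_deriv gf_represents_smooth[OF r])
    have nn: "0 \<le> sup_norm (cball x (e x)) (multi_deriv \<alpha> (r \<epsilon>))" for x by (intro sup_norm_nonneg c compact_cball)
    have "sup_norm K (multi_deriv \<alpha> (r \<epsilon>)) \<le> (\<Sum>x\<in>F. sup_norm (cball x (e x)) (multi_deriv \<alpha> (r \<epsilon>)))"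
    proof (rule sup_norm_least)
      fix y assume "y \<in> K"
      then obtain x where x: "x \<in> F" "y \<in> cball x (e x)" using F(3) by fastforce
      have "norm (multi_deriv \<alpha> (r \<epsilon>) y) \<le> sup_norm (cball x (e x)) (multi_deriv \<alpha> (r \<epsilon>))"
        by (intro sup_norm_upper c compact_cball x)
      also have "\<dots> \<le> (\<Sum>x\<in>F. sup_norm (cball x (e x)) (multi_deriv \<alpha> (r \<epsilon>)))"
        using F x nn by (intro member_le_sum) auto
      finally show "norm (multi_deriv \<alpha> (r \<epsilon>) y) \<le> (\<Sum>x\<in>F. sup_norm (cball x (e x)) (multi_deriv \<alpha> (r \<epsilon>)))" .
    qed (use nn in \<open>auto intro: sum_nonneg\<close>)
    then show "\<bar>sup_norm K (multi_deriv \<alpha> (r \<epsilon>))\<bar> \<le> \<bar>\<Sum>x\<in>F. sup_norm (cball x (e x)) (multi_deriv \<alpha> (r \<epsilon>))\<bar>"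
      using sup_norm_nonneg[OF K(1) c] by linarith
  qed
qed

lemma gf_represents_eqI:
  assumes "gf_represents r u" "gf_moderate r'" "gf_negligible_on UNIV (\<lambda>\<epsilon> x. r' \<epsilon> x - r \<epsilon> x)"
  shows "gf_represents r' u"
  using assms Quotient_rel_abs[OF Quotient_gfun, of r' r] by (auto simp: gf_represents_def gf_rel_def)

lemma gf_represents_diff:
  assumes "gf_represents r u" "gf_represents r' u"
  shows "gf_negligible_on UNIV (\<lambda>\<epsilon> x. r \<epsilon> x - r' \<epsilon> x)"
  using assms Quotient_rel[OF Quotient_gfun, of r r'] by (auto simp: gf_represents_def gf_rel_def gf_rel_refl_iff)

lemma multi_deriv_zero_open:
  assumes "open V" "\<And>x. x \<in> V \<Longrightarrow> f x = 0" "smooth f" "x \<in> V"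
  shows "multi_deriv \<alpha> f x = 0"
proof -
  have "f \<in> test_functions_on (- V)" using assms by (simp add: test_functions_on_def)
  then have "multi_deriv \<alpha> f \<in> test_functions_on (- V)" using assms(1) by (intro test_functions_on_multi_deriv) auto
  then show ?thesis using assms(4) by (simp add: test_functions_on_def)
qed

text \<open>Multiply any representative by a cutoff that is \<open>1\<close> on a neighbourhood of the support. The difference
  vanishes on this neighbourhood, and outside it the representative was already negligible.\<close>

lemma compact_representative:
  fixes u :: "('n::{finite,linorder}) gfun"
  assumes supp: "gf_supp u \<subseteq> cube A" and A: "0 \<le> A"
  shows "\<exists>r. gf_represents r u \<and> (\<forall>\<epsilon>\<in>{0<..1}. r \<epsilon> \<in> test_functions_on (cube (A + 2)))"
proof -
  obtain r where r: "gf_represents r u" using gf_represents_ex by blast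
  have s: "smooth (r \<epsilon>)" if "\<epsilon> \<in> {0<..1}" for \<epsilon> using gf_represents_smooth[OF r that] .
  obtain \<theta> :: "'n space \<Rightarrow> complex" where \<theta>: "smooth \<theta>" "\<And>x. x \<in> cube (A + 1) \<Longrightarrow> \<theta> x = 1" "\<And>x. x \<notin> cube (A + 1 + 1) \<Longrightarrow> \<theta> x = 0"
    using cutoff_exists[of "A + 1"] A by (metis add_nonneg_nonneg zero_le_one)
  let ?r = "\<lambda>\<epsilon> x. \<theta> x * r \<epsilon> x"
  have sm: "smooth (?r \<epsilon>)" if "\<epsilon> \<in> {0<..1}" for \<epsilon> using smooth_mult[OF \<theta>(1) s[OF that]] .
  have "gf_moderate ?r"
    unfolding gf_moderate_def smooth_net_def
  proof (intro conjI ballI allI impI)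
    fix K :: "'n space set" and \<alpha> :: "'n \<Rightarrow> nat" assume K: "compact K"
    obtain C where C: "C \<ge> 0" "\<And>f. smooth f \<Longrightarrow> sup_norm K (multi_deriv \<alpha> (\<lambda>x. \<theta> x * f x)) \<le> C * Cj_norm K (mi_order \<alpha>) f"
      using multi_deriv_mult_bound[OF K \<theta>(1)] by blast
    show "eps_moderate (\<lambda>\<epsilon>. sup_norm K (multi_deriv \<alpha> (?r \<epsilon>)))"
    proof (rule eps_moderate_dom)
      show "eps_moderate (\<lambda>\<epsilon>. C * Cj_norm K (mi_order \<alpha>) (r \<epsilon>))"
        using r K by (intro eps_moderate_mult eps_moderate_Cj_norm) (auto simp: gf_represents_def)
      fix \<epsilon> :: real assume e: "\<epsilon> \<in> {0<..1}"
      show "\<bar>sup_norm K (multi_deriv \<alpha> (?r \<epsilon>))\<bar> \<le> \<bar>C * Cj_norm K (mi_order \<alpha>) (r \<epsilon>)\<bar>"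
        using C(2)[OF s[OF e]] sup_norm_nonneg[OF K smooth_continuous[OF smooth_multi_deriv[OF sm[OF e]]]]
        by (smt (verit))
    qed
  qed (rule sm)
  moreover have "gf_negligible_on UNIV (\<lambda>\<epsilon> x. ?r \<epsilon> x - r \<epsilon> x)"
    unfolding gf_negligible_on_def
  proof (intro allI impI, elim conjE)
    fix K :: "'n space set" and \<alpha> :: "'n \<Rightarrow> nat" assume K: "compact K"
    let ?V = "{x :: 'n space. \<forall>i. \<bar>x $ i\<bar> < A + 1}"
    have "?V = (\<Inter>i. {x. \<bar>x $ i\<bar> < A + 1})" by auto
    then have V: "open ?V" by (simp only:, intro open_INT ballI open_Collect_less continuous_intros) auto
    let ?K = "K - ?V" and ?\<theta> = "\<lambda>x. 1 * \<theta> x + (-1) * 1"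
    have K2: "compact ?K" using K V by (simp add: compact_diff)
    have "smooth (\<lambda>x :: 'n space. complex_of_real 1)" by (intro smooth_flat_functions flat_functions.const)
    then have \<theta>1: "smooth ?\<theta>" using smooth_lin[OF \<theta>(1), of "\<lambda>x. 1" 1 "-1"] by simp
    have eq: "(\<lambda>x. ?r \<epsilon> x - r \<epsilon> x) = (\<lambda>x. ?\<theta> x * r \<epsilon> x)" for \<epsilon> by (simp add: algebra_simps)
    obtain C where C: "C \<ge> 0" "\<And>f. smooth f \<Longrightarrow> sup_norm ?K (multi_deriv \<alpha> (\<lambda>x. ?\<theta> x * f x)) \<le> C * Cj_norm ?K (mi_order \<alpha>) f"
      using multi_deriv_mult_bound[OF K2 \<theta>1] by blast
    show "eps_negligible (\<lambda>\<epsilon>. sup_norm K (multi_deriv \<alpha> (\<lambda>x. ?r \<epsilon> x - r \<epsilon> x)))"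
    proof (rule eps_negligible_dom)
      have "?K \<subseteq> - gf_supp u"
      proof
        fix x assume "x \<in> ?K"
        then obtain i where "A + 1 \<le> \<bar>x $ i\<bar>" by (auto simp: not_less)
        then have "x \<notin> cube A" by (auto simp: cube_def intro!: exI[of _ i])
        then show "x \<in> - gf_supp u" using supp by blast
      qed
      then have "eps_negligible (\<lambda>\<epsilon>. Cj_norm ?K (mi_order \<alpha>) (r \<epsilon>))"
        using r by (intro eps_negligible_Cj_norm[OF _ gf_negligible_off_supp[OF r] K2])
           (auto simp: gf_represents_def gf_moderate_def)
      then show "eps_negligible (\<lambda>\<epsilon>. C * Cj_norm ?K (mi_order \<alpha>) (r \<epsilon>))" by (intro eps_negligible_mult) auto
      fix \<epsilon> :: real assume e: "\<epsilon> \<in> {0<..1}"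
      have sm1: "smooth (\<lambda>x. ?\<theta> x * r \<epsilon> x)" by (rule smooth_mult[OF \<theta>1 s[OF e]])
      note c = smooth_continuous[OF smooth_multi_deriv[OF sm1]]
      have "sup_norm K (multi_deriv \<alpha> (\<lambda>x. ?\<theta> x * r \<epsilon> x)) \<le> sup_norm ?K (multi_deriv \<alpha> (\<lambda>x. ?\<theta> x * r \<epsilon> x))"
      proof (rule sup_norm_least)
        show nn: "0 \<le> sup_norm ?K (multi_deriv \<alpha> (\<lambda>x. ?\<theta> x * r \<epsilon> x))" by (rule sup_norm_nonneg[OF K2 c])
        fix x assume x: "x \<in> K"
        show "norm (multi_deriv \<alpha> (\<lambda>x. ?\<theta> x * r \<epsilon> x) x) \<le> sup_norm ?K (multi_deriv \<alpha> (\<lambda>x. ?\<theta> x * r \<epsilon> x))"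
        proof (cases "x \<in> ?V")
          case True
          have "multi_deriv \<alpha> (\<lambda>x. ?\<theta> x * r \<epsilon> x) x = 0"
            by (rule multi_deriv_zero_open[OF V _ sm1 True]) (simp add: \<theta>(2) cube_def less_imp_le)
          then show ?thesis using nn by simp
        next
          case False
          then show ?thesis using x by (intro sup_norm_upper[OF K2 c]) auto
        qed
      qed
      then show "\<bar>sup_norm K (multi_deriv \<alpha> (\<lambda>x. ?r \<epsilon> x - r \<epsilon> x))\<bar> \<le> \<bar>C * Cj_norm ?K (mi_order \<alpha>) (r \<epsilon>)\<bar>"
        unfolding eq using C(2)[OF s[OF e]] sup_norm_nonneg[OF K c] by (smt (verit))
    qed
  qed
  ultimately have "gf_represents ?r u" by (rule gf_represents_eqI[OF r])
  moreover have "?r \<epsilon> \<in> test_functions_on (cube (A + 2))" if "\<epsilon> \<in> {0<..1}" for \<epsilon>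
    using sm[OF that] \<theta>(3) by (auto simp: test_functions_on_def add.commute)
  ultimately show ?thesis by blast
qed

section \<open>Continuous functionals from moderate nets\<close>

lemma bigo_dom_ev:
  assumes "g \<in> O[at_right 0](h)" "eventually (\<lambda>\<epsilon>. \<bar>f \<epsilon>\<bar> \<le> \<bar>g \<epsilon> :: real\<bar>) (at_right 0)"
  shows "f \<in> O[at_right (0::real)](h)"
proof -
  have "f \<in> O[at_right (0::real)](g)"
    by (rule bigoI[of _ 1], rule eventually_mono[OF assms(2)]) auto
  then show ?thesis using assms(1) by (rule landau_o.big_trans)
qed

lemma eps_negligible_dom_ev:
  "eps_negligible g \<Longrightarrow> eventually (\<lambda>\<epsilon>. \<bar>f \<epsilon>\<bar> \<le> \<bar>g \<epsilon>\<bar>) (at_right 0) \<Longrightarrow> eps_negligible f"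
  unfolding eps_negligible_def using bigo_dom_ev by blast

lemma eventually_small: "0 < C \<Longrightarrow> eventually (\<lambda>\<epsilon>. \<epsilon> \<in> {0<..C}) (at_right (0::real))"
  using eventually_at_right_real[of 0 C] by (auto elim: eventually_mono)

lemma eventually_epsE:
  assumes "eventually P (at_right (0::real))"
  obtains \<eta> where "\<eta> \<in> {0<..1}" "\<And>\<epsilon>. \<epsilon> \<in> {0<..\<eta>} \<Longrightarrow> P \<epsilon>"
proof -
  obtain b where b: "b > 0" "\<And>y. 0 < y \<Longrightarrow> y < b \<Longrightarrow> P y"
    using assms unfolding eventually_at_right_field by blast
  show ?thesis by (rule that[of "min 1 (b / 2)"]) (use b in auto)
qed

lemma gc_rel_refl_iff: "gc_rel r r \<longleftrightarrow> gc_moderate r"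
  by (auto simp: gc_rel_def)

lemma gc_represents_ex: "\<exists>r. gc_represents r z"
proof -
  have "gc_rel (rep_gcomplex z) (rep_gcomplex z)" "abs_gcomplex (rep_gcomplex z) = z"
    using Quotient_rep_reflp[OF Quotient_gcomplex] Quotient_abs_rep[OF Quotient_gcomplex] by blast+
  then show ?thesis by (auto simp: gc_represents_def gc_rel_def)
qed

lemma gc_represents_eqI:
  assumes "gc_represents r z" "gc_moderate s" "gc_negligible (\<lambda>\<epsilon>. s \<epsilon> - r \<epsilon>)"
  shows "gc_represents s z"
  using assms Quotient_rel_abs[OF Quotient_gcomplex, of s r] by (auto simp: gc_represents_def gc_rel_def)

lemma gc_moderate_cong:
  assumes "gc_moderate r" "\<And>\<epsilon>. \<epsilon> \<in> {0<..1} \<Longrightarrow> s \<epsilon> = r \<epsilon>"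
  shows "gc_moderate s"
  unfolding gc_moderate_def by (rule eps_moderate_dom[OF assms(1)[unfolded gc_moderate_def]]) (simp add: assms(2))

lemma gc_represents_cong:
  assumes "gc_represents r z" "\<And>\<epsilon>. \<epsilon> \<in> {0<..1} \<Longrightarrow> s \<epsilon> = r \<epsilon>"
  shows "gc_represents s z"
proof (rule gc_represents_eqI[OF assms(1)])
  show "gc_moderate s" using assms gc_moderate_cong unfolding gc_represents_def by blast
  show "gc_negligible (\<lambda>\<epsilon>. s \<epsilon> - r \<epsilon>)"
    unfolding gc_negligible_def by (rule eps_negligible_dom[OF eps_negligible_zero]) (simp add: assms(2))
qed

lemma gc_represents_unique: "gc_represents r z \<Longrightarrow> gc_represents r w \<Longrightarrow> z = w"
  by (auto simp: gc_represents_def)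

lemma gc_represents_diff:
  assumes "gc_represents r z" "gc_represents s z" shows "gc_negligible (\<lambda>\<epsilon>. r \<epsilon> - s \<epsilon>)"
  using assms Quotient_rel[OF Quotient_gcomplex, of r s] by (auto simp: gc_represents_def gc_rel_def gc_rel_refl_iff)

lemma gc_represents_add: "gc_represents r z \<Longrightarrow> gc_represents s w \<Longrightarrow> gc_represents (\<lambda>\<epsilon>. r \<epsilon> + s \<epsilon>) (z + w)"
  by (auto simp: gc_represents_def gc_moderate_add plus_gcomplex.abs_eq gc_rel_refl_iff)

lemma gc_represents_mult: "gc_represents r z \<Longrightarrow> gc_represents s w \<Longrightarrow> gc_represents (\<lambda>\<epsilon>. r \<epsilon> * s \<epsilon>) (z * w)"
  by (auto simp: gc_represents_def gc_moderate_mult times_gcomplex.abs_eq gc_rel_refl_iff)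

lemma gc_represents_uminus: "gc_represents r z \<Longrightarrow> gc_represents (\<lambda>\<epsilon>. - r \<epsilon>) (- z)"
  by (auto simp: gc_represents_def gc_moderate_uminus uminus_gcomplex.abs_eq gc_rel_refl_iff)

lemma gc_represents_zero: "gc_represents (\<lambda>\<epsilon>. 0) 0"
  by (simp add: gc_represents_def zero_gcomplex_def)

lemma gc_represents_one: "gc_represents (\<lambda>\<epsilon>. 1) 1"
  by (simp add: gc_represents_def one_gcomplex_def)

lemma gc_represents_minus_one_power: "gc_represents (\<lambda>\<epsilon>. (-1) ^ k) ((-1) ^ k)"
proof (induction k)
  case (Suc k)
  from gc_represents_mult[OF gc_represents_uminus[OF gc_represents_one] this] show ?case by simp
qed (simp add: gc_represents_one)

lemma gf_represents_add:
  "gf_represents r u \<Longrightarrow> gf_represents s v \<Longrightarrow> gf_represents (\<lambda>\<epsilon> x. r \<epsilon> x + s \<epsilon> x) (u + v)"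
  using gf_moderate_lin[of "\<lambda>_. 1" "\<lambda>_. 1" r s]
  by (auto simp: gf_represents_def plus_gfun.abs_eq gf_rel_refl_iff)

lemma gf_represents_scale:
  "gc_represents z' z \<Longrightarrow> gf_represents r u \<Longrightarrow> gf_represents (\<lambda>\<epsilon> x. z' \<epsilon> * r \<epsilon> x) (z *\<^sub>G u)"
  using gf_moderate_lin[of z' "\<lambda>_. 0" r r]
  by (auto simp: gf_represents_def gc_represents_def gf_scale.abs_eq gf_rel_refl_iff gc_rel_refl_iff)

lemma gf_represents_zero: "gf_represents (\<lambda>\<epsilon> x. 0) 0"
  by (simp add: gf_represents_def zero_gfun_def)

lemma gf_represents_D:
  assumes "gf_represents r u" shows "gf_represents (\<lambda>\<epsilon> x. (- \<i>) ^ mi_order \<alpha> * multi_deriv \<alpha> (r \<epsilon>) x) (gf_D \<alpha> u)"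
proof -
  have r: "gf_rel r r" using assms by (simp add: gf_represents_def gf_rel_refl_iff)
  from gf_D.rsp[unfolded rel_fun_def, rule_format, OF refl r, of \<alpha>] gf_D.abs_eq[OF r, of \<alpha>] assms
  show ?thesis by (simp add: gf_represents_def gf_rel_refl_iff)
qed

lemma gf_represents_sum:
  "finite F \<Longrightarrow> (\<And>i. i \<in> F \<Longrightarrow> gf_represents (r i) (u i)) \<Longrightarrow> gf_represents (\<lambda>\<epsilon> x. \<Sum>i\<in>F. r i \<epsilon> x) (\<Sum>i\<in>F. u i)"
  by (induction F rule: finite_induct) (auto intro: gf_represents_zero gf_represents_add)

text \<open>The order of decay of a generalized number; \<^const>\<open>gc_val\<close> is the supremum of all such \<open>b\<close>. Strict bounds on
  \<^const>\<open>gc_abs\<close> become existence statements about orders, which are easier to add and multiply.\<close>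

definition gc_order :: "real \<Rightarrow> gcomplex \<Rightarrow> bool" where
  "gc_order b z \<longleftrightarrow> (\<exists>r. gc_represents r z \<and> (\<lambda>\<epsilon>. norm (r \<epsilon>)) \<in> O[at_right 0](\<lambda>\<epsilon>. \<epsilon> powr b))"

lemma gc_val_eq: "gc_val z = Sup {ereal b | b. gc_order b z}"
proof -
  have *: "(\<lambda>\<epsilon>. norm (s \<epsilon>)) \<in> O[at_right 0](\<lambda>\<epsilon>. \<epsilon> powr b)"
    if "gc_represents r z" "gc_represents s z" "(\<lambda>\<epsilon>. norm (r \<epsilon>)) \<in> O[at_right 0](\<lambda>\<epsilon>. \<epsilon> powr b)" for r s b
    by (rule bigo_norm_cong[OF _ gc_represents_diff[OF that(1,2), unfolded gc_negligible_def] that(3)])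
       (metis (no_types, lifting) abs_norm_cancel add.commute norm_minus_commute norm_triangle_sub)
  obtain r where r: "gc_represents r z" using gc_represents_ex by blast
  have "gc_order b z \<longleftrightarrow> (\<lambda>\<epsilon>. norm (r \<epsilon>)) \<in> O[at_right 0](\<lambda>\<epsilon>. \<epsilon> powr b)" for b
    using * r unfolding gc_order_def by blast
  moreover have "gc_rel r r" "z = abs_gcomplex r" using r by (auto simp: gc_represents_def gc_rel_refl_iff)
  ultimately show ?thesis using gc_val.abs_eq[of r] by simp
qed

lemma gc_order_mono: "gc_order b z \<Longrightarrow> b' \<le> b \<Longrightarrow> gc_order b' z"
  unfolding gc_order_def using powr_bigo_mono by blast

lemma gc_order_ex: "\<exists>b. gc_order b z"
  using gc_represents_ex[of z] unfolding gc_order_def gc_represents_def gc_moderate_def eps_moderate_def by blast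

lemma gc_order_add:
  assumes "gc_order b z" "gc_order b w" shows "gc_order b (z + w)"
proof -
  obtain r s where r: "gc_represents r z" "(\<lambda>\<epsilon>. norm (r \<epsilon>)) \<in> O[at_right 0](\<lambda>\<epsilon>. \<epsilon> powr b)"
    and s: "gc_represents s w" "(\<lambda>\<epsilon>. norm (s \<epsilon>)) \<in> O[at_right 0](\<lambda>\<epsilon>. \<epsilon> powr b)"
    using assms unfolding gc_order_def by blast
  have "(\<lambda>\<epsilon>. norm (r \<epsilon>) + norm (s \<epsilon>)) \<in> O[at_right 0](\<lambda>\<epsilon>. \<epsilon> powr b)" using r s by (intro sum_in_bigo(1))
  then have "(\<lambda>\<epsilon>. norm (r \<epsilon> + s \<epsilon>)) \<in> O[at_right 0](\<lambda>\<epsilon>. \<epsilon> powr b)"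
    by (rule bigo_dom) (auto intro: norm_triangle_ineq)
  then show ?thesis unfolding gc_order_def using gc_represents_add[OF r(1) s(1)] by blast
qed

lemma gc_order_mult:
  assumes "gc_order b z" "gc_order b' w" shows "gc_order (b + b') (z * w)"
proof -
  obtain r s where r: "gc_represents r z" "(\<lambda>\<epsilon>. norm (r \<epsilon>)) \<in> O[at_right 0](\<lambda>\<epsilon>. \<epsilon> powr b)"
    and s: "gc_represents s w" "(\<lambda>\<epsilon>. norm (s \<epsilon>)) \<in> O[at_right 0](\<lambda>\<epsilon>. \<epsilon> powr b')"
    using assms unfolding gc_order_def by blast
  have "(\<lambda>\<epsilon>. norm (r \<epsilon> * s \<epsilon>)) \<in> O[at_right 0](\<lambda>\<epsilon>. \<epsilon> powr (b + b'))"
    using landau_o.big.mult[OF r(2) s(2)] by (simp add: norm_mult powr_add)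
  then show ?thesis unfolding gc_order_def using gc_represents_mult[OF r(1) s(1)] by blast
qed

lemma gc_order_eps_powr: "gc_order b (gc_eps_powr b)"
proof -
  have m: "gc_moderate (\<lambda>\<epsilon>. complex_of_real (\<epsilon> powr b))" by (simp add: gc_moderate_def eps_moderate_powr)
  then have "gc_represents (\<lambda>\<epsilon>. of_real (\<epsilon> powr b)) (gc_eps_powr b)"
    by (simp add: gc_represents_def gc_eps_powr_def)
  then show ?thesis unfolding gc_order_def
    by (intro exI[of _ "\<lambda>\<epsilon>. of_real (\<epsilon> powr b)"]) simp
qed

text \<open>The hypothesis \<open>P b\<^sub>0\<close> excludes the value \<open>-\<infinity>\<close>, where \<^const>\<open>exp_minus\<close> is not meaningful.\<close>

lemma exp_minus_Sup_less:
  assumes d: "0 < d" and b0: "P b0"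
  shows "exp_minus (Sup {ereal b | b. P b}) < d \<longleftrightarrow> (\<exists>b. exp (- b) < d \<and> P b)"
proof -
  let ?v = "Sup {ereal b | b. P b}"
  have lnd: "- ln d < x \<longleftrightarrow> exp (- x) < d" for x
  proof -
    have "exp (- x) < d \<longleftrightarrow> exp (- x) < exp (ln d)" using d by simp
    then show ?thesis unfolding exp_less_cancel_iff by linarith
  qed
  have v: "exp_minus v < d \<longleftrightarrow> ereal (- ln d) < v" if "v \<noteq> -\<infinity>" for v
    using that d by (cases v) (simp_all add: exp_minus_def lnd)
  have "ereal b0 \<le> ?v" using b0 by (intro Sup_upper) blast
  then have "?v \<noteq> -\<infinity>" by auto
  from v[OF this] have "exp_minus ?v < d \<longleftrightarrow> ereal (- ln d) < ?v" .
  also have "\<dots> \<longleftrightarrow> (\<exists>b. P b \<and> - ln d < b)" unfolding less_Sup_iff by auto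
  finally show ?thesis unfolding lnd by blast
qed

lemma gc_abs_less_iff:
  assumes "0 < d" shows "gc_abs z < d \<longleftrightarrow> (\<exists>b. exp (- b) < d \<and> gc_order b z)"
proof -
  obtain b0 where "gc_order b0 z" using gc_order_ex by blast
  from exp_minus_Sup_less[of d "\<lambda>b. gc_order b z", OF assms this] show ?thesis
    unfolding gc_abs_def gc_val_eq .
qed

lemma gf_val_less:
  fixes u :: "('n::{finite,linorder}) gfun"
  assumes "0 < d" "compact K" "exp_minus (gf_val K j u) < d"
  shows "\<exists>b r. exp (- b) < d \<and> gf_represents r u \<and> (\<lambda>\<epsilon>. Cj_norm K j (r \<epsilon>)) \<in> O[at_right 0](\<lambda>\<epsilon>. \<epsilon> powr b)"
proof -
  let ?P = "\<lambda>b. \<exists>r. gf_represents r u \<and> (\<lambda>\<epsilon>. Cj_norm K j (r \<epsilon>)) \<in> O[at_right 0](\<lambda>\<epsilon>. \<epsilon> powr b)"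
  obtain r0 where r0: "gf_represents r0 u" using gf_represents_ex by blast
  then have "eps_moderate (\<lambda>\<epsilon>. Cj_norm K j (r0 \<epsilon>))"
    using assms(2) by (intro eps_moderate_Cj_norm) (auto simp: gf_represents_def)
  then obtain b0 where b0: "?P b0" using r0 unfolding eps_moderate_def by blast
  have eq: "gf_val K j u = Sup {ereal b | b. ?P b}"
    unfolding gf_val_def by (rule arg_cong[where f=Sup]) blast
  show ?thesis
    using exp_minus_Sup_less[of d ?P, OF assms(1) b0] assms(3) unfolding eq by blast
qed

definition compact_rep :: "(real \<Rightarrow> ('n::{finite,linorder}) space \<Rightarrow> complex) \<Rightarrow> 'n gfun \<Rightarrow> bool" where
  "compact_rep r u \<longleftrightarrow> gf_represents r u \<and> (\<exists>A\<ge>0. \<forall>\<epsilon>\<in>{0<..1}. r \<epsilon> \<in> test_functions_on (cube A))"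

lemma cube_mono: "A \<le> A' \<Longrightarrow> cube A \<subseteq> cube A'"
  by (auto simp: cube_def intro: order_trans)

lemma compact_subset_cube:
  fixes K :: "('n::finite) space set"
  assumes "compact K" shows "\<exists>A\<ge>0. K \<subseteq> cube A"
proof -
  obtain A where A: "\<And>x. x \<in> K \<Longrightarrow> norm x \<le> A" using compact_imp_bounded[OF assms] bounded_iff by blast
  have "K \<subseteq> cube \<bar>A\<bar>"
  proof
    fix x assume "x \<in> K"
    then have "\<bar>x $ i\<bar> \<le> \<bar>A\<bar>" for i using A[of x] component_le_norm_cart[of x i] by linarith
    then show "x \<in> cube \<bar>A\<bar>" by (simp add: cube_def)
  qed
  then show ?thesis by (intro exI[of _ "\<bar>A\<bar>"]) simp
qed

lemma test_functions_on_mono: "f \<in> test_functions_on K \<Longrightarrow> K \<subseteq> K' \<Longrightarrow> f \<in> test_functions_on K'"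
  by (auto simp: test_functions_on_def)

lemma test_functions_on_lin:
  "f \<in> test_functions_on K \<Longrightarrow> g \<in> test_functions_on K \<Longrightarrow> (\<lambda>x. a * f x + b * g x) \<in> test_functions_on K"
  by (auto simp: test_functions_on_def smooth_lin)

lemma compact_rep_ex: "u \<in> Gc \<Longrightarrow> \<exists>r. compact_rep r u"
proof -
  assume "u \<in> Gc"
  then obtain A where "A \<ge> 0" "gf_supp u \<subseteq> cube A" using compact_subset_cube unfolding Gc_def by blast
  with compact_representative[of u A] show ?thesis
    unfolding compact_rep_def by (metis add_nonneg_nonneg zero_le_numeral)
qed

lemma compact_rep_common:
  assumes "compact_rep r u" "compact_rep s v"
  shows "\<exists>A\<ge>0. \<forall>\<epsilon>\<in>{0<..1}. r \<epsilon> \<in> test_functions_on (cube A) \<and> s \<epsilon> \<in> test_functions_on (cube A)"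
proof -
  obtain A A' where A: "A \<ge> 0" "\<forall>\<epsilon>\<in>{0<..1}. r \<epsilon> \<in> test_functions_on (cube A)"
    "A' \<ge> 0" "\<forall>\<epsilon>\<in>{0<..1}. s \<epsilon> \<in> test_functions_on (cube A')"
    using assms unfolding compact_rep_def by blast
  then have "\<forall>\<epsilon>\<in>{0<..1}. r \<epsilon> \<in> test_functions_on (cube (max A A')) \<and> s \<epsilon> \<in> test_functions_on (cube (max A A'))"
    using test_functions_on_mono cube_mono by (metis max.cobounded1 max.cobounded2)
  then show ?thesis using A by (intro exI[of _ "max A A'"]) auto
qed

lemma compact_rep_add:
  assumes "compact_rep r u" "compact_rep s v" shows "compact_rep (\<lambda>\<epsilon> x. 1 * r \<epsilon> x + 1 * s \<epsilon> x) (u + v)"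
proof -
  obtain A where "A \<ge> 0" "\<forall>\<epsilon>\<in>{0<..1}. r \<epsilon> \<in> test_functions_on (cube A) \<and> s \<epsilon> \<in> test_functions_on (cube A)"
    using compact_rep_common[OF assms] by blast
  moreover have "gf_represents (\<lambda>\<epsilon> x. 1 * r \<epsilon> x + 1 * s \<epsilon> x) (u + v)"
    using gf_represents_add assms by (auto simp: compact_rep_def)
  ultimately show ?thesis unfolding compact_rep_def
    by (intro conjI exI[of _ A] ballI test_functions_on_lin) auto
qed

lemma compact_rep_scale:
  assumes "compact_rep r u" "gc_represents z' z" shows "compact_rep (\<lambda>\<epsilon> x. z' \<epsilon> * r \<epsilon> x) (z *\<^sub>G u)"
proof -
  obtain A where A: "A \<ge> 0" "\<forall>\<epsilon>\<in>{0<..1}. r \<epsilon> \<in> test_functions_on (cube A)"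
    using assms(1) unfolding compact_rep_def by blast
  have "(\<lambda>x. z' \<epsilon> * r \<epsilon> x) \<in> test_functions_on (cube A)" if "\<epsilon> \<in> {0<..1}" for \<epsilon>
    using test_functions_on_lin[of "r \<epsilon>" "cube A" "r \<epsilon>" "z' \<epsilon>" 0] A(2) that by simp
  then show ?thesis
    unfolding compact_rep_def using A(1) gf_represents_scale[OF assms(2)] assms(1) compact_rep_def by blast
qed

lemma Cj_norm_least:
  assumes "0 \<le> C" "\<And>\<alpha> x. mi_order \<alpha> \<le> j \<Longrightarrow> x \<in> K \<Longrightarrow> norm (multi_deriv \<alpha> f x) \<le> C"
  shows "Cj_norm K j f \<le> C"
  unfolding Cj_norm_def by (rule cSup_least) (use assms in auto)

lemma Cj_norm_test_function_le:
  fixes K :: "('n::{finite,linorder}) space set"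
  assumes K: "compact K" and f: "f \<in> test_functions_on K"
  shows "Cj_norm D j f \<le> Cj_norm K j f"
proof (rule Cj_norm_least)
  have s: "smooth f" using f by (rule test_functions_on_smooth)
  show nn: "0 \<le> Cj_norm K j f" by (rule Cj_norm_bounds(2)[OF K s])
  fix \<alpha> :: "'n \<Rightarrow> nat" and x :: "'n space" assume a: "mi_order \<alpha> \<le> j"
  show "norm (multi_deriv \<alpha> f x) \<le> Cj_norm K j f"
  proof (cases "x \<in> K")
    case True
    then show ?thesis using Cj_norm_upper[OF K s a] by blast
  next
    case False
    then show ?thesis
      using nn test_functions_on_zero[OF test_functions_on_multi_deriv[OF compact_imp_closed[OF K] f]] by simp
  qed
qed

text \<open>The triangle inequality for \<open>f = g + (f - g)\<close>.\<close>

lemma Cj_norm_diff_le: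
  fixes f g :: "('n::{finite,linorder}) space \<Rightarrow> complex"
  assumes K: "compact K" and s: "smooth f" "smooth g"
  shows "Cj_norm K j f \<le> Cj_norm K j g + Cj_norm K j (\<lambda>x. f x - g x)"
proof (rule Cj_norm_least)
  have d: "smooth (\<lambda>x. f x - g x)" using smooth_lin[OF s, of 1 "-1"] by simp
  show "0 \<le> Cj_norm K j g + Cj_norm K j (\<lambda>x. f x - g x)"
    using Cj_norm_bounds(2)[OF K s(2)] Cj_norm_bounds(2)[OF K d] by (intro add_nonneg_nonneg) auto
  fix \<alpha> :: "'n \<Rightarrow> nat" and x :: "'n space" assume a: "mi_order \<alpha> \<le> j" "x \<in> K"
  have "multi_deriv \<alpha> (\<lambda>x. f x - g x) x = multi_deriv \<alpha> f x - multi_deriv \<alpha> g x"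
    using multi_deriv_lin[OF s, of \<alpha> 1 "-1"] by simp
  then have "norm (multi_deriv \<alpha> f x) \<le> norm (multi_deriv \<alpha> g x) + norm (multi_deriv \<alpha> (\<lambda>x. f x - g x) x)"
    by (metis norm_triangle_sub)
  also have "\<dots> \<le> Cj_norm K j g + Cj_norm K j (\<lambda>x. f x - g x)"
    by (intro add_mono Cj_norm_upper K s d a)
  finally show "norm (multi_deriv \<alpha> f x) \<le> Cj_norm K j g + Cj_norm K j (\<lambda>x. f x - g x)" .
qed

text \<open>The moderateness condition in the definition of basic functionals, sharpened: the estimate uses the
  test function on \<open>H\<close> only. This sharpening encodes the support of the resulting functional.\<close>

definition moderate_functional_net :: "('n::{finite,linorder}) space set \<Rightarrow> (real \<Rightarrow> ('n space \<Rightarrow> complex) \<Rightarrow> complex) \<Rightarrow> bool" where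
  "moderate_functional_net H S \<longleftrightarrow> closed H \<and> (\<forall>\<epsilon>\<in>{0<..1}. distribution (S \<epsilon>)) \<and>
     (\<forall>A\<ge>0. \<exists>(j::nat) (N::nat). \<exists>c>0. \<exists>\<eta>\<in>{0<..1}. \<forall>f\<in>test_functions_on (cube A). \<forall>\<epsilon>\<in>{0<..\<eta>}.
        norm (S \<epsilon> f) \<le> c * \<epsilon> powr (- real N) * Cj_norm (cube A \<inter> H) j f)"

text \<open>The functional with representative \<open>S\<^sub>\<epsilon>\<close>. By moderateness of the net, the choice of the compactly supported
  representative is irrelevant.\<close>

definition net_functional :: "(real \<Rightarrow> (('n::{finite,linorder}) space \<Rightarrow> complex) \<Rightarrow> complex) \<Rightarrow> 'n gfun \<Rightarrow> gcomplex" where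
  "net_functional S u = abs_gcomplex (\<lambda>\<epsilon>. S \<epsilon> ((SOME r. compact_rep r u) \<epsilon>))"

context
  fixes H :: "('n::{finite,linorder}) space set" and S :: "real \<Rightarrow> ('n space \<Rightarrow> complex) \<Rightarrow> complex"
  assumes S: "moderate_functional_net H S"
begin

lemma net_lin:
  assumes "\<epsilon> \<in> {0<..1}" "f \<in> test_functions_on (cube A)" "g \<in> test_functions_on (cube A)"
  shows "S \<epsilon> (\<lambda>x. a * f x + b * g x) = a * S \<epsilon> f + b * S \<epsilon> g"
proof -
  have "distribution (S \<epsilon>)" using S assms(1) unfolding moderate_functional_net_def by (elim conjE) (rule bspec)
  then have "\<forall>f\<in>test_functions_on (cube A). \<forall>g\<in>test_functions_on (cube A). \<forall>a b.
      S \<epsilon> (\<lambda>x. a * f x + b * g x) = a * S \<epsilon> f + b * S \<epsilon> g"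
    unfolding distribution_def using compact_cube[of A] by (drule_tac x="cube A" in spec) simp
  then show ?thesis using assms(2,3) by simp
qed

lemma net_bound:
  assumes "A \<ge> 0"
  obtains j N :: nat and c where "c > 0"
    "eventually (\<lambda>\<epsilon>. \<forall>f\<in>test_functions_on (cube A). norm (S \<epsilon> f) \<le> c * \<epsilon> powr (- real N) * Cj_norm (cube A \<inter> H) j f) (at_right 0)"
proof -
  obtain j N :: nat and c \<eta> where *: "c > 0" "\<eta> \<in> {0<..1}"
    "\<forall>f\<in>test_functions_on (cube A). \<forall>\<epsilon>\<in>{0<..\<eta>}. norm (S \<epsilon> f) \<le> c * \<epsilon> powr (- real N) * Cj_norm (cube A \<inter> H) j f"
    using S assms unfolding moderate_functional_net_def by blast
  show ?thesis
  proof (rule that[OF *(1)], rule eventually_mono[OF eventually_small])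
    show "0 < \<eta>" using *(2) by simp
  qed (use *(3) in blast)
qed

lemma compact_cube_Int: "compact (cube A \<inter> H)"
proof -
  have "closed H" using S unfolding moderate_functional_net_def by (elim conjE)
  then show ?thesis by (rule compact_Int_closed[OF compact_cube])
qed

lemma net_order:
  assumes A: "A \<ge> 0"
  shows "\<exists>(j::nat) (N::nat). \<forall>r b. (\<forall>\<epsilon>\<in>{0<..1}. r \<epsilon> \<in> test_functions_on (cube A)) \<longrightarrow>
     (\<lambda>\<epsilon>. Cj_norm (cube A \<inter> H) j (r \<epsilon>)) \<in> O[at_right 0](\<lambda>\<epsilon>. \<epsilon> powr b) \<longrightarrow>
     (\<lambda>\<epsilon>. norm (S \<epsilon> (r \<epsilon>))) \<in> O[at_right 0](\<lambda>\<epsilon>. \<epsilon> powr (b - real N))"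
proof -
  obtain j N :: nat and c where c: "c > 0"
    "eventually (\<lambda>\<epsilon>. \<forall>f\<in>test_functions_on (cube A). norm (S \<epsilon> f) \<le> c * \<epsilon> powr (- real N) * Cj_norm (cube A \<inter> H) j f) (at_right 0)"
    using net_bound[OF A] by blast
  show ?thesis
  proof (rule exI[of _ j], rule exI[of _ N], intro allI impI)
    fix r :: "real \<Rightarrow> 'n space \<Rightarrow> complex" and b
    assume r: "\<forall>\<epsilon>\<in>{0<..1}. r \<epsilon> \<in> test_functions_on (cube A)"
      and b: "(\<lambda>\<epsilon>. Cj_norm (cube A \<inter> H) j (r \<epsilon>)) \<in> O[at_right 0](\<lambda>\<epsilon>. \<epsilon> powr b)"
    have 1: "(\<lambda>\<epsilon>. c * (\<epsilon> powr (- real N) * Cj_norm (cube A \<inter> H) j (r \<epsilon>))) \<in> O[at_right 0](\<lambda>\<epsilon>. \<epsilon> powr (b - real N))"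
      using landau_o.big.mult[OF landau_o.big_refl[of "\<lambda>\<epsilon>. \<epsilon> powr (- real N)"] b]
      by (simp add: powr_add[symmetric])
    show "(\<lambda>\<epsilon>. norm (S \<epsilon> (r \<epsilon>))) \<in> O[at_right 0](\<lambda>\<epsilon>. \<epsilon> powr (b - real N))"
      by (rule bigo_dom_ev[OF 1], rule eventually_mono[OF eventually_conj[OF c(2) ev_eps]])
         (use r in \<open>auto simp: mult.assoc intro: order_trans[OF _ abs_ge_self]\<close>)
  qed
qed

lemma net_moderate:
  assumes r: "compact_rep r u" shows "gc_moderate (\<lambda>\<epsilon>. S \<epsilon> (r \<epsilon>))"
proof -
  obtain A where A: "A \<ge> 0" "\<forall>\<epsilon>\<in>{0<..1}. r \<epsilon> \<in> test_functions_on (cube A)" and m: "gf_moderate r"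
    using r unfolding compact_rep_def gf_represents_def by blast
  obtain j N :: nat where jN: "\<And>b. (\<lambda>\<epsilon>. Cj_norm (cube A \<inter> H) j (r \<epsilon>)) \<in> O[at_right 0](\<lambda>\<epsilon>. \<epsilon> powr b) \<Longrightarrow>
     (\<lambda>\<epsilon>. norm (S \<epsilon> (r \<epsilon>))) \<in> O[at_right 0](\<lambda>\<epsilon>. \<epsilon> powr (b - real N))"
    using net_order[OF A(1)] A(2) by blast
  obtain M :: nat where "(\<lambda>\<epsilon>. Cj_norm (cube A \<inter> H) j (r \<epsilon>)) \<in> O[at_right 0](\<lambda>\<epsilon>. \<epsilon> powr (- real M))"
    using eps_moderate_Cj_norm[OF m compact_cube_Int] unfolding eps_moderate_def by blast
  from jN[OF this] have "(\<lambda>\<epsilon>. norm (S \<epsilon> (r \<epsilon>))) \<in> O[at_right 0](\<lambda>\<epsilon>. \<epsilon> powr (- real (M + N)))"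
    by simp
  then show ?thesis unfolding gc_moderate_def eps_moderate_def by blast
qed

lemma net_negligible:
  assumes A: "A \<ge> 0" "\<And>\<epsilon>. \<epsilon> \<in> {0<..1} \<Longrightarrow> r \<epsilon> \<in> test_functions_on (cube A)"
    and V: "gf_negligible_on V r" "H \<subseteq> V"
  shows "gc_negligible (\<lambda>\<epsilon>. S \<epsilon> (r \<epsilon>))"
proof -
  obtain j N :: nat where jN: "\<And>b. (\<lambda>\<epsilon>. Cj_norm (cube A \<inter> H) j (r \<epsilon>)) \<in> O[at_right 0](\<lambda>\<epsilon>. \<epsilon> powr b) \<Longrightarrow>
     (\<lambda>\<epsilon>. norm (S \<epsilon> (r \<epsilon>))) \<in> O[at_right 0](\<lambda>\<epsilon>. \<epsilon> powr (b - real N))"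
    using net_order[OF A(1)] A(2) by blast
  have sn: "smooth_net r" using A(2) by (auto simp: smooth_net_def test_functions_on_def)
  have "eps_negligible (\<lambda>\<epsilon>. Cj_norm (cube A \<inter> H) j (r \<epsilon>))"
    by (rule eps_negligible_Cj_norm[OF sn V(1) compact_cube_Int]) (use V(2) in auto)
  then have "(\<lambda>\<epsilon>. Cj_norm (cube A \<inter> H) j (r \<epsilon>)) \<in> O[at_right 0](\<lambda>\<epsilon>. \<epsilon> powr (real (q + N)))" for q :: nat
    unfolding eps_negligible_def by blast
  from jN[OF this] show ?thesis unfolding gc_negligible_def eps_negligible_def by simp
qed

lemma net_independent:
  assumes r: "compact_rep r u" and s: "compact_rep s u"
  shows "gc_negligible (\<lambda>\<epsilon>. S \<epsilon> (r \<epsilon>) - S \<epsilon> (s \<epsilon>))"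
proof -
  obtain A where A: "A \<ge> 0" "\<And>\<epsilon>. \<epsilon> \<in> {0<..1} \<Longrightarrow> r \<epsilon> \<in> test_functions_on (cube A) \<and> s \<epsilon> \<in> test_functions_on (cube A)"
    using compact_rep_common[OF r s] by blast
  have "gf_negligible_on UNIV (\<lambda>\<epsilon> x. 1 * r \<epsilon> x + (-1) * s \<epsilon> x)"
    using gf_represents_diff[of r u s] r s by (simp add: compact_rep_def)
  then have 1: "gc_negligible (\<lambda>\<epsilon>. S \<epsilon> (\<lambda>x. 1 * r \<epsilon> x + (-1) * s \<epsilon> x))"
  proof (rule net_negligible[where r="\<lambda>\<epsilon> x. 1 * r \<epsilon> x + (-1) * s \<epsilon> x", OF A(1), rotated])
    show "(\<lambda>x. 1 * r \<epsilon> x + (-1) * s \<epsilon> x) \<in> test_functions_on (cube A)" if "\<epsilon> \<in> {0<..1}" for \<epsilon>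
      using A(2)[OF that] by (intro test_functions_on_lin) auto
  qed simp
  have "S \<epsilon> (\<lambda>x. 1 * r \<epsilon> x + (-1) * s \<epsilon> x) = S \<epsilon> (r \<epsilon>) - S \<epsilon> (s \<epsilon>)" if "\<epsilon> \<in> {0<..1}" for \<epsilon>
    using net_lin[OF that, of "r \<epsilon>" A "s \<epsilon>" 1 "-1"] A(2)[OF that] by simp
  then show ?thesis
    using 1 unfolding gc_negligible_def by (auto intro: eps_negligible_dom)
qed

lemma net_functional_represents:
  assumes r: "compact_rep r u" shows "gc_represents (\<lambda>\<epsilon>. S \<epsilon> (r \<epsilon>)) (net_functional S u)"
proof (rule gc_represents_eqI)
  let ?s = "SOME r. compact_rep r u"
  have s: "compact_rep ?s u" using r by (rule someI[of "\<lambda>r. compact_rep r u"])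
  show "gc_represents (\<lambda>\<epsilon>. S \<epsilon> (?s \<epsilon>)) (net_functional S u)"
    using net_moderate[OF s] by (simp add: gc_represents_def net_functional_def)
  show "gc_negligible (\<lambda>\<epsilon>. S \<epsilon> (r \<epsilon>) - S \<epsilon> (?s \<epsilon>))" by (rule net_independent[OF r s])
qed (rule net_moderate[OF r])

lemma net_functional_add:
  assumes "u \<in> Gc" "v \<in> Gc" shows "net_functional S (u + v) = net_functional S u + net_functional S v"
proof -
  obtain r s where r: "compact_rep r u" and s: "compact_rep s v" using assms compact_rep_ex by blast
  obtain A where A: "\<And>\<epsilon>. \<epsilon> \<in> {0<..1} \<Longrightarrow> r \<epsilon> \<in> test_functions_on (cube A) \<and> s \<epsilon> \<in> test_functions_on (cube A)"
    using compact_rep_common[OF r s] by blast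
  have "gc_represents (\<lambda>\<epsilon>. S \<epsilon> (\<lambda>x. 1 * r \<epsilon> x + 1 * s \<epsilon> x)) (net_functional S u + net_functional S v)"
  proof (rule gc_represents_cong)
    show "gc_represents (\<lambda>\<epsilon>. S \<epsilon> (r \<epsilon>) + S \<epsilon> (s \<epsilon>)) (net_functional S u + net_functional S v)"
      by (intro gc_represents_add net_functional_represents r s)
    fix \<epsilon> :: real assume e: "\<epsilon> \<in> {0<..1}"
    show "S \<epsilon> (\<lambda>x. 1 * r \<epsilon> x + 1 * s \<epsilon> x) = S \<epsilon> (r \<epsilon>) + S \<epsilon> (s \<epsilon>)"
      using net_lin[OF e, of "r \<epsilon>" A "s \<epsilon>" 1 1] A[OF e] by simp
  qed
  with net_functional_represents[OF compact_rep_add[OF r s]] show ?thesis by (rule gc_represents_unique)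
qed

lemma net_functional_scale:
  assumes "u \<in> Gc" shows "net_functional S (z *\<^sub>G u) = z * net_functional S u"
proof -
  obtain r where r: "compact_rep r u" using assms compact_rep_ex by blast
  obtain A where A: "\<And>\<epsilon>. \<epsilon> \<in> {0<..1} \<Longrightarrow> r \<epsilon> \<in> test_functions_on (cube A)"
    using r unfolding compact_rep_def by blast
  obtain z' where z: "gc_represents z' z" using gc_represents_ex by blast
  have "gc_represents (\<lambda>\<epsilon>. S \<epsilon> (\<lambda>x. z' \<epsilon> * r \<epsilon> x)) (z * net_functional S u)"
  proof (rule gc_represents_cong)
    show "gc_represents (\<lambda>\<epsilon>. z' \<epsilon> * S \<epsilon> (r \<epsilon>)) (z * net_functional S u)"
      by (intro gc_represents_mult net_functional_represents r z)
    fix \<epsilon> :: real assume e: "\<epsilon> \<in> {0<..1}"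
    show "S \<epsilon> (\<lambda>x. z' \<epsilon> * r \<epsilon> x) = z' \<epsilon> * S \<epsilon> (r \<epsilon>)"
      using net_lin[OF e A[OF e] A[OF e], of "z' \<epsilon>" 0] by simp
  qed
  with net_functional_represents[OF compact_rep_scale[OF r z]] show ?thesis by (rule gc_represents_unique)
qed

text \<open>The preimage of a ball is a basic neighbourhood. For the condition on \<^term>\<open>GK K\<close> the order \<open>N\<close> of the estimate on
  a box around \<open>K\<close> costs the factor \<open>e\<^sup>N\<close> in the radius; the box is the same for all elements of
  \<^term>\<open>GK K\<close>, since these have representatives supported there.\<close>

lemma Gc_base_net_functional:
  assumes d: "0 < d"
  shows "Gc_base {w \<in> Gc. gc_abs (net_functional S w) < d}" (is "Gc_base ?W")
proof -
  let ?T = "net_functional S"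
  have W: "w \<in> ?W \<longleftrightarrow> w \<in> Gc \<and> (\<exists>b. exp (- b) < d \<and> gc_order b (?T w))" for w
    using gc_abs_less_iff[OF d] by simp
  have "gc_absorbent ?W"
    unfolding gc_absorbent_def
  proof
    fix u :: "'n gfun" assume u: "u \<in> Gc"
    obtain b0 where b0: "gc_order b0 (?T u)" using gc_order_ex by blast
    show "\<exists>a::real. \<forall>b\<le>a. \<exists>w\<in>?W. u = gc_eps_powr b *\<^sub>G w"
      \<comment> \<open>then \<open>exp (b - b0) \<le> d / e < d\<close>\<close>
    proof (intro exI[of _ "b0 + ln d - 1"] allI impI)
      fix b assume b: "b \<le> b0 + ln d - 1"
      let ?w = "gc_eps_powr (- b) *\<^sub>G u"
      have "gc_order (- b + b0) (?T ?w)"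
        unfolding net_functional_scale[OF u] by (intro gc_order_mult gc_order_eps_powr b0)
      moreover have "exp (- (- b + b0)) < d"
      proof -
        have "- (- b + b0) < ln d" using b by simp
        then show ?thesis using d by (metis exp_less_cancel_iff exp_ln)
      qed
      ultimately have "?w \<in> ?W" unfolding W using Gc_scale[OF u] by blast
      moreover have "u = gc_eps_powr b *\<^sub>G ?w" using gf_scale_eps_inverse[of "- b" u] by simp
      ultimately show "\<exists>w\<in>?W. u = gc_eps_powr b *\<^sub>G w" by blast
    qed
  qed
  moreover have "gc_balanced ?W"
    unfolding gc_balanced_def
  proof (intro allI impI, elim conjE)
    fix z u assume z: "gc_abs z \<le> 1" and u: "u \<in> ?W"
    obtain b where b: "exp (- b) < d" "gc_order b (?T u)" and uG: "u \<in> Gc" using u unfolding W by blast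
    have "- b < ln d" using b(1) d by (metis exp_less_cancel_iff exp_ln)
    \<comment> \<open>\<open>gc_abs z \<le> 1\<close> gives \<open>z\<close> every negative order, but perhaps not the order \<open>0\<close>; half of the margin in
      \<open>exp (- b) < d\<close> is given up for this\<close>
    define \<delta> where "\<delta> = (b + ln d) / 2"
    have \<delta>: "\<delta> > 0" using \<open>- b < ln d\<close> by (simp add: \<delta>_def)
    then have "gc_abs z < exp \<delta>" using z by (meson le_less_trans one_less_exp_iff)
    then obtain b' where b': "exp (- b') < exp \<delta>" "gc_order b' z" using gc_abs_less_iff[of "exp \<delta>" z] by auto
    have "gc_order (- \<delta>) z" using b' by (intro gc_order_mono[OF b'(2)]) simp
    then have "gc_order (- \<delta> + b) (?T (z *\<^sub>G u))"
      unfolding net_functional_scale[OF uG] using b(2) by (rule gc_order_mult)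
    moreover have "exp (- (- \<delta> + b)) < d"
    proof -
      have "- (- \<delta> + b) < ln d" using \<open>- b < ln d\<close> by (simp add: \<delta>_def field_simps)
      then show ?thesis using d by (metis exp_less_cancel_iff exp_ln)
    qed
    ultimately show "z *\<^sub>G u \<in> ?W" unfolding W using Gc_scale[OF uG] by blast
  qed
  moreover have "gc_convex ?W"
    unfolding gc_convex_def
  proof (intro conjI ballI allI impI)
    fix u v assume "u \<in> ?W" "v \<in> ?W"
    then obtain b b' where b: "u \<in> Gc" "exp (- b) < d" "gc_order b (?T u)" "v \<in> Gc" "exp (- b') < d" "gc_order b' (?T v)"
      unfolding W by blast
    have "gc_order (min b b') (?T (u + v))"
      unfolding net_functional_add[OF b(1,4)]
      by (intro gc_order_add) (use b gc_order_mono in auto)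
    moreover have "exp (- min b b') < d" using b by (simp add: min_def)
    ultimately show "u + v \<in> ?W" unfolding W using Gc_add[OF b(1,4)] by blast
  next
    fix b u assume "(0::real) \<le> b" "u \<in> ?W"
    then obtain b' where b': "u \<in> Gc" "exp (- b') < d" "gc_order b' (?T u)" unfolding W by blast
    have "gc_order (b + b') (?T (gc_eps_powr b *\<^sub>G u))"
      unfolding net_functional_scale[OF b'(1)] by (intro gc_order_mult gc_order_eps_powr b')
    moreover have "exp (- (b + b')) < d"
    proof -
      have "exp (- (b + b')) \<le> exp (- b')" using \<open>0 \<le> b\<close> by simp
      then show ?thesis using b'(2) by linarith
    qed
    ultimately show "gc_eps_powr b *\<^sub>G u \<in> ?W" unfolding W using Gc_scale[OF b'(1)] by blast
  qed
  moreover have "GK_nhd0 K (?W \<inter> GK K)" if K: "compact K" for K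
  proof -
    obtain A where A: "A \<ge> 0" "K \<subseteq> cube A" using compact_subset_cube[OF K] by blast
    let ?K = "cube (A + 2) :: 'n space set"
    have "A + 2 \<ge> 0" using A by simp
    from net_order[OF this] obtain j N :: nat where
      jN: "\<And>r b. (\<forall>\<epsilon>\<in>{0<..1}. r \<epsilon> \<in> test_functions_on ?K) \<Longrightarrow> (\<lambda>\<epsilon>. Cj_norm (?K \<inter> H) j (r \<epsilon>)) \<in> O[at_right 0](\<lambda>\<epsilon>. \<epsilon> powr b) \<Longrightarrow>
         (\<lambda>\<epsilon>. norm (S \<epsilon> (r \<epsilon>))) \<in> O[at_right 0](\<lambda>\<epsilon>. \<epsilon> powr (b - real N))" by blast
    have "{x :: 'n space. \<forall>i. \<bar>x $ i\<bar> < A + 2} = (\<Inter>i. {x. \<bar>x $ i\<bar> < A + 2})" by auto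
    then have "open {x :: 'n space. \<forall>i. \<bar>x $ i\<bar> < A + 2}"
      by (simp only:, intro open_INT ballI open_Collect_less continuous_intros) auto
    then have "{x :: 'n space. \<forall>i. \<bar>x $ i\<bar> < A + 2} \<subseteq> interior ?K"
      by (rule interior_maximal[rotated]) (auto simp: cube_def less_imp_le)
    moreover have "K \<subseteq> {x. \<forall>i. \<bar>x $ i\<bar> < A + 2}"
    proof
      fix x assume "x \<in> K"
      then have *: "\<bar>x $ i\<bar> \<le> A" for i using A(2) by (auto simp: cube_def)
      have "\<bar>x $ i\<bar> < A + 2" for i using *[of i] by linarith
      then show "x \<in> {x. \<forall>i. \<bar>x $ i\<bar> < A + 2}" by simp
    qed
    ultimately have "K \<subseteq> interior ?K" by blast
    moreover have "{u \<in> GK K. exp_minus (gf_val ?K j u) < d * exp (- real N)} \<subseteq> ?W \<inter> GK K"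
    proof
      fix u assume u: "u \<in> {u \<in> GK K. exp_minus (gf_val ?K j u) < d * exp (- real N)}"
      have "0 < d * exp (- real N)" using d by simp
      then obtain b s where b: "exp (- b) < d * exp (- real N)" and s: "gf_represents s u"
        and sb: "(\<lambda>\<epsilon>. Cj_norm ?K j (s \<epsilon>)) \<in> O[at_right 0](\<lambda>\<epsilon>. \<epsilon> powr b)"
        using gf_val_less[of "d * exp (- real N)" ?K j u] u by auto
      have uG: "u \<in> Gc" "gf_supp u \<subseteq> cube A" using u A(2) by (auto simp: GK_def)
      obtain r where r: "gf_represents r u" "\<forall>\<epsilon>\<in>{0<..1}. r \<epsilon> \<in> test_functions_on ?K"
        using compact_representative[OF uG(2) A(1)] by blast
      have sm: "smooth (r \<epsilon>)" "smooth (s \<epsilon>)" if "\<epsilon> \<in> {0<..1}" for \<epsilon>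
        using gf_represents_smooth[OF r(1) that] gf_represents_smooth[OF s that] by auto
      have sn: "smooth_net (\<lambda>\<epsilon> x. r \<epsilon> x - s \<epsilon> x)"
        using r(1) s by (intro smooth_net_diff) (auto simp: gf_represents_def gf_moderate_def)
      have "eps_negligible (\<lambda>\<epsilon>. Cj_norm ?K j (\<lambda>x. r \<epsilon> x - s \<epsilon> x))"
        by (rule eps_negligible_Cj_norm[OF sn gf_represents_diff[OF r(1) s]]) auto
      then have rb: "(\<lambda>\<epsilon>. Cj_norm (?K \<inter> H) j (r \<epsilon>)) \<in> O[at_right 0](\<lambda>\<epsilon>. \<epsilon> powr b)"
      proof (rule bigo_norm_cong[rotated, OF _ sb])
        fix \<epsilon> :: real assume e: "\<epsilon> \<in> {0<..1}"
        have "Cj_norm (?K \<inter> H) j (r \<epsilon>) \<le> Cj_norm ?K j (r \<epsilon>)"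
          by (rule Cj_norm_mono[OF compact_cube sm(1)[OF e]]) auto
        also have "\<dots> \<le> Cj_norm ?K j (s \<epsilon>) + Cj_norm ?K j (\<lambda>x. r \<epsilon> x - s \<epsilon> x)"
          by (rule Cj_norm_diff_le[OF compact_cube sm[OF e]])
        finally show "\<bar>Cj_norm (?K \<inter> H) j (r \<epsilon>)\<bar> \<le> \<bar>Cj_norm ?K j (s \<epsilon>)\<bar> + \<bar>Cj_norm ?K j (\<lambda>x. r \<epsilon> x - s \<epsilon> x)\<bar>"
          using Cj_norm_bounds(2)[OF compact_cube_Int sm(1)[OF e], of "A + 2" j] by linarith
      qed
      have "compact_rep r u" using r \<open>A + 2 \<ge> 0\<close> unfolding compact_rep_def by blast
      from net_functional_represents[OF this] jN[OF r(2) rb] have "gc_order (b - real N) (?T u)"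
        unfolding gc_order_def by blast
      moreover have "exp (- (b - real N)) < d"
        using b by (simp add: exp_diff exp_minus field_simps)
      ultimately show "u \<in> ?W \<inter> GK K" using W uG u by blast
    qed
    ultimately show ?thesis
      unfolding GK_nhd0_def using d by (intro exI[of _ ?K] exI[of _ j] exI[of _ "d * exp (- real N)"]) auto
  qed
  ultimately show ?thesis unfolding Gc_base_def by blast
qed

text \<open>By additivity it suffices to look at \<open>0\<close>.\<close>

lemma net_functional_continuous: "continuous_map Gc_topology gc_topology (net_functional S)"
  unfolding continuous_map_def
proof (intro conjI allI impI)
  have "gc_open UNIV" unfolding gc_open_def by (intro ballI exI[of _ "1::real"]) simp
  then have "UNIV \<subseteq> topspace gc_topology"
    using openin_subset[of gc_topology UNIV] by (simp only: openin_gc_topology)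
  then have "topspace gc_topology = UNIV" by (simp only: top.extremum_unique)
  then show "net_functional S \<in> topspace Gc_topology \<rightarrow> topspace gc_topology" by simp
  fix U assume "openin gc_topology U"
  then have U: "gc_open U" by (simp add: openin_gc_topology)
  show "openin Gc_topology {x \<in> topspace Gc_topology. net_functional S x \<in> U}"
    unfolding openin_Gc_topology topspace_Gc_topology Gc_open_def
  proof (intro conjI ballI)
    fix u assume u: "u \<in> {x \<in> Gc. net_functional S x \<in> U}"
    then obtain d where d: "d > 0" "\<And>w. gc_abs (w - net_functional S u) < d \<Longrightarrow> w \<in> U"
      using U unfolding gc_open_def by blast
    let ?W = "{w \<in> Gc. gc_abs (net_functional S w) < d}"
    have "u + w \<in> {x \<in> Gc. net_functional S x \<in> U}" if w: "w \<in> ?W" for w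
    proof -
      have "net_functional S (u + w) - net_functional S u = net_functional S w"
        using net_functional_add[of u w] u w by simp
      then have "net_functional S (u + w) \<in> U" using w by (intro d(2)) simp
      then show ?thesis using u w Gc_add by blast
    qed
    then show "\<exists>W. Gc_base W \<and> (\<forall>w\<in>W. u + w \<in> {x \<in> Gc. net_functional S x \<in> U})"
      using Gc_base_net_functional[OF d(1)] by blast
  qed blast
qed

theorem net_functional_basic: "net_functional S \<in> Gc_dual_basic"
proof -
  have "net_functional S \<in> Gc_dual"
    unfolding Gc_dual_def using net_functional_add net_functional_scale net_functional_continuous by blast
  moreover have "\<forall>\<epsilon>\<in>{0<..1}. distribution (S \<epsilon>)" using S unfolding moderate_functional_net_def by (elim conjE)
  moreover have "\<exists>(j::nat) (N::nat). \<exists>c>0. \<exists>\<eta>\<in>{0<..1}. \<forall>f\<in>test_functions_on K. \<forall>\<epsilon>\<in>{0<..\<eta>}.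
        norm (S \<epsilon> f) \<le> c * \<epsilon> powr (- real N) * Cj_norm K j f" if K: "compact K" for K
  proof -
    obtain A where A: "A \<ge> 0" "K \<subseteq> cube A" using compact_subset_cube[OF K] by blast
    obtain j N :: nat and c \<eta> where *: "c > 0" "\<eta> \<in> {0<..1}"
      "\<forall>f\<in>test_functions_on (cube A). \<forall>\<epsilon>\<in>{0<..\<eta>}. norm (S \<epsilon> f) \<le> c * \<epsilon> powr (- real N) * Cj_norm (cube A \<inter> H) j f"
      using S A(1) unfolding moderate_functional_net_def by blast
    have "norm (S \<epsilon> f) \<le> c * \<epsilon> powr (- real N) * Cj_norm K j f" if f: "f \<in> test_functions_on K" "\<epsilon> \<in> {0<..\<eta>}" for f \<epsilon>
    proof -
      have "norm (S \<epsilon> f) \<le> c * \<epsilon> powr (- real N) * Cj_norm (cube A \<inter> H) j f"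
        using *(3) f test_functions_on_mono[OF f(1) A(2)] by blast
      also have "\<dots> \<le> c * \<epsilon> powr (- real N) * Cj_norm K j f"
        using *(1) by (intro mult_left_mono Cj_norm_test_function_le[OF K f(1)]) auto
      finally show ?thesis .
    qed
    then show ?thesis using *(1,2) by blast
  qed
  moreover have "gc_represents (\<lambda>\<epsilon>. S \<epsilon> (r \<epsilon>)) (net_functional S u)"
    if h: "gf_represents r u" "compact L" "\<forall>\<epsilon>\<in>{0<..1}. r \<epsilon> \<in> test_functions_on L" for u r L
  proof (rule net_functional_represents)
    obtain A where "A \<ge> 0" "L \<subseteq> cube A" using compact_subset_cube[OF h(2)] by blast
    then show "compact_rep r u" unfolding compact_rep_def using h test_functions_on_mono by blast
  qed
  ultimately show ?thesis unfolding Gc_dual_basic_def by blast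
qed

text \<open>If the support of \<open>u\<close> misses \<open>H\<close>, then a representative is negligible on \<open>H\<close>, which is all that the
  estimate of the net sees.\<close>

theorem net_functional_supp: "functional_supp (net_functional S) \<subseteq> H"
proof -
  have "functional_zero_on (net_functional S) (- H)"
    unfolding functional_zero_on_def
  proof (intro ballI impI)
    fix u :: "'n gfun" assume u: "u \<in> Gc" "gf_supp u \<subseteq> - H"
    obtain r where r: "compact_rep r u" using u compact_rep_ex by blast
    then obtain A where A: "A \<ge> 0" "\<And>\<epsilon>. \<epsilon> \<in> {0<..1} \<Longrightarrow> r \<epsilon> \<in> test_functions_on (cube A)"
      unfolding compact_rep_def by blast
    have nn: "gf_negligible_on (- gf_supp u) r" using r by (intro gf_negligible_off_supp) (simp add: compact_rep_def)
    have "gc_negligible (\<lambda>\<epsilon>. S \<epsilon> (r \<epsilon>))"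
      by (rule net_negligible[where r=r, OF A(1) A(2) nn]) (use u in auto)
    then have "gc_represents (\<lambda>\<epsilon>. S \<epsilon> (r \<epsilon>)) 0"
      by (intro gc_represents_eqI[OF gc_represents_zero] net_moderate[OF r]) simp
    with net_functional_represents[OF r] show "net_functional S u = 0" by (rule gc_represents_unique)
  qed
  moreover have "open (- H)"
    using S unfolding moderate_functional_net_def by (elim conjE) (rule open_Compl)
  ultimately show ?thesis unfolding functional_supp_def by blast
qed

end

section \<open>Evolution operators\<close>

lemma eps_negligible_imp_moderate: "eps_negligible f \<Longrightarrow> eps_moderate f"
  unfolding eps_moderate_def using eps_negligible_imp_bigo by blast

lemma eps_moderate_power: "eps_moderate f \<Longrightarrow> eps_moderate (\<lambda>\<epsilon>. f \<epsilon> ^ n)"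
  by (induction n) (auto intro: eps_moderate_mult)

lemma eps_negligible_root:
  assumes n: "0 < n" and \<mu>: "eps_negligible \<mu>" "\<And>\<epsilon>. 0 \<le> \<mu> \<epsilon>"
  shows "eps_negligible (\<lambda>\<epsilon>. root n (\<mu> \<epsilon>))"
  unfolding eps_negligible_def
proof
  fix q :: nat
  have "\<mu> \<in> O[at_right 0](\<lambda>\<epsilon>. \<epsilon> powr real (n * q))" using \<mu>(1) unfolding eps_negligible_def by blast
  then obtain C where C: "C > 0" "eventually (\<lambda>\<epsilon>. norm (\<mu> \<epsilon>) \<le> C * norm (\<epsilon> powr real (n * q))) (at_right 0)"
    by (elim landau_o.bigE)
  show "(\<lambda>\<epsilon>. root n (\<mu> \<epsilon>)) \<in> O[at_right 0](\<lambda>\<epsilon>. \<epsilon> powr real q)"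
  proof (rule bigoI[of _ "root n C"], rule eventually_mono[OF eventually_conj[OF C(2) ev_eps]])
    fix \<epsilon> :: real assume e: "norm (\<mu> \<epsilon>) \<le> C * norm (\<epsilon> powr real (n * q)) \<and> \<epsilon> \<in> {0<..1}"
    then have "(\<epsilon> powr real q) ^ n = \<epsilon> powr real (n * q)" by (subst powr_power) auto
    then have "\<mu> \<epsilon> \<le> C * (\<epsilon> powr real q) ^ n" using e \<mu>(2)[of \<epsilon>] by simp
    then have "root n (\<mu> \<epsilon>) \<le> root n (C * (\<epsilon> powr real q) ^ n)" using n by simp
    also have "\<dots> = root n C * \<epsilon> powr real q" using n by (simp add: real_root_mult real_root_power_cancel)
    finally show "norm (root n (\<mu> \<epsilon>)) \<le> root n C * norm (\<epsilon> powr real q)"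
      using n \<mu>(2)[of \<epsilon>] by simp
  qed
qed

lemma eps_negligible_exp: "eps_negligible (\<lambda>\<epsilon>. exp (- (1 / \<epsilon>)))"
  unfolding eps_negligible_def
proof
  fix q :: nat
  have "(flat_exp (monom 1 q) \<longlongrightarrow> 0) (at_right 0)"
    using flat_exp_tendsto_0 by (rule tendsto_within_subset) simp
  then have "eventually (\<lambda>\<epsilon>. dist (flat_exp (monom 1 q) \<epsilon>) 0 < 1) (at_right 0)" by (rule tendstoD) simp
  then show "(\<lambda>\<epsilon>::real. exp (- (1 / \<epsilon>))) \<in> O[at_right 0](\<lambda>\<epsilon>. \<epsilon> powr real q)"
  proof (intro bigoI[of _ 1], elim eventually_mono[OF eventually_conj[OF _ ev_eps]])
    fix \<epsilon> :: real assume e: "dist (flat_exp (monom 1 q) \<epsilon>) 0 < 1 \<and> \<epsilon> \<in> {0<..1}"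
    then have pos: "0 < \<epsilon>" by simp
    with e have "(1 / \<epsilon>) ^ q * exp (- (1 / \<epsilon>)) < 1" by (simp add: flat_exp_def poly_monom)
    then have "exp (- (1 / \<epsilon>)) < \<epsilon> ^ q" using e by (simp add: power_divide field_simps)
    then show "norm (exp (- (1 / \<epsilon>))) \<le> 1 * norm (\<epsilon> powr real q)" using e by (simp add: powr_realpow)
  qed
qed

text \<open>With a root \<open>\<rho>\<close> of sufficiently high order of a positive negligible net above \<open>\<nu>\<close>, take \<open>M\<close> about
  \<open>\<rho>\<^sup>-\<^sup>2\<close>: both \<open>\<rho>\<close> and \<open>\<rho>\<^sup>2\<^sup>m\<^sup>+\<^sup>2 M\<^sup>m\<close> are negligible. The term \<open>e\<^sup>-\<^sup>1\<^sup>/\<^sup>\<epsilon>\<close> covers the case that \<open>\<nu>\<close> vanishes.\<close>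

lemma superpolynomial_choice:
  assumes \<nu>: "eps_negligible \<nu>" "\<And>\<epsilon>. 0 \<le> \<nu> \<epsilon>"
  obtains M :: "real \<Rightarrow> nat" where "\<And>\<epsilon>. 0 < M \<epsilon>" "eps_negligible (\<lambda>\<epsilon>. 1 / sqrt (M \<epsilon>))"
    "eps_negligible (\<lambda>\<epsilon>. \<nu> \<epsilon> * (pi * M \<epsilon>) ^ m)"
proof -
  define \<mu> where "\<mu> \<epsilon> = \<nu> \<epsilon> + exp (- (1 / \<epsilon>))" for \<epsilon>
  define \<rho> where "\<rho> \<epsilon> = root (2 * m + 2) (\<mu> \<epsilon>)" for \<epsilon>
  define M where "M \<epsilon> = nat \<lceil>1 / (\<rho> \<epsilon>)\<^sup>2\<rceil>" for \<epsilon>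
  have \<mu>0: "0 < \<mu> \<epsilon>" for \<epsilon> using \<nu>(2)[of \<epsilon>] by (simp add: \<mu>_def add_nonneg_pos)
  have \<rho>0: "0 < \<rho> \<epsilon>" for \<epsilon> using \<mu>0[of \<epsilon>] by (simp add: \<rho>_def)
  have \<rho>n: "eps_negligible \<rho>" unfolding \<rho>_def[abs_def]
    by (rule eps_negligible_root) (use \<nu> eps_negligible_add eps_negligible_exp in \<open>auto simp: \<mu>_def[abs_def] add_nonneg_nonneg\<close>)
  have M0: "0 < M \<epsilon>" for \<epsilon> using \<rho>0[of \<epsilon>] by (simp add: M_def)
  have M1: "1 / (\<rho> \<epsilon>)\<^sup>2 \<le> M \<epsilon>" for \<epsilon> unfolding M_def by (rule real_nat_ceiling_ge)
  have M2: "M \<epsilon> \<le> 1 / (\<rho> \<epsilon>)\<^sup>2 + 1" for \<epsilon>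
  proof -
    have "0 \<le> 1 / (\<rho> \<epsilon>)\<^sup>2" by simp
    then show ?thesis unfolding M_def by linarith
  qed
  show ?thesis
  proof (rule that[of M])
    show "eps_negligible (\<lambda>\<epsilon>. 1 / sqrt (M \<epsilon>))"
    proof (rule eps_negligible_dom[OF \<rho>n])
      fix \<epsilon> :: real
      have "1 / \<rho> \<epsilon> \<le> sqrt (M \<epsilon>)" by (rule real_le_rsqrt) (use M1[of \<epsilon>] in \<open>simp add: power_divide\<close>)
      then have "1 \<le> sqrt (M \<epsilon>) * \<rho> \<epsilon>" using \<rho>0[of \<epsilon>] by (simp add: field_simps)
      then show "\<bar>1 / sqrt (M \<epsilon>)\<bar> \<le> \<bar>\<rho> \<epsilon>\<bar>" using \<rho>0[of \<epsilon>] M0[of \<epsilon>] by (simp add: field_simps)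
    qed
    have "eps_negligible (\<lambda>\<epsilon>. (pi ^ m * (1 + \<rho> \<epsilon> ^ 2) ^ m * \<rho> \<epsilon>) * \<rho> \<epsilon>)"
      using \<rho>n eps_negligible_imp_moderate[OF \<rho>n]
      by (intro eps_negligible_mult eps_moderate_mult eps_moderate_power eps_moderate_add) auto
    then show "eps_negligible (\<lambda>\<epsilon>. \<nu> \<epsilon> * (pi * M \<epsilon>) ^ m)"
    proof (rule eps_negligible_dom)
      fix \<epsilon> :: real
      let ?r = "\<rho> \<epsilon>"
      have r: "?r > 0" by (rule \<rho>0)
      have "\<mu> \<epsilon> = ?r ^ (2 * m + 2)" unfolding \<rho>_def
        by (rule sym, rule real_root_pow_pos2) (use \<mu>0[of \<epsilon>] in auto)
      moreover have "\<nu> \<epsilon> \<le> \<mu> \<epsilon>" by (simp add: \<mu>_def)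
      ultimately have "\<nu> \<epsilon> \<le> ?r ^ (2 * m + 2)" by simp
      moreover have "(pi * M \<epsilon>) ^ m \<le> (pi * (1 / ?r\<^sup>2 + 1)) ^ m"
        using M2[of \<epsilon>] by (intro power_mono mult_left_mono) auto
      ultimately have "\<nu> \<epsilon> * (pi * M \<epsilon>) ^ m \<le> ?r ^ (2 * m + 2) * (pi * (1 / ?r\<^sup>2 + 1)) ^ m"
        using \<nu>(2)[of \<epsilon>] r by (intro mult_mono) auto
      also have "\<dots> = (pi ^ m * (1 + ?r ^ 2) ^ m * ?r) * ?r"
      proof -
        have "?r ^ (2 * m + 2) = (?r\<^sup>2) ^ m * (?r * ?r)" by (simp add: power_add power_mult power2_eq_square)
        moreover have "(?r\<^sup>2) ^ m * (pi * (1 / ?r\<^sup>2 + 1)) ^ m = pi ^ m * (1 + ?r\<^sup>2) ^ m"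
          unfolding power_mult_distrib[symmetric] using r by (intro arg_cong[where f="\<lambda>x. x ^ m"]) (simp add: field_simps)
        ultimately show ?thesis by (simp only: mult_ac)
      qed
      finally show "\<bar>\<nu> \<epsilon> * (pi * M \<epsilon>) ^ m\<bar> \<le> \<bar>(pi ^ m * (1 + ?r ^ 2) ^ m * ?r) * ?r\<bar>"
        using \<nu>(2)[of \<epsilon>] by (simp add: abs_mult)
    qed
  qed (rule M0)
qed

lemma eps_negligible_eventually_le:
  assumes f: "eps_negligible f" and C: "0 < C"
  shows "eventually (\<lambda>\<epsilon>. \<bar>f \<epsilon>\<bar> \<le> C * \<epsilon> powr real q) (at_right 0)"
proof -
  have "f \<in> O[at_right 0](\<lambda>\<epsilon>. \<epsilon> powr real (Suc q))" using f unfolding eps_negligible_def by blast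
  then obtain K where K: "K > 0" "eventually (\<lambda>\<epsilon>. norm (f \<epsilon>) \<le> K * norm (\<epsilon> powr real (Suc q))) (at_right 0)"
    by (elim landau_o.bigE)
  have "0 < C / K" using K C by simp
  from eventually_conj[OF K(2) eventually_small[OF this]] show ?thesis
  proof (rule eventually_mono)
    fix \<epsilon> assume e: "norm (f \<epsilon>) \<le> K * norm (\<epsilon> powr real (Suc q)) \<and> \<epsilon> \<in> {0<..C / K}"
    then have pos: "0 < \<epsilon>" by simp
    have "\<epsilon> powr real (Suc q) = \<epsilon> * \<epsilon> powr real q" using pos by (simp add: powr_add)
    then have "\<bar>f \<epsilon>\<bar> \<le> (K * \<epsilon>) * \<epsilon> powr real q" using e pos by (simp add: abs_mult mult.assoc)
    also have "\<dots> \<le> C * \<epsilon> powr real q" using e K by (intro mult_right_mono) (auto simp: field_simps)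
    finally show "\<bar>f \<epsilon>\<bar> \<le> C * \<epsilon> powr real q" .
  qed
qed

lemma eps_moderate_eventually_le:
  assumes "eps_moderate f"
  obtains C and N :: nat where "C > 0" "eventually (\<lambda>\<epsilon>. \<bar>f \<epsilon>\<bar> \<le> C * \<epsilon> powr (- real N)) (at_right 0)"
proof -
  obtain N :: nat where "f \<in> O[at_right 0](\<lambda>\<epsilon>. \<epsilon> powr (- real N))" using assms unfolding eps_moderate_def by blast
  then obtain C where C: "C > 0" "eventually (\<lambda>\<epsilon>. norm (f \<epsilon>) \<le> C * norm (\<epsilon> powr (- real N))) (at_right 0)"
    by (elim landau_o.bigE)
  show ?thesis by (rule that[OF C(1)], rule eventually_mono[OF C(2)]) simp
qed

text \<open>The inverse is moderate, and the product of representatives tends to \<open>1\<close>.\<close>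

lemma invertible_lower_bound:
  assumes b: "b dvd 1" and r: "gc_represents r b"
  obtains N :: nat where "eventually (\<lambda>\<epsilon>. \<epsilon> powr real N \<le> norm (r \<epsilon>)) (at_right 0)"
proof -
  obtain z where z: "1 = b * z" using b by (elim dvdE)
  obtain s where s: "gc_represents s z" using gc_represents_ex by blast
  have "gc_represents (\<lambda>\<epsilon>. r \<epsilon> * s \<epsilon>) 1" unfolding z by (rule gc_represents_mult[OF r s])
  from gc_represents_diff[OF this gc_represents_one] have "eps_negligible (\<lambda>\<epsilon>. norm (r \<epsilon> * s \<epsilon> - 1))"
    by (simp add: gc_negligible_def)
  then have 1: "eventually (\<lambda>\<epsilon>. \<bar>norm (r \<epsilon> * s \<epsilon> - 1)\<bar> \<le> 1 / 2 * \<epsilon> powr real 0) (at_right 0)"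
    by (rule eps_negligible_eventually_le) simp
  have "eps_moderate (\<lambda>\<epsilon>. norm (s \<epsilon>))" using s by (simp add: gc_represents_def gc_moderate_def)
  then obtain C and N :: nat where C: "C > 0" "eventually (\<lambda>\<epsilon>. \<bar>norm (s \<epsilon>)\<bar> \<le> C * \<epsilon> powr (- real N)) (at_right 0)"
    by (rule eps_moderate_eventually_le)
  have "0 < 1 / (2 * C)" using C by simp
  note ev = eventually_conj[OF eventually_conj[OF 1 C(2)] eventually_small[OF this]]
  show ?thesis
  proof (rule that[of "Suc N"], rule eventually_mono[OF ev])
    fix \<epsilon> assume e: "(\<bar>norm (r \<epsilon> * s \<epsilon> - 1)\<bar> \<le> 1 / 2 * \<epsilon> powr real 0 \<and> \<bar>norm (s \<epsilon>)\<bar> \<le> C * \<epsilon> powr (- real N)) \<and> \<epsilon> \<in> {0<..1 / (2 * C)}"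
    then have pos: "\<epsilon> > 0" by simp
    have "norm (1 :: complex) \<le> norm (r \<epsilon> * s \<epsilon>) + norm (r \<epsilon> * s \<epsilon> - 1)"
      by (metis norm_minus_commute norm_triangle_sub)
    then have "1 / 2 \<le> norm (r \<epsilon>) * norm (s \<epsilon>)" using e pos by (simp add: norm_mult)
    also have "\<dots> \<le> norm (r \<epsilon>) * (C * \<epsilon> powr (- real N))" using e by (intro mult_left_mono) auto
    finally have "1 / 2 * \<epsilon> powr real N \<le> norm (r \<epsilon>) * (C * \<epsilon> powr (- real N)) * \<epsilon> powr real N"
      by (rule mult_right_mono) simp
    also have "\<dots> = norm (r \<epsilon>) * C" using pos by (simp add: powr_minus field_simps)
    finally have 2: "\<epsilon> powr real N \<le> 2 * C * norm (r \<epsilon>)" by (simp add: mult_ac)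
    have "\<epsilon> powr real (Suc N) = \<epsilon> * \<epsilon> powr real N" using pos by (simp add: powr_add)
    also have "\<dots> \<le> 1 / (2 * C) * (2 * C * norm (r \<epsilon>))" using 2 e pos C by (intro mult_mono) auto
    finally show "\<epsilon> powr real (Suc N) \<le> norm (r \<epsilon>)" using C by simp
  qed
qed

lemma freq_le:
  assumes "0 < B" "k \<in> freq_index M" shows "\<bar>freq B k i\<bar> \<le> pi / B * M"
proof (cases "i = last_index")
  case False
  then have "k i \<in> {..<M} \<times> {..<M}" using assms(2) by (auto simp: freq_index_def PiE_iff)
  then have "\<bar>real (fst (k i)) - real (snd (k i))\<bar> \<le> M" by (auto simp: mem_Times_iff)
  then have "pi / B * \<bar>real (fst (k i)) - real (snd (k i))\<bar> \<le> pi / B * M"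
    using assms(1) by (intro mult_left_mono) auto
  then show ?thesis using False assms(1) by (simp add: freq_def abs_mult)
qed (use assms in simp)

text \<open>If the coefficient of \<open>\<zeta>\<^sub>n\<^sup>d\<close> is a constant up to small terms, these small terms cannot interfere as long
  as the frequencies remain below \<open>R\<close>.\<close>

lemma coeff_slice_poly_ge:
  fixes a :: "('n::{finite,linorder} \<Rightarrow> nat) \<Rightarrow> complex"
  defines "\<alpha>\<^sub>0 d \<equiv> (\<lambda>_. 0)(last_index := d)"
  assumes d: "\<alpha>\<^sub>0 d \<in> mi_upto m" and R: "1 \<le> R" "\<And>i. \<bar>\<xi> i\<bar> \<le> R"
  shows "norm (a (\<alpha>\<^sub>0 d)) - (\<Sum>\<alpha>\<in>{\<alpha> \<in> mi_upto m. \<alpha> last_index = d \<and> \<alpha> \<noteq> \<alpha>\<^sub>0 d}. norm (a \<alpha>)) * R ^ m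
    \<le> norm (coeff (slice_poly m a \<xi>) d)"
proof -
  let ?F = "{\<alpha> \<in> mi_upto m. \<alpha> last_index = d \<and> \<alpha> \<noteq> \<alpha>\<^sub>0 d}" and ?I = "UNIV - {last_index :: 'n}"
  let ?c = "\<lambda>\<alpha>. a \<alpha> * (\<Prod>i\<in>?I. complex_of_real (\<xi> i) ^ \<alpha> i)"
  have fin: "finite ?F" using finite_mi_upto[of m] by (rule finite_subset[rotated]) auto
  have "coeff (slice_poly m a \<xi>) d = (\<Sum>\<alpha>\<in>mi_upto m. if \<alpha> last_index = d then ?c \<alpha> else 0)"
    by (simp add: slice_poly_def coeff_sum)
  also have "\<dots> = (\<Sum>\<alpha>\<in>{\<alpha> \<in> mi_upto m. \<alpha> last_index = d}. ?c \<alpha>)"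
    by (rule sum.inter_filter[symmetric]) (rule finite_mi_upto)
  also have "{\<alpha> \<in> mi_upto m. \<alpha> last_index = d} = insert (\<alpha>\<^sub>0 d) ?F" using d by (auto simp: \<alpha>\<^sub>0_def)
  also have "(\<Sum>\<alpha>\<in>insert (\<alpha>\<^sub>0 d) ?F. ?c \<alpha>) = ?c (\<alpha>\<^sub>0 d) + (\<Sum>\<alpha>\<in>?F. ?c \<alpha>)"
    by (rule sum.insert[OF fin]) simp
  also have "?c (\<alpha>\<^sub>0 d) = a (\<alpha>\<^sub>0 d)" by (simp add: \<alpha>\<^sub>0_def)
  finally have eq: "coeff (slice_poly m a \<xi>) d = a (\<alpha>\<^sub>0 d) + (\<Sum>\<alpha>\<in>?F. ?c \<alpha>)" .
  have "norm (\<Sum>\<alpha>\<in>?F. ?c \<alpha>) \<le> (\<Sum>\<alpha>\<in>?F. norm (a \<alpha>) * R ^ m)"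
  proof (rule sum_norm_le)
    fix \<alpha> assume "\<alpha> \<in> ?F"
    then have "mi_order \<alpha> \<le> m" by (simp add: mi_upto_def)
    have "norm (\<Prod>i\<in>?I. complex_of_real (\<xi> i) ^ \<alpha> i) = (\<Prod>i\<in>?I. \<bar>\<xi> i\<bar> ^ \<alpha> i)"
      by (simp add: prod_norm[symmetric] norm_power)
    also have "\<dots> \<le> (\<Prod>i\<in>?I. R ^ \<alpha> i)" using R by (intro prod_mono) (auto intro: power_mono)
    also have "\<dots> = R ^ (\<Sum>i\<in>?I. \<alpha> i)" by (simp add: power_sum)
    also have "\<dots> \<le> R ^ m"
    proof (rule power_increasing[OF _ R(1)])
      have "(\<Sum>i\<in>?I. \<alpha> i) \<le> mi_order \<alpha>" unfolding mi_order_def by (rule sum_mono2) auto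
      then show "(\<Sum>i\<in>?I. \<alpha> i) \<le> m" using \<open>mi_order \<alpha> \<le> m\<close> by simp
    qed
    finally show "norm (?c \<alpha>) \<le> norm (a \<alpha>) * R ^ m" unfolding norm_mult by (rule mult_left_mono) simp
  qed
  also have "\<dots> = (\<Sum>\<alpha>\<in>?F. norm (a \<alpha>)) * R ^ m" by (simp add: sum_distrib_right)
  finally show ?thesis unfolding eq
    using norm_triangle_ineq4[of "a (\<alpha>\<^sub>0 d) + (\<Sum>\<alpha>\<in>?F. ?c \<alpha>)" "\<Sum>\<alpha>\<in>?F. ?c \<alpha>"] by simp
qed

lemma compact_rep_transpose:
  fixes a :: "('n::{finite,linorder} \<Rightarrow> nat) \<Rightarrow> gcomplex"
  assumes a: "\<And>\<alpha>. mi_order \<alpha> \<le> m \<Longrightarrow> gc_represents (a' \<alpha>) (a \<alpha>)" and r: "compact_rep r u"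
  shows "compact_rep (\<lambda>\<epsilon>. transpose_fun m (\<lambda>\<alpha>. a' \<alpha> \<epsilon>) (r \<epsilon>)) (transpose_op m a u)"
proof -
  obtain A where A: "A \<ge> 0" "\<forall>\<epsilon>\<in>{0<..1}. r \<epsilon> \<in> test_functions_on (cube A)" and ru: "gf_represents r u"
    using r unfolding compact_rep_def by blast
  have "gf_represents (\<lambda>\<epsilon>. transpose_fun m (\<lambda>\<alpha>. a' \<alpha> \<epsilon>) (r \<epsilon>)) (transpose_op m a u)"
    unfolding transpose_fun_def[abs_def] transpose_op_def
    by (intro gf_represents_sum finite_mi_upto gf_represents_scale gc_represents_mult gc_represents_minus_one_power
        gf_represents_D ru a) (simp add: mi_upto_def)
  moreover have "transpose_fun m (\<lambda>\<alpha>. a' \<alpha> \<epsilon>) (r \<epsilon>) \<in> test_functions_on (cube A)" if e: "\<epsilon> \<in> {0<..1}" for \<epsilon>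
  proof -
    have t: "multi_deriv \<alpha> (r \<epsilon>) \<in> test_functions_on (cube A)" for \<alpha>
      using A(2) e by (intro test_functions_on_multi_deriv compact_imp_closed compact_cube) auto
    have "(\<lambda>x. \<Sum>\<alpha>\<in>F. w \<alpha> * ((- \<i>) ^ mi_order \<alpha> * multi_deriv \<alpha> (r \<epsilon>) x)) \<in> test_functions_on (cube A)"
      if "finite F" for F w
      using that
    proof (induction F rule: finite_induct)
      case empty
      show ?case by (simp add: test_functions_on_def)
    next
      case (insert \<alpha> F)
      from test_functions_on_lin[OF t[of \<alpha>] insert.IH, of "w \<alpha> * (- \<i>) ^ mi_order \<alpha>" 1] insert.hyps
      show ?case by (simp add: mult.assoc)
    qed
    from this[OF finite_mi_upto] show ?thesis unfolding transpose_fun_def[abs_def] .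
  qed
  ultimately show ?thesis unfolding compact_rep_def using A(1) by blast
qed

lemma gf_dirac_represents: "gf_represents r u \<Longrightarrow> gc_represents (\<lambda>\<epsilon>. r \<epsilon> 0) (gf_dirac u)"
proof -
  assume "gf_represents r u"
  then have r: "gf_rel r r" "u = abs_gfun r" by (auto simp: gf_represents_def gf_rel_refl_iff)
  from gf_dirac.rsp[unfolded rel_fun_def, rule_format, OF r(1)] gf_dirac.abs_eq[OF r(1)] r(2)
  show ?thesis by (simp add: gc_represents_def gc_rel_refl_iff)
qed

text \<open>The data for each \<open>\<epsilon>\<close>: box half-width \<open>1/\<epsilon>\<close>, which exceeds every compact set eventually while all its
  powers are moderate, and the superpolynomial number \<open>M\<^sub>\<epsilon>\<close> of frequencies that belongs to the net \<open>\<nu>\<close> of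
  the nonconstant terms in the coefficient of \<open>\<zeta>\<^sub>n\<^sup>d\<close>.\<close>

theorem theorem2p10:
  fixes a :: "('n::{finite,linorder} \<Rightarrow> nat) \<Rightarrow> gcomplex"
    and m :: nat
    and a' :: "('n \<Rightarrow> nat) \<Rightarrow> real \<Rightarrow> complex"
    and c c\<^sub>0 s \<epsilon>\<^sub>0 :: real
    and \<omega> :: "real \<Rightarrow> real"
  assumes repr: "\<And>\<alpha>. mi_order \<alpha> \<le> m \<Longrightarrow> gc_represents (a' \<alpha>) (a \<alpha>)"
    and c: "c < 0"
    and \<omega>: "c\<^sub>0 > 0" "s > 0"
      "\<And>\<epsilon>. \<epsilon> \<in> {0<..1} \<Longrightarrow> c\<^sub>0 * \<epsilon> powr s \<le> \<omega> \<epsilon> \<and> \<omega> \<epsilon> \<le> ln (1 / \<epsilon>) + 1"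
    and \<epsilon>\<^sub>0: "\<epsilon>\<^sub>0 > 0"
    and nonzero: "\<And>\<epsilon> \<zeta>. \<epsilon> \<in> {0<..1} \<Longrightarrow> \<epsilon> \<le> \<epsilon>\<^sub>0 \<Longrightarrow>
      (\<And>i. i \<noteq> last_index \<Longrightarrow> \<zeta> $ i \<in> \<real>) \<Longrightarrow> Im (\<zeta> $ last_index) < c * \<omega> \<epsilon> \<Longrightarrow>
      poly_value m (\<lambda>\<alpha>. a' \<alpha> \<epsilon>) \<zeta> \<noteq> 0"
    and invertible: "\<exists>b. b dvd 1 \<and> last_coeff m a (last_degree m a) = const_coeff b"
  shows "evolution_operator m a {x :: 'n space. x $ last_index \<ge> 0}"
proof -
  let ?H = "{x :: 'n space. x $ last_index \<ge> 0}"
  define d where "d = last_degree m a"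
  define \<alpha>\<^sub>0 :: "'n \<Rightarrow> nat" where "\<alpha>\<^sub>0 = (\<lambda>_. 0)(last_index := d)"
  define F where "F = {\<alpha> \<in> mi_upto m. \<alpha> last_index = d \<and> \<alpha> \<noteq> \<alpha>\<^sub>0}"
  define \<nu> where "\<nu> \<epsilon> = (\<Sum>\<alpha>\<in>F. norm (a' \<alpha> \<epsilon>))" for \<epsilon>
  define n where "n = card (UNIV - {last_index :: 'n})"
  obtain b where b: "b dvd 1" "last_coeff m a d = const_coeff b" using invertible unfolding d_def by blast
  have "b \<noteq> 0" using b(1) by auto
  then have \<alpha>\<^sub>0: "\<alpha>\<^sub>0 \<in> mi_upto m" "a \<alpha>\<^sub>0 = b"
    using fun_cong[OF b(2), of "\<lambda>_. 0"] by (auto simp: last_coeff_def const_coeff_def \<alpha>\<^sub>0_def split: if_splits)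
  have aF: "a \<alpha> = 0" if "\<alpha> \<in> F" for \<alpha>
  proof -
    have "\<alpha>(last_index := 0) \<noteq> (\<lambda>_. 0)"
    proof
      assume "\<alpha>(last_index := 0) = (\<lambda>_. 0)"
      then have "(\<alpha>(last_index := 0))(last_index := d) = \<alpha>\<^sub>0" by (simp only: \<alpha>\<^sub>0_def)
      then show False using that by (auto simp: F_def)
    qed
    then show ?thesis
      using fun_cong[OF b(2), of "\<alpha>(last_index := 0)"] that
      by (auto simp: last_coeff_def const_coeff_def F_def split: if_splits)
  qed
  have fin: "finite F" unfolding F_def using finite_mi_upto[of m] by (rule finite_subset[rotated]) auto
  have "eps_negligible (\<lambda>\<epsilon>. norm (a' \<alpha> \<epsilon>))" if "\<alpha> \<in> F" for \<alpha>
    using gc_represents_diff[OF repr[of \<alpha>] gc_represents_zero[folded aF[OF that]]] that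
    by (simp add: F_def mi_upto_def gc_negligible_def)
  then have \<nu>: "eps_negligible \<nu>" unfolding \<nu>_def[abs_def] using fin by (intro eps_negligible_sum)
  obtain M :: "real \<Rightarrow> nat" where M: "\<And>\<epsilon>. 0 < M \<epsilon>" "eps_negligible (\<lambda>\<epsilon>. 1 / sqrt (M \<epsilon>))" "eps_negligible (\<lambda>\<epsilon>. \<nu> \<epsilon> * (pi * M \<epsilon>) ^ m)"
    by (rule superpolynomial_choice[OF \<nu>, of m]) (auto simp: \<nu>_def sum_nonneg)
  obtain N :: nat where N: "eventually (\<lambda>\<epsilon>. \<epsilon> powr real N \<le> norm (a' \<alpha>\<^sub>0 \<epsilon>)) (at_right 0)"
    using invertible_lower_bound[OF b(1), of "a' \<alpha>\<^sub>0"] repr[of \<alpha>\<^sub>0] \<alpha>\<^sub>0 by (auto simp: mi_upto_def)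
  define P where "P \<epsilon> = slice_poly m (\<lambda>\<alpha>. a' \<alpha> \<epsilon>)" for \<epsilon>
  define S where "S \<epsilon> = approx_solution (1 / \<epsilon>) (M \<epsilon>) (P \<epsilon>)" for \<epsilon>
  \<comment> \<open>At all frequencies below the cut-off, the nonconstant terms in the coefficient of \<open>\<zeta>\<^sub>n\<^sup>d\<close> are dominated by
    the invertible constant.\<close>
  have small: "eventually (\<lambda>\<epsilon>. \<bar>\<nu> \<epsilon> * (pi * M \<epsilon>) ^ m\<bar> \<le> 1 / 2 * \<epsilon> powr real N) (at_right 0)"
    by (rule eps_negligible_eventually_le[OF M(3)]) simp
  have coeff: "eventually (\<lambda>\<epsilon>. \<forall>k\<in>freq_index (M \<epsilon>). 1 / 2 * \<epsilon> powr real N \<le> norm (coeff (P \<epsilon> (freq (1 / \<epsilon>) k)) d)) (at_right 0)"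
  proof (rule eventually_mono[OF eventually_conj[OF eventually_conj[OF N small] ev_eps]], intro ballI)
    fix \<epsilon> and k :: "'n \<Rightarrow> nat \<times> nat"
    assume e: "(\<epsilon> powr real N \<le> norm (a' \<alpha>\<^sub>0 \<epsilon>) \<and> \<bar>\<nu> \<epsilon> * (pi * M \<epsilon>) ^ m\<bar> \<le> 1 / 2 * \<epsilon> powr real N) \<and> \<epsilon> \<in> {0<..1}"
      and k: "k \<in> freq_index (M \<epsilon>)"
    have "1 * 1 \<le> pi * real (M \<epsilon>)" using pi_gt3 M(1)[of \<epsilon>] by (intro mult_mono) auto
    moreover have "\<bar>freq (1 / \<epsilon>) k i\<bar> \<le> pi * M \<epsilon>" for i
    proof -
      have "\<bar>freq (1 / \<epsilon>) k i\<bar> \<le> pi / (1 / \<epsilon>) * M \<epsilon>" by (rule freq_le[OF _ k]) (use e in auto)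
      also have "\<dots> \<le> pi * M \<epsilon>" using e by (intro mult_right_mono) auto
      finally show ?thesis .
    qed
    ultimately have "norm (a' \<alpha>\<^sub>0 \<epsilon>) - \<nu> \<epsilon> * (pi * M \<epsilon>) ^ m \<le> norm (coeff (P \<epsilon> (freq (1 / \<epsilon>) k)) d)"
      using coeff_slice_poly_ge[of d m "pi * M \<epsilon>" "freq (1 / \<epsilon>) k" "\<lambda>\<alpha>. a' \<alpha> \<epsilon>"] \<alpha>\<^sub>0(1)
      by (simp add: P_def \<nu>_def F_def \<alpha>\<^sub>0_def)
    then show "1 / 2 * \<epsilon> powr real N \<le> norm (coeff (P \<epsilon> (freq (1 / \<epsilon>) k)) d)" using e by linarith
  qed
  have roots: "- (- c * (ln (1 / \<epsilon>) + 1)) \<le> Im z" if e: "\<epsilon> \<in> {0<..1}" "\<epsilon> \<le> \<epsilon>\<^sub>0" and z: "poly (P \<epsilon> \<xi>) z = 0" for \<epsilon> \<xi> z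
  proof -
    have "\<not> Im z < c * \<omega> \<epsilon>"
      using nonzero[OF e, of "\<chi> i. if i = last_index then z else complex_of_real (\<xi> i)"] z
      by (auto simp: P_def poly_slice_poly)
    moreover have "c * (ln (1 / \<epsilon>) + 1) \<le> c * \<omega> \<epsilon>" using \<omega>(3)[OF e(1)] c by (intro mult_left_mono_neg) auto
    ultimately show ?thesis by simp
  qed
  have net: "moderate_functional_net ?H S"
    unfolding moderate_functional_net_def
  proof (intro conjI ballI allI impI)
    show "closed ?H" by (intro closed_Collect_le continuous_intros)
    show "distribution (S \<epsilon>)" if "\<epsilon> \<in> {0<..1}" for \<epsilon>
      unfolding S_def using that by (intro distribution_approx_solution) auto
    fix A :: real assume A: "0 \<le> A"
    \<comment> \<open>The roots lie above \<open>-\<gamma>\<close> with \<open>\<gamma> = -c (ln (1/\<epsilon>) + 1)\<close>, and \<open>exp (\<gamma> (A + 1))\<close> is a power of \<open>\<epsilon>\<close> up to a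
      constant; this is what the logarithmic bound on \<open>\<omega>\<close> is for.\<close>
    define Q where "Q \<epsilon> = (6 * (1 + ((1 / \<epsilon>) / pi)\<^sup>2)) ^ n *
       ((2 * (A + 1) * exp (- c * (ln (1 / \<epsilon>) + 1) * (A + 1)) + 1) ^ m / (1 / 2 * \<epsilon> powr real N))" for \<epsilon> :: real
    have "eps_moderate (\<lambda>\<epsilon>. (6 * (1 + (1 / pi * \<epsilon> powr (-1)) ^ 2)) ^ n *
       ((2 * (A + 1) * (exp (- c * (A + 1)) * \<epsilon> powr (c * (A + 1))) + 1) ^ m * (2 * \<epsilon> powr (- real N))))"
      by (intro eps_moderate_mult eps_moderate_power eps_moderate_add eps_moderate_const eps_moderate_powr)
    then have "eps_moderate Q"
    proof (rule eps_moderate_dom)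
      fix \<epsilon> :: real assume e: "\<epsilon> \<in> {0<..1}"
      have "exp (- c * (ln (1 / \<epsilon>) + 1) * (A + 1)) = exp (- c * (A + 1)) * \<epsilon> powr (c * (A + 1))"
        using e by (simp add: powr_def ln_div exp_add[symmetric] algebra_simps)
      moreover have "(1 / \<epsilon>) / pi = 1 / pi * \<epsilon> powr (-1)" using e by (simp add: powr_minus field_simps)
      moreover have "x / (1 / 2 * \<epsilon> powr real N) = x * (2 * \<epsilon> powr (- real N))" for x
        using e by (simp add: powr_minus field_simps)
      ultimately show "\<bar>Q \<epsilon>\<bar> \<le> \<bar>(6 * (1 + (1 / pi * \<epsilon> powr (-1)) ^ 2)) ^ n *
       ((2 * (A + 1) * (exp (- c * (A + 1)) * \<epsilon> powr (c * (A + 1))) + 1) ^ m * (2 * \<epsilon> powr (- real N)))\<bar>"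
        unfolding Q_def by (simp only: order_refl)
    qed
    then obtain C and N' :: nat where C: "C > 0" "eventually (\<lambda>\<epsilon>. \<bar>Q \<epsilon>\<bar> \<le> C * \<epsilon> powr (- real N')) (at_right 0)"
      by (rule eps_moderate_eventually_le)
    have "0 < 1 / (A + 1)" using A by simp
    note ev = eventually_conj[OF eventually_conj[OF C(2) coeff]
        eventually_conj[OF ev_eps eventually_conj[OF eventually_small[OF \<epsilon>\<^sub>0] eventually_small[OF this]]]]
    obtain \<eta> where \<eta>: "\<eta> \<in> {0<..1}" and
      good: "\<And>\<epsilon>. \<epsilon> \<in> {0<..\<eta>} \<Longrightarrow> (\<bar>Q \<epsilon>\<bar> \<le> C * \<epsilon> powr (- real N') \<and>
         (\<forall>k\<in>freq_index (M \<epsilon>). 1 / 2 * \<epsilon> powr real N \<le> norm (coeff (P \<epsilon> (freq (1 / \<epsilon>) k)) d))) \<and>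
         \<epsilon> \<in> {0<..1} \<and> \<epsilon> \<in> {0<..\<epsilon>\<^sub>0} \<and> \<epsilon> \<in> {0<..1 / (A + 1)}"
      by (rule eventually_epsE[OF ev]) blast
    have "norm (S \<epsilon> f) \<le> C * \<epsilon> powr (- real N') * Cj_norm (cube A \<inter> ?H) (m + 2 * n) f"
      if f: "f \<in> test_functions_on (cube A)" and e: "\<epsilon> \<in> {0<..\<eta>}" for f \<epsilon>
    proof -
      note g = good[OF e]
      have e1: "\<epsilon> \<in> {0<..1}" "\<epsilon> \<le> \<epsilon>\<^sub>0" "A + 1 \<le> 1 / \<epsilon>" using g A by (auto simp: field_simps)
      have "norm (S \<epsilon> f) \<le> Q \<epsilon> * Cj_norm (cube A \<inter> {x. 0 \<le> x $ last_index}) (m + 2 * n) f"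
        unfolding S_def Q_def n_def
      proof (rule approx_solution_bound[OF f A e1(3) M(1)])
        show "0 \<le> - c * (ln (1 / \<epsilon>) + 1)" using c e1(1) by (intro mult_nonneg_nonneg) auto
        show "\<And>k z. poly (P \<epsilon> (freq (1 / \<epsilon>) k)) z = 0 \<Longrightarrow> - (- c * (ln (1 / \<epsilon>) + 1)) \<le> Im z"
          by (rule roots[OF e1(1,2)])
        show "\<And>k. degree (P \<epsilon> (freq (1 / \<epsilon>) k)) \<le> m" unfolding P_def by (rule degree_slice_poly)
        show "0 < 1 / 2 * \<epsilon> powr real N" using e1(1) by simp
        show "\<And>k. k \<in> freq_index (M \<epsilon>) \<Longrightarrow> 1 / 2 * \<epsilon> powr real N \<le> norm (coeff (P \<epsilon> (freq (1 / \<epsilon>) k)) d)"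
          using g by blast
      qed
      also have "\<dots> \<le> C * \<epsilon> powr (- real N') * Cj_norm (cube A \<inter> ?H) (m + 2 * n) f"
      proof (rule mult_right_mono)
        have "closed ?H" by (intro closed_Collect_le continuous_intros)
        then show "0 \<le> Cj_norm (cube A \<inter> ?H) (m + 2 * n) f"
          by (intro Cj_norm_bounds(2) compact_Int_closed compact_cube test_functions_on_smooth[OF f])
      qed (use g in linarith)
      finally show ?thesis .
    qed
    then show "\<exists>(j::nat) (N::nat). \<exists>c>0. \<exists>\<eta>\<in>{0<..1}. \<forall>f\<in>test_functions_on (cube A). \<forall>\<epsilon>\<in>{0<..\<eta>}.
        norm (S \<epsilon> f) \<le> c * \<epsilon> powr (- real N) * Cj_norm (cube A \<inter> ?H) j f"
      using C(1) \<eta> by blast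
  qed
  let ?E = "net_functional S"
  have basic: "?E \<in> Gc_dual_basic" by (rule net_functional_basic[OF net])
  have "?E (transpose_op m a u) = gf_dirac u" if u: "u \<in> Gc" for u
  proof -
    obtain r where r: "compact_rep r u" using compact_rep_ex[OF u] by blast
    then obtain A where A: "A \<ge> 0" "\<And>\<epsilon>. \<epsilon> \<in> {0<..1} \<Longrightarrow> r \<epsilon> \<in> test_functions_on (cube A)" and ru: "gf_represents r u"
      unfolding compact_rep_def by blast
    let ?r = "\<lambda>\<epsilon>. transpose_fun m (\<lambda>\<alpha>. a' \<alpha> \<epsilon>) (r \<epsilon>)"
    have r': "compact_rep ?r (transpose_op m a u)" by (rule compact_rep_transpose[OF repr r])
    let ?\<Lambda> = "\<lambda>\<epsilon>. Cj_norm (cube A) 1 (r \<epsilon>)"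
    have "eps_moderate ?\<Lambda>" using ru by (intro eps_moderate_Cj_norm) (auto simp: gf_represents_def)
    then have "eps_negligible (\<lambda>\<epsilon>. (real n * \<epsilon> powr (-1) * ?\<Lambda> \<epsilon>) * (1 / sqrt (M \<epsilon>)))"
      by (intro eps_negligible_mult eps_moderate_mult eps_moderate_const eps_moderate_powr M(2))
    then have "gc_negligible (\<lambda>\<epsilon>. S \<epsilon> (?r \<epsilon>) - r \<epsilon> 0)"
      unfolding gc_negligible_def
    proof (rule eps_negligible_dom_ev)
      have "0 < 1 / (A + 1)" using A by simp
      note ev = eventually_conj[OF coeff eventually_conj[OF ev_eps eventually_small[OF this]]]
      show "eventually (\<lambda>\<epsilon>. \<bar>norm (S \<epsilon> (?r \<epsilon>) - r \<epsilon> 0)\<bar> \<le> \<bar>(real n * \<epsilon> powr (-1) * ?\<Lambda> \<epsilon>) * (1 / sqrt (M \<epsilon>))\<bar>) (at_right 0)"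
      proof (rule eventually_mono[OF ev])
        fix \<epsilon> assume g: "(\<forall>k\<in>freq_index (M \<epsilon>). 1 / 2 * \<epsilon> powr real N \<le> norm (coeff (P \<epsilon> (freq (1 / \<epsilon>) k)) d)) \<and>
          \<epsilon> \<in> {0<..1} \<and> \<epsilon> \<in> {0<..1 / (A + 1)}"
        then have e: "\<epsilon> \<in> {0<..1}" "A + 1 \<le> 1 / \<epsilon>" using A(1) by (auto simp: field_simps)
        note f = A(2)[OF e(1)]
        have s: "smooth (r \<epsilon>)" by (rule test_functions_on_smooth[OF f])
        have nn: "0 \<le> ?\<Lambda> \<epsilon>" by (rule Cj_norm_bounds(2)[OF compact_cube s])
        have "norm (partial_deriv i (r \<epsilon>) x) \<le> ?\<Lambda> \<epsilon>" for i x
        proof (cases "x \<in> cube A")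
          case True
          have "mi_order (\<lambda>j. if j = i then 1 else 0) \<le> 1" by (simp add: mi_order_def)
          from Cj_norm_upper[OF compact_cube s this True] show ?thesis by (simp add: multi_deriv_unit)
        next
          case False
          then show ?thesis
            using nn test_functions_on_zero[OF test_functions_on_partial[OF compact_imp_closed[OF compact_cube] f]] by simp
        qed
        moreover have "slice_poly m (\<lambda>\<alpha>. a' \<alpha> \<epsilon>) (freq (1 / \<epsilon>) k) \<noteq> 0" if "k \<in> freq_index (M \<epsilon>)" for k
        proof -
          have "0 < 1 / 2 * \<epsilon> powr real N" using e by simp
          also have "\<dots> \<le> norm (coeff (P \<epsilon> (freq (1 / \<epsilon>) k)) d)" using g that by blast
          finally show ?thesis by (auto simp: P_def)
        qed
        ultimately have "norm (S \<epsilon> (?r \<epsilon>) - r \<epsilon> 0) \<le> n * (1 / \<epsilon> / sqrt (M \<epsilon>) * ?\<Lambda> \<epsilon>)"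
          unfolding S_def P_def n_def
          by (intro approx_solution_transpose[OF f A(1) e(2) M(1)]) auto
        also have "\<dots> = (real n * \<epsilon> powr (-1) * ?\<Lambda> \<epsilon>) * (1 / sqrt (M \<epsilon>))"
          using e by (simp add: powr_minus field_simps)
        finally show "\<bar>norm (S \<epsilon> (?r \<epsilon>) - r \<epsilon> 0)\<bar> \<le> \<bar>(real n * \<epsilon> powr (-1) * ?\<Lambda> \<epsilon>) * (1 / sqrt (M \<epsilon>))\<bar>"
          unfolding abs_norm_cancel by (rule order_trans[OF _ abs_ge_self])
      qed
    qed
    from gc_represents_eqI[OF gf_dirac_represents[OF ru] net_moderate[OF net r'] this]
    have "gc_represents (\<lambda>\<epsilon>. S \<epsilon> (?r \<epsilon>)) (gf_dirac u)" .
    with net_functional_represents[OF net r'] show ?thesis by (rule gc_represents_unique)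
  qed
  moreover have "?E \<in> Gc_dual"
    using basic unfolding Gc_dual_basic_def by (elim CollectE conjE)
  ultimately have "fundamental_solution m a ?E"
    unfolding fundamental_solution_def diff_op_def by (intro conjI ballI)
  then show ?thesis
    unfolding evolution_operator_def by (intro bexI[OF _ basic] conjI net_functional_supp[OF net])
qed

end
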